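(* (Directional Poincaré inequality.) Suppose there are constants $C_M,\alpha_M>0$ such that $|M_{ij}|\le C_M[1+|i-j|]^{-(2d+\alpha_M)}$ for all $i,j\in\mathbb{Z}^d$, and suppose there is a constant $\varrho>0$ such that for every finite $\Lambda\subset\mathbb{Z}^d$, every boundary condition $\omega$ and every $h\in H^1(\mu_\Lambda^\omega)$, $\operatorname{var}_{\mu_\Lambda^\omega}(h)\le\frac1\varrho\int|\nabla h|^2d\mu_\Lambda^\omega$. Then there is a constant $C>0$, depending only on $d$, $C_M$, $\alpha_M$, $\varrho$, $\delta$ and $C_\psi$, such that for every finite $\Lambda\subset\mathbb{Z}^d$, every boundary condition $\omega$, every $f\in H^1(\mu_\Lambda^\omega)$ with $\operatorname{supp}f\subset\Lambda$, and every $i\in\Lambda$, the weak solution $\varphi\in H^1(\mu_\Lambda^\omega)$ of $-L\varphi=f-\int f\,d\mu_\Lambda^\omega$ satisfies $$\int|\nabla_i\varphi|^2d\mu_\Lambda^\omega\le C\,\frac{|\operatorname{supp} f|}{(1+\operatorname{dist}(i,\operatorname{supp} f))^{2d+\alpha_M}}\int|\nabla f|^2d\mu_\Lambda^\omega .$$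
   Context: Setting. Fix $d\ge1$, functions $\psi_i:\mathbb{R}\to\mathbb{R}$ (single-site potentials), numbers $s_i\in\mathbb{R}$ (external field), for $i\in\mathbb{Z}^d$, and a symmetric real matrix $(M_{ij})_{i,j\in\mathbb{Z}^d}$. Write $|i|=\max_k|i_k|$ for $i\in\mathbb{Z}^d$. Standing assumptions: there is $\delta>0$ with $\delta+\sum_{j\ne i}|M_{ij}|\le M_{ii}$ for all $i$; and $\psi_i=\psi_{i,b}+\psi_{i,c}$ with a constant $C_\psi$, independent of $i$, such that $\psi_{i,c}''(r)\ge0$ and $|\psi_{i,b}(r)|+|\psi_{i,b}'(r)|\le C_\psi$ for all $r\in\mathbb{R}$. For finite $\Lambda\subset\mathbb{Z}^d$ and $\omega=(\omega_j)_{j\notin\Lambda}$, the finite volume Gibbs measure is the probability measure $d\mu_\Lambda^\omega=\frac1{Z_\Lambda^\omega}e^{-H(x)}dx$ on $\mathbb{R}^\Lambda$ with $$H(x)=\sum_{i\in\Lambda}(\psi_i(x_i)+s_ix_i)+\sum_{i,j\in\Lambda}M_{ij}x_ix_j+2\sum_{i\in\Lambda,j\notin\Lambda}M_{ij}x_i\omega_j .$$ Only well-tempered boundary conditions are considered: $\max_{i\in\Lambda}\sum_{j\notin\Lambda}|M_{ij}||\omega_j|<\infty$. $\nabla_i$ is the partial derivative with respect to $x_i$, $\nabla f=(\nabla_if)_{i\in\Lambda}$, and $H^1(\mu_\Lambda^\omega)$ is the space of functions $f$ of $(x_i)_{i\in\Lambda}$ with $f,\nabla f\in L^2(\mu_\Lambda^\omega)$.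 $\operatorname{supp}f$ is the set of sites on whose spin values $f$ depends, $|\operatorname{supp}f|$ its cardinality, and $\operatorname{dist}$ is the distance for $|\cdot|$. With $L\varphi=\Delta\varphi-\nabla H\cdot\nabla\varphi$, a weak solution of $-L\varphi=f-\int f\,d\mu_\Lambda^\omega$ is $\varphi\in H^1(\mu_\Lambda^\omega)$ such that $\int\nabla\xi\cdot\nabla\varphi\,d\mu_\Lambda^\omega=\int\xi\,(f-\int f\,d\mu_\Lambda^\omega)\,d\mu_\Lambda^\omega$ for all $\xi\in H^1(\mu_\Lambda^\omega)$. *)

theory Defs
  imports "HOL-Analysis.Analysis"
begin

type_synonym 'd site = "(int, 'd) vec"
type_synonym 'd config = "'d site \<Rightarrow> real"

definition site_norm :: "'d::finite site \<Rightarrow> int" where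
  "site_norm i = Max (range (\<lambda>k. \<bar>i $ k\<bar>))"

text \<open>Only used as a divisor of the cardinality of the (finite) set \<open>S\<close>, so the unspecified
  value at \<open>S = {}\<close> plays no role.\<close>

definition site_dist :: "'d::finite site \<Rightarrow> 'd site set \<Rightarrow> int" where
  "site_dist i S = Min ((\<lambda>j. site_norm (i - j)) ` S)"

definition diag_dominant :: "real \<Rightarrow> ('d::finite site \<Rightarrow> 'd site \<Rightarrow> real) \<Rightarrow> bool" where
  "diag_dominant \<delta> M \<longleftrightarrow>
     (\<forall>i. (\<lambda>j. \<bar>M i j\<bar>) summable_on (- {i}) \<and> \<delta> + (\<Sum>\<^sub>\<infinity>j\<in>- {i}. \<bar>M i j\<bar>) \<le> M i i)"

definition perturbed_convex :: "real \<Rightarrow> ('d::finite site \<Rightarrow> real \<Rightarrow> real) \<Rightarrow> bool" where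
  "perturbed_convex C \<psi> \<longleftrightarrow>
     (\<exists>\<psi>b \<psi>c. \<forall>i r. \<psi> i r = \<psi>b i r + \<psi>c i r \<and>
        \<psi>c i differentiable (at r) \<and> deriv (\<psi>c i) differentiable (at r) \<and>
        deriv (deriv (\<psi>c i)) r \<ge> 0 \<and>
        \<psi>b i differentiable (at r) \<and> \<bar>\<psi>b i r\<bar> + \<bar>deriv (\<psi>b i) r\<bar> \<le> C)"

text \<open>A boundary condition is a total function of which only the values outside \<open>\<Lambda>\<close> are used.\<close>

definition well_tempered ::
    "('d::finite site \<Rightarrow> 'd site \<Rightarrow> real) \<Rightarrow> 'd site set \<Rightarrow> 'd config \<Rightarrow> bool" where
  "well_tempered M \<Lambda> \<omega> \<longleftrightarrow> (\<forall>i\<in>\<Lambda>. (\<lambda>j. \<bar>M i j\<bar> * \<bar>\<omega> j\<bar>) summable_on (- \<Lambda>))"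

definition hamiltonian ::
    "('d::finite site \<Rightarrow> real \<Rightarrow> real) \<Rightarrow> ('d site \<Rightarrow> real) \<Rightarrow> ('d site \<Rightarrow> 'd site \<Rightarrow> real) \<Rightarrow>
     'd site set \<Rightarrow> 'd config \<Rightarrow> 'd config \<Rightarrow> real" where
  "hamiltonian \<psi> s M \<Lambda> \<omega> x =
     (\<Sum>i\<in>\<Lambda>. \<psi> i (x i) + s i * x i) + (\<Sum>i\<in>\<Lambda>. \<Sum>j\<in>\<Lambda>. M i j * x i * x j)
     + 2 * (\<Sum>i\<in>\<Lambda>. \<Sum>\<^sub>\<infinity>j\<in>- \<Lambda>. M i j * x i * \<omega> j)"

text \<open>The space \<open>\<real>\<^sup>\<Lambda>\<close> is represented by the extensional functions on \<open>\<Lambda>\<close>.\<close>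

abbreviation cspace :: "'d::finite site set \<Rightarrow> 'd config set" where
  "cspace \<Lambda> \<equiv> \<Pi>\<^sub>E i\<in>\<Lambda>. UNIV"

abbreviation leb :: "'d::finite site set \<Rightarrow> 'd config measure" where
  "leb \<Lambda> \<equiv> \<Pi>\<^sub>M i\<in>\<Lambda>. lborel"

definition gibbs ::
    "('d::finite site \<Rightarrow> real \<Rightarrow> real) \<Rightarrow> ('d site \<Rightarrow> real) \<Rightarrow> ('d site \<Rightarrow> 'd site \<Rightarrow> real) \<Rightarrow>
     'd site set \<Rightarrow> 'd config \<Rightarrow> 'd config measure" where
  "gibbs \<psi> s M \<Lambda> \<omega> =
     (let Z = (\<integral>x. exp (- hamiltonian \<psi> s M \<Lambda> \<omega> x) \<partial>leb \<Lambda>)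
      in density (leb \<Lambda>) (\<lambda>x. ennreal (exp (- hamiltonian \<psi> s M \<Lambda> \<omega> x) / Z)))"

definition partial_deriv :: "'d::finite site \<Rightarrow> ('d config \<Rightarrow> real) \<Rightarrow> 'd config \<Rightarrow> real" where
  "partial_deriv i \<eta> x = deriv (\<lambda>t. \<eta> (x(i := t))) (x i)"

text \<open>Compactly supported continuously differentiable functions on \<open>\<real>\<^sup>\<Lambda>\<close>.\<close>

definition test_fun :: "'d::finite site set \<Rightarrow> ('d config \<Rightarrow> real) \<Rightarrow> bool" where
  "test_fun \<Lambda> \<eta> \<longleftrightarrow>
     continuous_on (cspace \<Lambda>) \<eta> \<and>
     (\<forall>i\<in>\<Lambda>. (\<forall>x\<in>cspace \<Lambda>. (\<lambda>t. \<eta> (x(i := t))) differentiable (at (x i))) \<and>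
             continuous_on (cspace \<Lambda>) (partial_deriv i \<eta>)) \<and>
     (\<exists>R. \<forall>x\<in>cspace \<Lambda>. \<eta> x \<noteq> 0 \<longrightarrow> (\<forall>i\<in>\<Lambda>. \<bar>x i\<bar> \<le> R))"

definition locally_integrable :: "'d::finite site set \<Rightarrow> ('d config \<Rightarrow> real) \<Rightarrow> bool" where
  "locally_integrable \<Lambda> f \<longleftrightarrow> (\<forall>R. set_integrable (leb \<Lambda>) (\<Pi>\<^sub>E i\<in>\<Lambda>. {-R..R}) f)"

definition has_weak_partial ::
    "'d::finite site set \<Rightarrow> 'd site \<Rightarrow> ('d config \<Rightarrow> real) \<Rightarrow> ('d config \<Rightarrow> real) \<Rightarrow> bool" where
  "has_weak_partial \<Lambda> i f g \<longleftrightarrow>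
     locally_integrable \<Lambda> f \<and> locally_integrable \<Lambda> g \<and>
     (\<forall>\<eta>. test_fun \<Lambda> \<eta> \<longrightarrow>
        (\<integral>x. f x * partial_deriv i \<eta> x \<partial>leb \<Lambda>) = - (\<integral>x. g x * \<eta> x \<partial>leb \<Lambda>))"

text \<open>Weak derivatives are unique up to null sets, so the choice of version is immaterial.\<close>

definition weak_partial ::
    "'d::finite site set \<Rightarrow> 'd site \<Rightarrow> ('d config \<Rightarrow> real) \<Rightarrow> 'd config \<Rightarrow> real" where
  "weak_partial \<Lambda> i f = (SOME g. has_weak_partial \<Lambda> i f g)"

definition L2 :: "'a measure \<Rightarrow> ('a \<Rightarrow> real) set" where
  "L2 \<mu> = {f \<in> borel_measurable \<mu>. integrable \<mu> (\<lambda>x. (f x)\<^sup>2)}"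

definition H1 :: "'d::finite site set \<Rightarrow> 'd config measure \<Rightarrow> ('d config \<Rightarrow> real) set" where
  "H1 \<Lambda> \<mu> = {f \<in> L2 \<mu>. \<forall>i\<in>\<Lambda>. (\<exists>g. has_weak_partial \<Lambda> i f g) \<and> weak_partial \<Lambda> i f \<in> L2 \<mu>}"

definition dirichlet ::
    "'d::finite site set \<Rightarrow> 'd config measure \<Rightarrow> ('d config \<Rightarrow> real) \<Rightarrow> ('d config \<Rightarrow> real) \<Rightarrow> real" where
  "dirichlet \<Lambda> \<mu> \<xi> \<phi> = (\<integral>x. (\<Sum>i\<in>\<Lambda>. weak_partial \<Lambda> i \<xi> x * weak_partial \<Lambda> i \<phi> x) \<partial>\<mu>)"

definition poincare :: "real \<Rightarrow> 'd::finite site set \<Rightarrow> 'd config measure \<Rightarrow> bool" where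
  "poincare \<rho> \<Lambda> \<mu> \<longleftrightarrow>
     (\<forall>h\<in>H1 \<Lambda> \<mu>. (\<integral>x. (h x - (\<integral>y. h y \<partial>\<mu>))\<^sup>2 \<partial>\<mu>) \<le> 1 / \<rho> * dirichlet \<Lambda> \<mu> h h)"

definition weak_solution ::
    "'d::finite site set \<Rightarrow> 'd config measure \<Rightarrow> ('d config \<Rightarrow> real) \<Rightarrow> ('d config \<Rightarrow> real) \<Rightarrow> bool" where
  "weak_solution \<Lambda> \<mu> f \<phi> \<longleftrightarrow>
     \<phi> \<in> H1 \<Lambda> \<mu> \<and>
     (\<forall>\<xi>\<in>H1 \<Lambda> \<mu>. dirichlet \<Lambda> \<mu> \<xi> \<phi> = (\<integral>x. \<xi> x * (f x - (\<integral>y. f y \<partial>\<mu>)) \<partial>\<mu>))"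

text \<open>The sites on whose spin values \<open>f\<close> depends. Independence of \<open>x\<^sub>i\<close> is meant almost everywhere,
  which makes the support invariant under modification of \<open>f\<close> on a null set. A function on
  \<open>\<real>\<^sup>\<Lambda>\<close> depends on no spin outside \<open>\<Lambda>\<close>.\<close>

definition site_supp :: "'d::finite site set \<Rightarrow> ('d config \<Rightarrow> real) \<Rightarrow> 'd site set" where
  "site_supp \<Lambda> f = {i \<in> \<Lambda>. \<not> (AE x in leb \<Lambda>. AE t in lborel. f (x(i := t)) = f x)}"

end

theory Submission
  imports Defs "HOL-Probability.Probability"
begin

text \<open>
  For a finite block \<open>A\<close> disjoint from the support of \<open>f\<close>, the weak equation is tested with
  \<open>\<phi> - E \<phi>\<close>, where \<open>E\<close> is the conditional expectation given the spins outside \<open>A\<close>. For \<open>j \<notin> A\<close> the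
  derivative of \<open>E \<phi>\<close> in direction \<open>j\<close> is \<open>E (\<partial>\<^sub>j \<phi>)\<close> minus the conditional covariance of \<open>\<phi>\<close> with
  \<open>2 \<Sum>k\<in>A. M j k * x k\<close>, and the Poincare inequality of the block measure controls this covariance. The result
  bounds \<open>\<Sum>k\<in>A. \<parallel>\<partial>\<^sub>k \<phi>\<parallel>\<^sup>2\<close> by \<open>4 / \<rho>\<^sup>2\<close> times the sum over \<open>k \<in> A\<close> of the squares of
  \<open>\<Sum>j\<notin>A. \<bar>M k j\<bar> * \<parallel>\<partial>\<^sub>j \<phi>\<parallel>\<close>. Averaging over the radii of balls \<open>A\<close> around \<open>i\<close> gains a factor \<open>1 / R\<close>
  per step, so finitely many iterations reach the decay rate of the matrix tail.
\<close>

subsection \<open>Lattice sums and hole filling\<close>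

text \<open>Freezing finitely many spins of a volume yields an admissible boundary condition for the
  rest, so the assumed Poincare inequality holds on every block with the same \<rho>. Testing with
  \<open>\<phi> - E \<phi>\<close> removes the right-hand side because \<open>f\<close> is almost
  surely constant in the block spins, and it keeps the full block energy because
  \<open>E \<phi>\<close> ignores these spins. The obstacle is regularity. Gradients are weak
  derivatives under Lebesgue measure, and the single-site potentials need not be continuously
  differentiable, so the Gibbs density is no admissible factor of a test function. The conditional
  density given the outer spins is better: an outer spin enters it only through the linear field
  that it exerts on the block. Yet its support in the block spins is unbounded, so integration by
  parts is needed for functions that are regular and compactly supported in one direction only.
  Therefore weak derivatives are traded for absolute continuity on lines, which moreover passes to
  sections.\<close>

lemma site_norm_ge: "\<bar>n $ k\<bar> \<le> site_norm (n :: 'd::finite site)"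
  unfolding site_norm_def by (rule Max_ge) auto

lemma site_norm_le_iff: "site_norm (n :: 'd::finite site) \<le> c \<longleftrightarrow> (\<forall>k. \<bar>n $ k\<bar> \<le> c)"
  unfolding site_norm_def by (subst Max_le_iff) auto

lemma site_norm_nonneg: "0 \<le> site_norm (n :: 'd::finite site)"
  using site_norm_ge[of n undefined] by linarith

lemma site_norm_zero [simp]: "site_norm (0 :: 'd::finite site) = 0"
  using site_norm_nonneg[of "0 :: 'd site"] site_norm_le_iff[of "0 :: 'd site" 0] by simp

lemma site_norm_commute: "site_norm (m - n) = site_norm (n - m :: 'd::finite site)"
  by (simp add: site_norm_def abs_minus_commute)

lemma site_norm_triangle:
  "site_norm (a - c) \<le> site_norm (a - b) + site_norm (b - c :: 'd::finite site)"
proof -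
  have "\<bar>(a - c) $ k\<bar> \<le> site_norm (a - b) + site_norm (b - c)" for k
    using site_norm_ge[of "a - b" k] site_norm_ge[of "b - c" k] by simp
  then show ?thesis by (simp add: site_norm_le_iff)
qed

lemma summable_int_powr:
  assumes "b > (1::real)"
  shows "\<exists>K>0. \<forall>R::nat. (\<Sum>m\<in>{- int R..int R}. (1 + \<bar>real_of_int m\<bar>) powr (- b)) \<le> K"
proof -
  have s: "summable (\<lambda>n::nat. (1 + real n) powr (- b))"
  proof -
    have "summable (\<lambda>n::nat. real n powr (- b))"
      using assms by (simp add: summable_real_powr_iff)
    then have "summable (\<lambda>n::nat. real (Suc n) powr (- b))"
      by (subst summable_Suc_iff)
    then show ?thesis by (simp add: add.commute)
  qed
  define T where "T = (\<Sum>n::nat. (1 + real n) powr (- b))"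
  have le: "(\<Sum>n\<le>R. (1 + real n) powr (- b)) \<le> T" for R
    unfolding T_def by (rule sum_le_suminf[OF s]) auto
  have pos: "0 \<le> T" using le[of 0] by simp
  \<comment> \<open>Zero lies in both halves and is counted twice; the extra 1 makes the bound
    strictly positive.\<close>
  have "(\<Sum>m\<in>{- int R..int R}. (1 + \<bar>real_of_int m\<bar>) powr (- b)) \<le> 2 * T + 1" for R :: nat
  proof -
    have "(\<Sum>m\<in>{- int R..int R}. (1 + \<bar>real_of_int m\<bar>) powr (- b))
        \<le> (\<Sum>m\<in>(\<lambda>n. - int n) ` {..R} \<union> int ` {..R}. (1 + \<bar>real_of_int m\<bar>) powr (- b))"
    proof (rule sum_mono2)
      show "{- int R..int R} \<subseteq> (\<lambda>n. - int n) ` {..R} \<union> int ` {..R}"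
      proof
        fix m assume m: "m \<in> {- int R..int R}"
        show "m \<in> (\<lambda>n. - int n) ` {..R} \<union> int ` {..R}"
        proof (cases "0 \<le> m")
          case True
          then have "m = int (nat m)" "nat m \<le> R" using m by auto
          then show ?thesis by blast
        next
          case False
          then have "m = - int (nat (- m))" "nat (- m) \<le> R" using m by auto
          then show ?thesis by blast
        qed
      qed
    qed auto
    also have "\<dots> \<le> (\<Sum>m\<in>(\<lambda>n. - int n) ` {..R}. (1 + \<bar>real_of_int m\<bar>) powr (- b))
        + (\<Sum>m\<in>int ` {..R}. (1 + \<bar>real_of_int m\<bar>) powr (- b))"
      by (subst sum_Un) (auto intro!: sum_nonneg)
    also have "\<dots> = 2 * (\<Sum>n\<le>R. (1 + real n) powr (- b))"
      by (subst (1 2) sum.reindex) (auto simp: inj_on_def)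
    also have "\<dots> \<le> 2 * T + 1" using le[of R] by simp
    finally show ?thesis .
  qed
  then show ?thesis using pos by (intro exI[of _ "2 * T + 1"]) auto
qed

text \<open>A sup-norm ball is a product of intervals. Seen as a \<open>PiE\<close> over the
  coordinates it can be counted with \<open>card_PiE\<close>, and sums of products over it
  factorise.\<close>

lemma bij_betw_cube:
  "bij_betw vec_lambda (PiE UNIV (\<lambda>_::'d::finite. {- c..c})) {n :: 'd site. site_norm n \<le> c}"
  by (rule bij_betw_byWitness[where f' = vec_nth])
    (auto simp: site_norm_le_iff PiE_iff abs_le_iff minus_le_iff)

lemma finite_cube: "finite {n :: 'd::finite site. site_norm n \<le> c}"
  using bij_betw_finite[OF bij_betw_cube[of c, where ?'d = 'd]] by (simp add: finite_PiE)

text \<open>The averaged balls have radii below \<open>2 * R\<close>, hence this radius;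
  \<open>R \<ge> 1\<close> turns the exact side length \<open>4 * R + 1\<close> into a multiple of
  \<open>R\<close>.\<close>

lemma card_cube_le:
  assumes "R \<ge> 1"
  shows "real (card {n :: 'd::finite site. site_norm n \<le> 2 * int R}) \<le> (5 * real R) ^ CARD('d)"
proof -
  have "card {n :: 'd site. site_norm n \<le> 2 * int R} = card (PiE UNIV (\<lambda>_::'d. {- (2 * int R)..2 * int R}))"
    using bij_betw_same_card[OF bij_betw_cube[of "2 * int R", where ?'d = 'd]] by simp
  also have "\<dots> = (4 * R + 1) ^ CARD('d)"
    by (simp add: card_PiE nat_add_distrib nat_mult_distrib)
  finally have "real (card {n :: 'd site. site_norm n \<le> 2 * int R}) = (4 * real R + 1) ^ CARD('d)"
    by (simp add: add.commute)
  also have "\<dots> \<le> (5 * real R) ^ CARD('d)" using assms by (intro power_mono) auto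
  finally show ?thesis .
qed

text \<open>The summand is at most a product over the coordinates, so the lattice sum factorises.\<close>

lemma lattice_sum_bound:
  assumes "\<alpha> > (0::real)"
  shows "\<exists>K>0. \<forall>F :: 'd::finite site set. finite F \<longrightarrow>
    (\<Sum>n\<in>F. (1 + real_of_int (site_norm n)) powr (- (real CARD('d) + \<alpha>))) \<le> K"
proof -
  define d where "d = CARD('d)"
  have d: "real d > 0" unfolding d_def by simp
  \<comment> \<open>The exponent is spread evenly: \<open>d\<close> factors with exponent
    \<open>b\<close> give \<open>d + \<alpha>\<close>, and \<alpha> > 0 keeps each one-dimensional
    series convergent.\<close>
  define b where "b = 1 + \<alpha> / d"
  have b: "b > 1" using assms d by (simp add: b_def)
  have bd: "real d * b = real d + \<alpha>" using d by (simp add: b_def field_simps)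
  obtain K where K: "K > 0"
    and Kb: "\<And>R::nat. (\<Sum>m\<in>{- int R..int R}. (1 + \<bar>real_of_int m\<bar>) powr (- b)) \<le> K"
    using summable_int_powr[OF b] by auto
  have "(\<Sum>n\<in>F. (1 + real_of_int (site_norm n)) powr (- (real d + \<alpha>))) \<le> K ^ d"
    if fin: "finite F" for F :: "'d site set"
  proof -
    define R where "R = nat (Max (insert 0 (site_norm ` F)))"
    have R: "site_norm n \<le> int R" if "n \<in> F" for n
      using fin that unfolding R_def by (simp add: nat_0_le)
    have "(1 + real_of_int (site_norm n)) powr (- (real d + \<alpha>)) \<le> (\<Prod>k\<in>UNIV. (1 + \<bar>real_of_int (n $ k)\<bar>) powr (- b))"
      for n :: "'d site"
    proof -
      have "(1 + real_of_int (site_norm n)) powr (- (real d + \<alpha>)) = (\<Prod>k\<in>(UNIV::'d set). (1 + real_of_int (site_norm n)) powr (- b))"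
        using site_norm_nonneg[of n] unfolding bd[symmetric]
        by (simp add: d_def powr_powr[symmetric] powr_realpow[symmetric] mult.commute[of _ b]
            flip: powr_power) (simp add: powr_powr)
      also have "\<dots> \<le> (\<Prod>k\<in>UNIV. (1 + \<bar>real_of_int (n $ k)\<bar>) powr (- b))"
        using b site_norm_ge[of n]
        by (intro prod_mono conjI powr_mono2') (auto simp flip: of_int_abs)
      finally show ?thesis .
    qed
    then have "(\<Sum>n\<in>F. (1 + real_of_int (site_norm n)) powr (- (real d + \<alpha>)))
        \<le> (\<Sum>n\<in>F. \<Prod>k\<in>UNIV. (1 + \<bar>real_of_int (n $ k)\<bar>) powr (- b))"
      by (rule sum_mono)
    also have "\<dots> \<le> (\<Sum>n\<in>{n :: 'd site. site_norm n \<le> int R}. \<Prod>k\<in>UNIV. (1 + \<bar>real_of_int (n $ k)\<bar>) powr (- b))"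
    proof (rule sum_mono2)
      show "finite {n :: 'd site. site_norm n \<le> int R}" by (rule finite_cube)
      show "F \<subseteq> {n. site_norm n \<le> int R}" using R by auto
    qed (auto intro!: prod_nonneg)
    also have "\<dots> = (\<Sum>g\<in>PiE (UNIV :: 'd set) (\<lambda>_. {- int R..int R}). \<Prod>k\<in>UNIV. (1 + \<bar>real_of_int (g k)\<bar>) powr (- b))"
      by (subst sum.reindex_bij_betw[OF bij_betw_cube, symmetric]) simp
    also have "\<dots> = (\<Prod>k\<in>(UNIV::'d set). \<Sum>m\<in>{- int R..int R}. (1 + \<bar>real_of_int m\<bar>) powr (- b))"
      by (subst prod_sum_PiE) auto
    also have "\<dots> \<le> (\<Prod>k\<in>(UNIV::'d set). K)"
      using Kb by (intro prod_mono conjI sum_nonneg) auto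
    finally show ?thesis by (simp add: d_def)
  qed
  then show ?thesis using K by (intro exI[of _ "K ^ d"]) (auto simp: d_def)
qed

text \<open>Hole filling: the bound on the ball of radius \<open>r\<close> is averaged over \<open>R \<le> r < 2 R\<close>, so that a
  pair \<open>(j, k)\<close> separated by the sphere is counted at most \<open>\<bar>j - k\<bar>\<close> times.\<close>

lemma hole_filling_step:
  fixes M :: "'d::finite site \<Rightarrow> 'd site \<Rightarrow> real" and b :: "'d site \<Rightarrow> real"
  assumes C: "C > 0" and al: "\<alpha> > 0" and Q: "Q \<ge> 0" and fin: "finite \<Lambda>"
    and M: "\<And>i j. \<bar>M i j\<bar> \<le> C * (1 + real_of_int (site_norm (i - j))) powr (- (2 * real CARD('d) + \<alpha>))"
    and b: "\<And>j. b j \<ge> 0"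
    and K: "K > 0" "\<And>F :: 'd site set. finite F \<Longrightarrow>
      (\<Sum>n\<in>F. (1 + real_of_int (site_norm n)) powr (- (real CARD('d) + \<alpha>))) \<le> K"
    and key: "\<And>r. R \<le> r \<Longrightarrow> r < 2 * R \<Longrightarrow>
      (\<Sum>k\<in>{k\<in>\<Lambda>. site_norm (k - i) \<le> int r}. (b k)\<^sup>2) \<le>
      Q * (\<Sum>k\<in>{k\<in>\<Lambda>. site_norm (k - i) \<le> int r}.
            (\<Sum>j\<in>{j\<in>\<Lambda>. \<not> site_norm (j - i) \<le> int r}. \<bar>M k j\<bar> * b j)\<^sup>2)"
    and R: "R \<ge> 1"
  shows "(\<Sum>k\<in>{k\<in>\<Lambda>. site_norm (k - i) \<le> int R}. (b k)\<^sup>2) \<le>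
    2 * Q * C\<^sup>2 * K\<^sup>2 * (\<Sum>k\<in>{k\<in>\<Lambda>. site_norm (k - i) \<le> int (4 * R)}. (b k)\<^sup>2) / real R
    + 2 * Q * 5 ^ CARD('d) * C\<^sup>2 * K * real R powr (- (2 * real CARD('d) + \<alpha>)) * (\<Sum>k\<in>\<Lambda>. (b k)\<^sup>2)"
proof -
  define d where "d = real CARD('d)"
  have d1: "d \<ge> 1" unfolding d_def by (simp add: Suc_leI)
  define A where "A r = {k\<in>\<Lambda>. site_norm (k - i) \<le> int r}" for r :: nat
  \<comment> \<open>The exterior of the ball is cut at radius \<open>4 * R\<close>. Sites beyond it
    are at distance at least \<open>2 * R\<close> from every ball with \<open>r < 2 * R\<close> and
    are treated crudely; for the sites in \<open>N r\<close> the averaging over \<open>r\<close> is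
    needed.\<close>
  define N where "N r = {j\<in>\<Lambda>. \<not> site_norm (j - i) \<le> int r \<and> site_norm (j - i) \<le> int (4 * R)}" for r :: nat
  define Fr where "Fr = {j\<in>\<Lambda>. \<not> site_norm (j - i) \<le> int (4 * R)}"
  define a where "a r = (\<Sum>k\<in>A r. (b k)\<^sup>2)" for r
  define B where "B = (\<Sum>k\<in>\<Lambda>. (b k)\<^sup>2)"
  define w where "w n = 1 + real_of_int (site_norm n)" for n :: "'d site"
  have w1: "w n \<ge> 1" for n unfolding w_def using site_norm_nonneg[of n] by simp
  have finA [simp]: "finite (A r)" "finite (N r)" "finite Fr" for r
    using fin unfolding A_def N_def Fr_def by auto
  have Kk: "(\<Sum>j\<in>F. w (k - j) powr (- (d + \<alpha>))) \<le> K" if "finite F" for F k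
  proof -
    have "(\<Sum>j\<in>F. w (k - j) powr (- (d + \<alpha>))) = (\<Sum>n\<in>(\<lambda>j. k - j) ` F. w n powr (- (d + \<alpha>)))"
      by (subst sum.reindex) (auto simp: inj_on_def)
    also have "\<dots> \<le> K" using K(2)[of "(\<lambda>j. k - j) ` F"] that by (simp add: w_def d_def)
    finally show ?thesis .
  qed
  have Mw: "\<bar>M k j\<bar> \<le> C * w (k - j) powr (- (2 * d + \<alpha>))" for k j
    using M[of k j] by (simp add: w_def d_def)
  have M1: "\<bar>M k j\<bar> \<le> C * w (k - j) powr (- (d + \<alpha>))" for k j
    using Mw[of k j] C d1 w1[of "k - j"]
    by (elim order_trans) (intro mult_left_mono powr_mono, auto)
  have sumM: "(\<Sum>j\<in>F. \<bar>M k j\<bar>) \<le> C * K" if "finite F" for F k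
  proof -
    have "(\<Sum>j\<in>F. \<bar>M k j\<bar>) \<le> (\<Sum>j\<in>F. C * w (k - j) powr (- (d + \<alpha>)))"
      by (intro sum_mono M1)
    also have "\<dots> \<le> C * K" using Kk[OF that, of k] C by (simp add: sum_distrib_left[symmetric])
    finally show ?thesis .
  qed
  have far: "(\<Sum>j\<in>Fr. \<bar>M k j\<bar> * b j)\<^sup>2 \<le> C\<^sup>2 * K * real R powr (- (3 * d + \<alpha>)) * B"
    if k: "k \<in> A r" "r < 2 * R" for k r
  proof -
    \<comment> \<open>The squared kernel decays with exponent \<open>4 * d + 2 * \<alpha>\<close>:
      the part \<open>d + \<alpha>\<close> pays for the sum over \<open>j\<close>, the remaining
      \<open>3 * d + \<alpha>\<close> is evaluated at distance \<open>R\<close>.\<close>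
    have m: "\<bar>M k j\<bar>\<^sup>2 \<le> C\<^sup>2 * real R powr (- (3 * d + \<alpha>)) * w (k - j) powr (- (d + \<alpha>))" if "j \<in> Fr" for j
    proof -
      have "site_norm (j - i) \<le> site_norm (j - k) + site_norm (k - i)" by (rule site_norm_triangle)
      then have "int (2 * R) \<le> site_norm (k - j)"
        using that k by (auto simp: Fr_def A_def site_norm_commute[of k j])
      then have "real_of_int (int (2 * R)) \<le> real_of_int (site_norm (k - j))"
        by (subst of_int_le_iff)
      then have wR: "real R \<le> w (k - j)" by (simp add: w_def)
      have "\<bar>M k j\<bar>\<^sup>2 \<le> (C * w (k - j) powr (- (2 * d + \<alpha>)))\<^sup>2"
        by (intro power_mono Mw) auto
      also have "\<dots> = C\<^sup>2 * (w (k - j) powr (- (3 * d + \<alpha>)) * w (k - j) powr (- (d + \<alpha>)))"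
        using w1[of "k - j"] by (simp add: power_mult_distrib power2_eq_square powr_add[symmetric])
      also have "\<dots> \<le> C\<^sup>2 * (real R powr (- (3 * d + \<alpha>)) * w (k - j) powr (- (d + \<alpha>)))"
        using wR R d1 al by (intro mult_left_mono mult_right_mono powr_mono2') auto
      finally show ?thesis by (simp add: mult.assoc)
    qed
    have "(\<Sum>j\<in>Fr. \<bar>M k j\<bar> * b j)\<^sup>2 \<le> (\<Sum>j\<in>Fr. \<bar>M k j\<bar>\<^sup>2) * (\<Sum>j\<in>Fr. (b j)\<^sup>2)"
      by (rule Cauchy_Schwarz_ineq_sum)
    also have "\<dots> \<le> (C\<^sup>2 * K * real R powr (- (3 * d + \<alpha>))) * B"
    proof (intro mult_mono)
      have "(\<Sum>j\<in>Fr. \<bar>M k j\<bar>\<^sup>2) \<le> (\<Sum>j\<in>Fr. C\<^sup>2 * real R powr (- (3 * d + \<alpha>)) * w (k - j) powr (- (d + \<alpha>)))"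
        by (intro sum_mono m)
      also have "\<dots> \<le> C\<^sup>2 * real R powr (- (3 * d + \<alpha>)) * K"
        unfolding sum_distrib_left[symmetric] using Kk[of Fr k] by (intro mult_left_mono) auto
      finally show "(\<Sum>j\<in>Fr. \<bar>M k j\<bar>\<^sup>2) \<le> C\<^sup>2 * K * real R powr (- (3 * d + \<alpha>))"
        by (simp add: mult_ac)
      show "(\<Sum>j\<in>Fr. (b j)\<^sup>2) \<le> B"
        unfolding B_def Fr_def by (rule sum_mono2) (use fin in auto)
    qed (use K(1) in \<open>auto intro!: sum_nonneg\<close>)
    finally show ?thesis .
  qed
  \<comment> \<open>Splitting the kernel into two square roots keeps one power of it under the sum;
    this power later pays for the number of radii at which a pair is counted.\<close>
  have near: "(\<Sum>j\<in>N r. \<bar>M k j\<bar> * b j)\<^sup>2 \<le> C * K * (\<Sum>j\<in>N r. \<bar>M k j\<bar> * (b j)\<^sup>2)" for k r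
  proof -
    have "(\<Sum>j\<in>N r. \<bar>M k j\<bar> * b j)\<^sup>2 = (\<Sum>j\<in>N r. sqrt \<bar>M k j\<bar> * (sqrt \<bar>M k j\<bar> * b j))\<^sup>2"
      by (simp add: mult.assoc[symmetric])
    also have "\<dots> \<le> (\<Sum>j\<in>N r. (sqrt \<bar>M k j\<bar>)\<^sup>2) * (\<Sum>j\<in>N r. (sqrt \<bar>M k j\<bar> * b j)\<^sup>2)"
      by (rule Cauchy_Schwarz_ineq_sum)
    also have "\<dots> = (\<Sum>j\<in>N r. \<bar>M k j\<bar>) * (\<Sum>j\<in>N r. \<bar>M k j\<bar> * (b j)\<^sup>2)"
      by (simp add: power_mult_distrib)
    also have "\<dots> \<le> C * K * (\<Sum>j\<in>N r. \<bar>M k j\<bar> * (b j)\<^sup>2)"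
      by (intro mult_right_mono sumM sum_nonneg) auto
    finally show ?thesis .
  qed
  have card_A: "real (card (A r)) \<le> 5 ^ CARD('d) * real R ^ CARD('d)" if "r < 2 * R" for r
  proof -
    have "(\<lambda>k. k - i) ` A r \<subseteq> {n. site_norm n \<le> 2 * int R}" using that by (auto simp: A_def)
    then have "card ((\<lambda>k. k - i) ` A r) \<le> card {n :: 'd site. site_norm n \<le> 2 * int R}"
      by (intro card_mono finite_cube)
    moreover have "card ((\<lambda>k. k - i) ` A r) = card (A r)" by (intro card_image) (auto simp: inj_on_def)
    ultimately have "real (card (A r)) \<le> real (card {n :: 'd site. site_norm n \<le> 2 * int R})" by simp
    also have "\<dots> \<le> 5 ^ CARD('d) * real R ^ CARD('d)" using card_cube_le[OF R, where ?'d = 'd] by (simp add: power_mult_distrib)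
    finally show ?thesis .
  qed
  define E where "E = 2 * Q * 5 ^ CARD('d) * C\<^sup>2 * K * real R powr (- (2 * d + \<alpha>)) * B"
  \<comment> \<open>Summing the far part over \<open>k\<close> costs the volume of the ball, and
    exactly the decay \<open>2 * d + \<alpha>\<close> of the claim is left.\<close>
  have Rp: "real R ^ CARD('d) * real R powr (- (3 * d + \<alpha>)) = real R powr (- (2 * d + \<alpha>))"
    using R by (simp add: d_def powr_realpow[symmetric] powr_add[symmetric])
  have B0: "B \<ge> 0" unfolding B_def by (intro sum_nonneg) auto
  have one: "a r \<le> 2 * Q * C * K * (\<Sum>k\<in>A r. \<Sum>j\<in>N r. \<bar>M k j\<bar> * (b j)\<^sup>2) + E"
    if r: "R \<le> r" "r < 2 * R" for r
  proof -
    have spl: "{j\<in>\<Lambda>. \<not> site_norm (j - i) \<le> int r} = N r \<union> Fr" "N r \<inter> Fr = {}"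
      using r by (auto simp: N_def Fr_def)
    have "a r \<le> Q * (\<Sum>k\<in>A r. (\<Sum>j\<in>N r \<union> Fr. \<bar>M k j\<bar> * b j)\<^sup>2)"
      using key[OF r] unfolding a_def A_def spl by simp
    also have "\<dots> \<le> Q * (\<Sum>k\<in>A r. 2 * (C * K * (\<Sum>j\<in>N r. \<bar>M k j\<bar> * (b j)\<^sup>2))
        + 2 * (C\<^sup>2 * K * real R powr (- (3 * d + \<alpha>)) * B))"
    proof (intro mult_left_mono sum_mono Q)
      fix k assume k: "k \<in> A r"
      have "(\<Sum>j\<in>N r \<union> Fr. \<bar>M k j\<bar> * b j)\<^sup>2 = ((\<Sum>j\<in>N r. \<bar>M k j\<bar> * b j) + (\<Sum>j\<in>Fr. \<bar>M k j\<bar> * b j))\<^sup>2"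
        by (subst sum.union_disjoint) (use spl in auto)
      also have "\<dots> \<le> 2 * (\<Sum>j\<in>N r. \<bar>M k j\<bar> * b j)\<^sup>2 + 2 * (\<Sum>j\<in>Fr. \<bar>M k j\<bar> * b j)\<^sup>2"
        using sum_squares_bound[of "\<Sum>j\<in>N r. \<bar>M k j\<bar> * b j" "\<Sum>j\<in>Fr. \<bar>M k j\<bar> * b j"]
        by (simp add: power2_sum)
      also have "\<dots> \<le> 2 * (C * K * (\<Sum>j\<in>N r. \<bar>M k j\<bar> * (b j)\<^sup>2))
        + 2 * (C\<^sup>2 * K * real R powr (- (3 * d + \<alpha>)) * B)"
        by (intro add_mono mult_left_mono near far[OF k r(2)]) auto
      finally show "(\<Sum>j\<in>N r \<union> Fr. \<bar>M k j\<bar> * b j)\<^sup>2 \<le> 2 * (C * K * (\<Sum>j\<in>N r. \<bar>M k j\<bar> * (b j)\<^sup>2))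
        + 2 * (C\<^sup>2 * K * real R powr (- (3 * d + \<alpha>)) * B)" .
    qed
    also have "\<dots> = 2 * Q * C * K * (\<Sum>k\<in>A r. \<Sum>j\<in>N r. \<bar>M k j\<bar> * (b j)\<^sup>2)
        + (2 * Q * C\<^sup>2 * K * real R powr (- (3 * d + \<alpha>)) * B) * real (card (A r))"
      by (simp add: sum.distrib sum_distrib_left algebra_simps)
    also have "(2 * Q * C\<^sup>2 * K * real R powr (- (3 * d + \<alpha>)) * B) * real (card (A r))
      \<le> (2 * Q * C\<^sup>2 * K * real R powr (- (3 * d + \<alpha>)) * B) * (5 ^ CARD('d) * real R ^ CARD('d))"
      using Q K(1) B0 by (intro mult_left_mono card_A r) auto
    also have "\<dots> = 2 * Q * C\<^sup>2 * K * B * 5 ^ CARD('d) * (real R ^ CARD('d) * real R powr (- (3 * d + \<alpha>)))"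
      by (simp add: mult_ac)
    also have "\<dots> = E" unfolding Rp E_def by (simp add: mult_ac)
    finally show ?thesis by simp
  qed
  have cnt: "(\<Sum>r\<in>{R..<2*R}. \<Sum>k\<in>A r. \<Sum>j\<in>N r. \<bar>M k j\<bar> * (b j)\<^sup>2) \<le> C * K * a (4 * R)"
  proof -
    have "(\<Sum>r\<in>{R..<2*R}. \<Sum>k\<in>A r. \<Sum>j\<in>N r. \<bar>M k j\<bar> * (b j)\<^sup>2)
      = (\<Sum>r\<in>{R..<2*R}. \<Sum>k\<in>\<Lambda>. \<Sum>j\<in>A (4 * R). if k \<in> A r \<and> j \<in> N r then \<bar>M k j\<bar> * (b j)\<^sup>2 else 0)"
    proof (rule sum.cong[OF refl])
      fix r
      have "(\<Sum>k\<in>A r. \<Sum>j\<in>N r. \<bar>M k j\<bar> * (b j)\<^sup>2) =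
        (\<Sum>k\<in>A r. \<Sum>j\<in>A (4 * R). if k \<in> A r \<and> j \<in> N r then \<bar>M k j\<bar> * (b j)\<^sup>2 else 0)"
        by (intro sum.cong refl sum.mono_neutral_cong_left) (auto simp: N_def A_def fin)
      also have "\<dots> = (\<Sum>k\<in>\<Lambda>. \<Sum>j\<in>A (4 * R). if k \<in> A r \<and> j \<in> N r then \<bar>M k j\<bar> * (b j)\<^sup>2 else 0)"
        by (intro sum.mono_neutral_cong_left) (auto simp: A_def fin)
      finally show "(\<Sum>k\<in>A r. \<Sum>j\<in>N r. \<bar>M k j\<bar> * (b j)\<^sup>2) = \<dots>" .
    qed
    also have "\<dots> = (\<Sum>j\<in>A (4 * R). \<Sum>k\<in>\<Lambda>. \<Sum>r\<in>{R..<2*R}. if k \<in> A r \<and> j \<in> N r then \<bar>M k j\<bar> * (b j)\<^sup>2 else 0)"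
    proof -
      have "(\<Sum>r\<in>X. \<Sum>k\<in>Y. \<Sum>j\<in>Z. h r k j) = (\<Sum>j\<in>Z. \<Sum>k\<in>Y. \<Sum>r\<in>X. h r k j)"
        for h :: "nat \<Rightarrow> 'd site \<Rightarrow> 'd site \<Rightarrow> real" and X Y Z
        by (simp add: sum.swap[of _ Y X] sum.swap[of _ Z X] sum.swap[of _ Z Y])
      then show ?thesis .
    qed
    also have "\<dots> \<le> (\<Sum>j\<in>A (4 * R). \<Sum>k\<in>\<Lambda>. C * w (j - k) powr (- (d + \<alpha>)) * (b j)\<^sup>2)"
    proof (intro sum_mono)
      fix j k
      define nk nj where "nk = site_norm (k - i)" and "nj = site_norm (j - i)"
      have nkj: "nk \<ge> 0" "nj \<ge> 0" by (auto simp: nk_def nj_def site_norm_nonneg)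
      have tri: "nj \<le> site_norm (k - j) + nk"
        using site_norm_triangle[of j i k] by (simp add: nk_def nj_def site_norm_commute[of k j])
      have "(\<Sum>r\<in>{R..<2*R}. if k \<in> A r \<and> j \<in> N r then \<bar>M k j\<bar> * (b j)\<^sup>2 else 0)
        = real (card {r\<in>{R..<2*R}. k \<in> A r \<and> j \<in> N r}) * (\<bar>M k j\<bar> * (b j)\<^sup>2)"
        by (subst sum.inter_filter[symmetric]) auto
      also have "\<dots> \<le> w (k - j) * (\<bar>M k j\<bar> * (b j)\<^sup>2)"
      proof (rule mult_right_mono)
        \<comment> \<open>Membership of \<open>k\<close> in the ball means
          \<open>nk \<le> r\<close>, membership of \<open>j\<close> in the exterior means
          \<open>r < nj\<close>: the admissible radii lie in an interval of length
          \<open>nj - nk\<close>.\<close>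
        have "{r\<in>{R..<2*R}. k \<in> A r \<and> j \<in> N r} \<subseteq> {nat nk..<nat nj}"
          using nkj by (auto simp: A_def N_def nk_def nj_def)
        then have "card {r\<in>{R..<2*R}. k \<in> A r \<and> j \<in> N r} \<le> nat nj - nat nk"
          using card_mono[of "{nat nk..<nat nj}"] by simp
        also have "\<dots> \<le> nat (site_norm (k - j))" using tri nkj by linarith
        finally have "int (card {r\<in>{R..<2*R}. k \<in> A r \<and> j \<in> N r}) \<le> site_norm (k - j)"
          using site_norm_nonneg[of "k - j"] by linarith
        then have "real_of_int (int (card {r\<in>{R..<2*R}. k \<in> A r \<and> j \<in> N r})) \<le> real_of_int (site_norm (k - j))"
          by (subst of_int_le_iff)
        then show "real (card {r\<in>{R..<2*R}. k \<in> A r \<and> j \<in> N r}) \<le> w (k - j)"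
          by (simp add: w_def)
      qed auto
      also have "\<dots> \<le> C * w (j - k) powr (- (d + \<alpha>)) * (b j)\<^sup>2"
      proof -
        \<comment> \<open>The multiplicity costs one power of the distance. Since
          \<open>d \<ge> 1\<close>, the exponent \<open>2 * d + \<alpha> - 1\<close> is still at
          least the summable \<open>d + \<alpha>\<close>.\<close>
        have "w (k - j) * \<bar>M k j\<bar> \<le> w (k - j) powr 1 * (C * w (k - j) powr (- (2 * d + \<alpha>)))"
          using w1[of "k - j"] by (intro mult_mono Mw) auto
        also have "\<dots> = C * w (k - j) powr (1 - (2 * d + \<alpha>))"
          using w1[of "k - j"] by (simp add: powr_add powr_diff powr_minus field_simps)
        also have "\<dots> \<le> C * w (k - j) powr (- (d + \<alpha>))"
          using w1[of "k - j"] d1 C by (intro mult_left_mono powr_mono) auto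
        finally have "w (k - j) * \<bar>M k j\<bar> \<le> C * w (j - k) powr (- (d + \<alpha>))"
          by (simp add: w_def site_norm_commute[of k j])
        then show ?thesis by (simp add: mult.assoc[symmetric] mult_right_mono)
      qed
      finally show "(\<Sum>r\<in>{R..<2*R}. if k \<in> A r \<and> j \<in> N r then \<bar>M k j\<bar> * (b j)\<^sup>2 else 0)
        \<le> C * w (j - k) powr (- (d + \<alpha>)) * (b j)\<^sup>2" .
    qed
    also have "\<dots> = (\<Sum>j\<in>A (4 * R). C * (b j)\<^sup>2 * (\<Sum>k\<in>\<Lambda>. w (j - k) powr (- (d + \<alpha>))))"
      by (simp add: sum_distrib_left mult_ac)
    also have "\<dots> \<le> (\<Sum>j\<in>A (4 * R). C * (b j)\<^sup>2 * K)"
      using C by (intro sum_mono mult_left_mono Kk fin) auto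
    also have "\<dots> = C * K * a (4 * R)" by (simp add: a_def sum_distrib_left mult_ac)
    finally show ?thesis .
  qed
  \<comment> \<open>\<open>a\<close> grows with the radius, so \<open>a R\<close> is at most each of
    the \<open>R\<close> averaged terms; the division by \<open>R\<close> is the gain of the
    step.\<close>
  have "real R * a R = (\<Sum>r\<in>{R..<2*R}. a R)" by simp
  also have "\<dots> \<le> (\<Sum>r\<in>{R..<2*R}. a r)"
    unfolding a_def A_def by (intro sum_mono sum_mono2) (use fin in auto)
  also have "\<dots> \<le> (\<Sum>r\<in>{R..<2*R}. 2 * Q * C * K * (\<Sum>k\<in>A r. \<Sum>j\<in>N r. \<bar>M k j\<bar> * (b j)\<^sup>2) + E)"
    by (intro sum_mono one) auto
  also have "\<dots> = 2 * Q * C * K * (\<Sum>r\<in>{R..<2*R}. \<Sum>k\<in>A r. \<Sum>j\<in>N r. \<bar>M k j\<bar> * (b j)\<^sup>2) + real R * E"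
    by (simp add: sum.distrib sum_distrib_left)
  also have "\<dots> \<le> 2 * Q * C * K * (C * K * a (4 * R)) + real R * E"
    using cnt C Q K(1) by (intro add_mono mult_left_mono) auto
  finally have "a R \<le> 2 * Q * C\<^sup>2 * K\<^sup>2 * a (4 * R) / real R + E"
    using R by (simp add: field_simps power2_eq_square)
  then show ?thesis by (simp add: a_def A_def E_def B_def d_def)
qed

text \<open>One hole filling step replaces \<open>a R\<close> by a multiple of
  \<open>a (4 * R) / R\<close> up to an error of the final order, so every iteration gains one power
  of \<open>R\<close>, starting from the trivial bound by the total energy. The hypothesis is
  available for radii below \<open>m\<close> only, which forces the initial radius to be a fixed
  fraction of \<open>m\<close>.\<close>

lemma decay_of_hole_filling:
  fixes C \<alpha> Q :: real
  assumes C: "C > 0" and al: "\<alpha> > 0" and Q: "Q \<ge> 0"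
  shows "\<exists>C'>0. \<forall>(M :: 'd::finite site \<Rightarrow> 'd site \<Rightarrow> real) b \<Lambda> i m.
    (\<forall>i j. \<bar>M i j\<bar> \<le> C * (1 + real_of_int (site_norm (i - j))) powr (- (2 * real CARD('d) + \<alpha>))) \<longrightarrow>
    finite \<Lambda> \<longrightarrow> i \<in> \<Lambda> \<longrightarrow> (\<forall>j. b j \<ge> 0) \<longrightarrow>
    (\<forall>r<m. (\<Sum>k\<in>{k\<in>\<Lambda>. site_norm (k - i) \<le> int r}. (b k)\<^sup>2) \<le>
      Q * (\<Sum>k\<in>{k\<in>\<Lambda>. site_norm (k - i) \<le> int r}.
            (\<Sum>j\<in>{j\<in>\<Lambda>. \<not> site_norm (j - i) \<le> int r}. \<bar>M k j\<bar> * b j)\<^sup>2)) \<longrightarrow>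
    (b i)\<^sup>2 \<le> C' * (1 + real m) powr (- (2 * real CARD('d) + \<alpha>)) * (\<Sum>k\<in>\<Lambda>. (b k)\<^sup>2)"
proof -
  define p where "p = 2 * real CARD('d) + \<alpha>"
  have p: "p > 0" using al by (simp add: p_def)
  obtain K where K: "K > 0" "\<And>F :: 'd site set. finite F \<Longrightarrow>
      (\<Sum>n\<in>F. (1 + real_of_int (site_norm n)) powr (- (real CARD('d) + \<alpha>))) \<le> K"
    using lattice_sum_bound[OF al, where ?'d = 'd] by blast
  define C1 where "C1 = 2 * Q * C\<^sup>2 * K\<^sup>2"
  define C2 where "C2 = 2 * Q * 5 ^ CARD('d) * C\<^sup>2 * K"
  have C12: "C1 \<ge> 0" "C2 \<ge> 0" using Q K by (auto simp: C1_def C2_def)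
  \<comment> \<open>Constants of the iteration: the old coefficient times \<open>C1\<close>, plus
    the far-field error \<open>C2\<close>.\<close>
  define D where "D = rec_nat 1 (\<lambda>_ x. C1 * x + C2)"
  have D0: "D 0 = 1" and DS: "D (Suc n) = C1 * D n + C2" for n by (auto simp: D_def)
  have Dpos: "D n \<ge> 0" for n by (induction n) (use C12 in \<open>auto simp: D0 DS\<close>)
  define N where "N = nat \<lceil>p\<rceil>"
  have N: "real N \<ge> p" unfolding N_def by linarith
  \<comment> \<open>The radius grows by the factor 4 in each of \<open>N\<close> steps, and a step
    looks at radii below twice its own; starting from \<open>R = m div L\<close> keeps all of them
    below \<open>m\<close>.\<close>
  define L :: nat where "L = 2 * 4 ^ N"
  have L: "L \<ge> 1" by (simp add: L_def)
  \<comment> \<open>For \<open>m \<ge> L\<close> one has \<open>1 + m \<le> 2 * L * R\<close>,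
    whence the power of \<open>2 * L\<close>. The added 1 makes the constant positive and covers
    \<open>m < L\<close>, where the total energy is a sufficient bound.\<close>
  define C' where "C' = (D N + 1) * (2 * real L) powr p"
  have C'pos: "C' > 0" using Dpos[of N] L by (auto simp: C'_def intro!: mult_pos_pos)
  have main: "(b i)\<^sup>2 \<le> C' * (1 + real m) powr (- p) * (\<Sum>k\<in>\<Lambda>. (b k)\<^sup>2)"
    if M: "\<And>i j. \<bar>M i j\<bar> \<le> C * (1 + real_of_int (site_norm (i - j))) powr (- (2 * real CARD('d) + \<alpha>))"
      and fin: "finite \<Lambda>" and i: "i \<in> \<Lambda>" and b: "\<And>j. b j \<ge> 0"
      and key: "\<And>r. r < m \<Longrightarrow> (\<Sum>k\<in>{k\<in>\<Lambda>. site_norm (k - i) \<le> int r}. (b k)\<^sup>2) \<le>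
      Q * (\<Sum>k\<in>{k\<in>\<Lambda>. site_norm (k - i) \<le> int r}.
            (\<Sum>j\<in>{j\<in>\<Lambda>. \<not> site_norm (j - i) \<le> int r}. \<bar>M k j\<bar> * b j)\<^sup>2)"
    for M :: "'d site \<Rightarrow> 'd site \<Rightarrow> real" and b \<Lambda> i m
  proof -
    define B where "B = (\<Sum>k\<in>\<Lambda>. (b k)\<^sup>2)"
    have B0: "B \<ge> 0" unfolding B_def by (intro sum_nonneg) auto
    define a where "a r = (\<Sum>k\<in>{k\<in>\<Lambda>. site_norm (k - i) \<le> int r}. (b k)\<^sup>2)" for r :: nat
    have aB: "a r \<le> B" for r unfolding a_def B_def by (rule sum_mono2) (use fin in auto)
    have bi: "(b i)\<^sup>2 \<le> a r" for r
      unfolding a_def by (rule member_le_sum) (use i fin in auto)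
    have step: "a R \<le> C1 * a (4 * R) / real R + C2 * real R powr (- p) * B"
      if "R \<ge> 1" "2 * R \<le> m" for R
      unfolding a_def B_def C1_def C2_def p_def
      by (rule hole_filling_step[OF C al Q fin M b K _ that(1)]) (use that key in auto)
    have it: "a R \<le> D n * real R powr (- min (real n) p) * B" if "R \<ge> 1" "2 * 4 ^ n * R \<le> m" for n R
      using that
    proof (induction n arbitrary: R)
      case 0
      then show ?case using aB[of R] p by (simp add: D0)
    next
      case (Suc n)
      have "1 * R \<le> 4 ^ Suc n * R" by (intro mult_right_mono one_le_power) auto
      then have "2 * R \<le> m" using Suc.prems(2) by linarith
      have "a (4 * R) \<le> D n * real (4 * R) powr (- min (real n) p) * B"
        using Suc.prems by (intro Suc.IH) (auto simp: algebra_simps)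
      also have "\<dots> \<le> D n * real R powr (- min (real n) p) * B"
        using Dpos B0 p Suc.prems(1) by (intro mult_right_mono mult_left_mono powr_mono2') auto
      finally have ih: "a (4 * R) \<le> D n * real R powr (- min (real n) p) * B" .
      have "a R \<le> C1 * a (4 * R) / real R + C2 * real R powr (- p) * B"
        by (rule step) (use Suc.prems(1) \<open>2 * R \<le> m\<close> in auto)
      also have "\<dots> \<le> C1 * (D n * real R powr (- min (real n) p) * B) / real R + C2 * real R powr (- p) * B"
        using ih C12 by (intro add_mono divide_right_mono mult_left_mono) auto
      also have "\<dots> = C1 * D n * B * real R powr (- min (real n) p - 1) + C2 * B * real R powr (- p)"
        using Suc.prems(1) by (simp add: powr_diff field_simps)
      also have "\<dots> \<le> C1 * D n * B * real R powr (- min (real (Suc n)) p) + C2 * B * real R powr (- min (real (Suc n)) p)"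
        using Suc.prems(1) C12 Dpos B0 by (intro add_mono mult_left_mono powr_mono) auto
      also have "\<dots> = D (Suc n) * real R powr (- min (real (Suc n)) p) * B"
        by (simp add: DS algebra_simps)
      finally show ?case .
    qed
    show ?thesis
    proof (cases "L \<le> m")
      case True
      define R where "R = m div L"
      have R1: "R \<ge> 1" using True L by (simp add: R_def Suc_leI div_greater_zero_iff)
      have "m < L * (R + 1)" unfolding R_def using L
        by (metis Suc_eq_plus1 div_less_iff_less_mult lessI mult.commute not_less_eq_eq One_nat_def Suc_le_lessD)
      also have "L * (R + 1) \<le> L * (2 * R)" using R1 by (intro mult_left_mono) auto
      finally have "1 + real m \<le> 2 * real L * real R"
        by (metis Suc_leI mult.assoc mult.left_commute of_nat_Suc of_nat_le_iff of_nat_mult of_nat_numeral)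
      then have "(2 * real L * real R) powr (- p) \<le> (1 + real m) powr (- p)"
        using p by (intro powr_mono2') auto
      then have "(2 * real L) powr (- p) * real R powr (- p) \<le> (1 + real m) powr (- p)"
        by (simp add: powr_mult)
      then have "(2 * real L) powr p * ((2 * real L) powr (- p) * real R powr (- p)) \<le> (2 * real L) powr p * (1 + real m) powr (- p)"
        by (intro mult_left_mono) auto
      then have Rm: "real R powr (- p) \<le> (2 * real L) powr p * (1 + real m) powr (- p)"
        using L by (simp add: powr_minus field_simps)
      have "(b i)\<^sup>2 \<le> a R" by (rule bi)
      also have "\<dots> \<le> D N * real R powr (- min (real N) p) * B"
        by (rule it[OF R1]) (simp add: R_def L_def[symmetric])
      also have "min (real N) p = p" using N by simp
      also have "D N * real R powr (- p) * B \<le> (D N + 1) * ((2 * real L) powr p * (1 + real m) powr (- p)) * B"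
        using Dpos[of N] B0 Rm by (intro mult_right_mono mult_mono) auto
      finally show ?thesis by (simp add: C'_def B_def mult_ac)
    next
      case False
      have "(1 + real m) powr p \<le> (2 * real L) powr p" using False p L by (intro powr_mono2) auto
      then have "1 \<le> (2 * real L) powr p * (1 + real m) powr (- p)"
        by (simp add: powr_minus field_simps)
      also have "\<dots> \<le> C' * (1 + real m) powr (- p)"
        unfolding C'_def using Dpos[of N] by (intro mult_right_mono) (auto simp: mult_le_cancel_right1)
      finally have "1 * B \<le> C' * (1 + real m) powr (- p) * B" using B0 by (intro mult_right_mono)
      moreover have "(b i)\<^sup>2 \<le> B" using bi[of 0] aB[of 0] by linarith
      ultimately show ?thesis by (simp add: B_def)
    qed
  qed
  show ?thesis
    unfolding p_def[symmetric]
    by (rule exI[of _ C'], intro conjI C'pos allI impI, rule main) (auto simp: p_def)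
qed

subsection \<open>Differentiation of Laplace transforms\<close>

lemma abs_exp_minus_one_le: "\<bar>exp a - 1\<bar> \<le> \<bar>a\<bar> * exp \<bar>a\<bar>" for a :: real
proof (cases "0 \<le> a")
  case True
  have "1 - a \<le> exp (- a)" using exp_ge_add_one_self[of "- a"] by simp
  then have "(1 - a) * exp a \<le> exp (- a) * exp a" by (intro mult_right_mono) auto
  then show ?thesis using True by (simp add: algebra_simps exp_minus)
next
  case False
  have "1 - exp a \<le> - a" using exp_ge_add_one_self[of a] by linarith
  also have "\<dots> \<le> - a * exp (- a)" using False by (intro mult_le_cancel_left1[THEN iffD2]) auto
  finally show ?thesis using False by simp
qed

text \<open>Dominates difference quotients of exponentials by two tilts free of absolute values, the
  form in which integrability is assumed below.\<close>

lemma abs_le_exp_abs: "\<bar>l\<bar> * exp (T * \<bar>l\<bar>) \<le> exp ((T + 1) * l) + exp (- (T + 1) * l)"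
  if "T \<ge> 0" for l T :: real
proof -
  have "\<bar>l\<bar> \<le> exp \<bar>l\<bar>" using exp_ge_add_one_self[of "\<bar>l\<bar>"] by linarith
  then have "\<bar>l\<bar> * exp (T * \<bar>l\<bar>) \<le> exp \<bar>l\<bar> * exp (T * \<bar>l\<bar>)" by (intro mult_right_mono) auto
  also have "\<dots> = exp ((T + 1) * \<bar>l\<bar>)" by (simp add: exp_add[symmetric] algebra_simps)
  also have "\<dots> \<le> exp ((T + 1) * l) + exp (- (T + 1) * l)"
    by (cases "l \<ge> 0") (auto simp: algebra_simps)
  finally show ?thesis .
qed

text \<open>A factor \<open>l\<close> is dominated by tilting further by 1 in both directions. As
  the hypothesis ranges over all \<open>t\<close>, the conclusion again has its form, so higher
  moments follow by repetition.\<close>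

lemma integrable_mult_Laplace:
  fixes G l :: "'a \<Rightarrow> real"
  assumes [measurable]: "G \<in> borel_measurable M" "l \<in> borel_measurable M"
    and int: "\<And>t. integrable M (\<lambda>y. G y * exp (t * l y))"
  shows "integrable M (\<lambda>y. G y * l y * exp (t * l y))"
proof (rule Bochner_Integration.integrable_bound)
  show "integrable M (\<lambda>y. norm (G y * exp ((t + 1) * l y)) + norm (G y * exp ((t - 1) * l y)))"
    by (intro Bochner_Integration.integrable_add integrable_norm int)
  show "AE y in M. norm (G y * l y * exp (t * l y))
    \<le> norm (norm (G y * exp ((t + 1) * l y)) + norm (G y * exp ((t - 1) * l y)))"
  proof (rule AE_I2)
    fix y
    have "\<bar>l y\<bar> \<le> exp (l y) + exp (- l y)" using abs_le_exp_abs[of 0 "l y"] by simp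
    then have "\<bar>G y\<bar> * \<bar>l y\<bar> * exp (t * l y) \<le> \<bar>G y\<bar> * (exp (l y) + exp (- l y)) * exp (t * l y)"
      by (intro mult_left_mono mult_right_mono) auto
    also have "\<dots> = \<bar>G y\<bar> * exp ((t + 1) * l y) + \<bar>G y\<bar> * exp ((t - 1) * l y)"
      by (simp add: algebra_simps exp_add exp_diff exp_minus field_simps)
    finally show "norm (G y * l y * exp (t * l y))
    \<le> norm (norm (G y * exp ((t + 1) * l y)) + norm (G y * exp ((t - 1) * l y)))"
      by (simp add: abs_mult)
  qed
qed simp

text \<open>Dominated convergence along an arbitrary sequence of increments. With a bound
  \<open>T\<close> for the increments, the difference quotients are dominated by the tilts at
  \<open>t + (T + 1)\<close> and \<open>t - (T + 1)\<close>.\<close>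

lemma DERIV_Laplace:
  fixes G l :: "'a \<Rightarrow> real"
  assumes [measurable]: "G \<in> borel_measurable M" "l \<in> borel_measurable M"
    and int: "\<And>t. integrable M (\<lambda>y. G y * exp (t * l y))"
  shows "((\<lambda>t. \<integral>y. G y * exp (t * l y) \<partial>M) has_real_derivative
    (\<integral>y. G y * l y * exp (t * l y) \<partial>M)) (at t)"
  unfolding has_field_derivative_iff tendsto_at_iff_sequentially
proof (intro allI impI)
  fix X :: "nat \<Rightarrow> real" assume X: "\<forall>i. X i \<in> UNIV - {t}" "X \<longlonglongrightarrow> t"
  define h where "h i = X i - t" for i
  have h0: "h i \<noteq> 0" for i using X by (simp add: h_def)
  have hlim: "h \<longlonglongrightarrow> 0" unfolding h_def using X(2) by (simp add: LIM_zero)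
  have "Bseq h" by (rule convergent_imp_Bseq) (use hlim in \<open>auto simp: convergent_def\<close>)
  then obtain T where T: "T > 0" "\<And>i. \<bar>h i\<bar> \<le> T" by (auto simp: Bseq_def)
  define s where "s i y = G y * exp (t * l y) * ((exp (h i * l y) - 1) / h i)" for i y
  have eq: "((\<integral>y. G y * exp (X i * l y) \<partial>M) - (\<integral>y. G y * exp (t * l y) \<partial>M)) / (X i - t) = (\<integral>y. s i y \<partial>M)" for i
  proof -
    have "(\<integral>y. G y * exp (X i * l y) \<partial>M) - (\<integral>y. G y * exp (t * l y) \<partial>M)
      = (\<integral>y. G y * exp (X i * l y) - G y * exp (t * l y) \<partial>M)"
      by (rule Bochner_Integration.integral_diff[symmetric]) (rule int)+
    also have "\<dots> / (X i - t) = (\<integral>y. (G y * exp (X i * l y) - G y * exp (t * l y)) / (X i - t) \<partial>M)"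
      by simp
    also have "(\<lambda>y. (G y * exp (X i * l y) - G y * exp (t * l y)) / (X i - t)) = s i"
    proof
      fix y
      have "exp (X i * l y) = exp (t * l y) * exp (h i * l y)"
        by (simp add: h_def algebra_simps flip: exp_add)
      then show "(G y * exp (X i * l y) - G y * exp (t * l y)) / (X i - t) = s i y"
        by (simp add: s_def h_def algebra_simps diff_divide_distrib)
    qed
    finally show ?thesis .
  qed
  have "(\<lambda>i. \<integral>y. s i y \<partial>M) \<longlonglongrightarrow> (\<integral>y. G y * l y * exp (t * l y) \<partial>M)"
  proof (rule integral_dominated_convergence)
    show "integrable M (\<lambda>y. norm (G y * exp ((t + (T + 1)) * l y)) + norm (G y * exp ((t - (T + 1)) * l y)))"
      by (intro Bochner_Integration.integrable_add integrable_norm int)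
    show "AE y in M. (\<lambda>i. s i y) \<longlonglongrightarrow> G y * l y * exp (t * l y)"
    proof (rule AE_I2)
      fix y
      have "((\<lambda>u. exp (u * l y)) has_real_derivative l y) (at 0)"
        by (auto intro!: derivative_eq_intros)
      then have "(\<lambda>i. (exp (h i * l y) - 1) / h i) \<longlonglongrightarrow> l y"
        unfolding has_field_derivative_iff tendsto_at_iff_sequentially
        using h0 hlim by (auto simp: comp_def)
      then have "(\<lambda>i. G y * exp (t * l y) * ((exp (h i * l y) - 1) / h i)) \<longlonglongrightarrow> G y * exp (t * l y) * l y"
        by (rule tendsto_mult_left)
      then show "(\<lambda>i. s i y) \<longlonglongrightarrow> G y * l y * exp (t * l y)"
        by (simp add: s_def mult_ac)
    qed
    show "AE y in M. norm (s i y) \<le> norm (G y * exp ((t + (T + 1)) * l y)) + norm (G y * exp ((t - (T + 1)) * l y))" for i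
    proof (rule AE_I2)
      fix y
      have "\<bar>(exp (h i * l y) - 1) / h i\<bar> \<le> (\<bar>h i * l y\<bar> * exp \<bar>h i * l y\<bar>) / \<bar>h i\<bar>"
        unfolding abs_divide by (intro divide_right_mono abs_exp_minus_one_le) auto
      also have "\<dots> = \<bar>l y\<bar> * exp (\<bar>h i\<bar> * \<bar>l y\<bar>)" using h0[of i] by (simp add: abs_mult)
      also have "\<dots> \<le> \<bar>l y\<bar> * exp (T * \<bar>l y\<bar>)" using T(2)[of i] by (intro mult_left_mono) (auto intro: mult_right_mono)
      also have "\<dots> \<le> exp ((T + 1) * l y) + exp (- (T + 1) * l y)" using T(1) by (intro abs_le_exp_abs) auto
      finally have "\<bar>G y * exp (t * l y)\<bar> * \<bar>(exp (h i * l y) - 1) / h i\<bar> \<le> \<bar>G y * exp (t * l y)\<bar> * (exp ((T + 1) * l y) + exp (- (T + 1) * l y))"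
        by (rule mult_left_mono) auto
      also have "\<dots> = norm (G y * exp ((t + (T + 1)) * l y)) + norm (G y * exp ((t - (T + 1)) * l y))"
        by (simp add: abs_mult algebra_simps flip: exp_add)
      finally show "norm (s i y) \<le> norm (G y * exp ((t + (T + 1)) * l y)) + norm (G y * exp ((t - (T + 1)) * l y))"
        by (simp add: s_def abs_mult)
    qed
  qed (simp_all add: s_def)
  then show "((\<lambda>y. ((\<integral>ya. G ya * exp (y * l ya) \<partial>M) - (\<integral>y. G y * exp (t * l y) \<partial>M)) / (y - t)) \<circ> X)
    \<longlonglongrightarrow> (\<integral>y. G y * l y * exp (t * l y) \<partial>M)"
    by (simp add: comp_def eq)
qed

subsection \<open>Smooth approximation of intervals\<close>

text \<open>A compactly supported, continuously differentiable approximation of an open interval by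
  an explicit formula: the square of a positive part is continuously differentiable, and
  \<open>1 - 1 / (1 + n * q)\<close> tends to 1 for \<open>q > 0\<close> and is 0 for
  \<open>q = 0\<close>. For \<open>n = 0\<close> the function vanishes identically.\<close>

definition bump :: "real \<Rightarrow> real \<Rightarrow> nat \<Rightarrow> real \<Rightarrow> real" where
  "bump a b n t = 1 - 1 / (1 + real n * (max 0 ((t - a) * (b - t)))\<^sup>2)"

definition dbump :: "real \<Rightarrow> real \<Rightarrow> nat \<Rightarrow> real \<Rightarrow> real" where
  "dbump a b n t = real n * (2 * max 0 ((t - a) * (b - t)) * (a + b - 2 * t))
     / (1 + real n * (max 0 ((t - a) * (b - t)))\<^sup>2)\<^sup>2"

lemma DERIV_max_0_square: "((\<lambda>x. (max 0 x)\<^sup>2) has_real_derivative 2 * max 0 x) (at x)"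
proof (cases "x = 0")
  case False
  show ?thesis
  proof (cases "x > 0")
    case True
    have "((\<lambda>x. x\<^sup>2) has_real_derivative 2 * max 0 x) (at x)"
      using True by (auto intro!: derivative_eq_intros)
    then show ?thesis
      by (rule DERIV_cong_ev[THEN iffD1, rotated -1, OF _ refl _ refl])
        (use True eventually_nhds_in_open[of "{0<..}" x] in \<open>auto elim!: eventually_mono\<close>)
  next
    case *: False
    have "((\<lambda>x. 0) has_real_derivative 2 * max 0 x) (at x)"
      using * by (auto intro!: derivative_eq_intros)
    then show ?thesis
      by (rule DERIV_cong_ev[THEN iffD1, rotated -1, OF _ refl _ refl])
        (use * False eventually_nhds_in_open[of "{..<0}" x] in \<open>auto elim!: eventually_mono\<close>)
  qed
next
  case True
  have "((\<lambda>y. (max 0 y)\<^sup>2 / y) \<longlongrightarrow> 0) (at (0::real))"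
  proof (rule Lim_null_comparison)
    show "((\<lambda>y. \<bar>y\<bar>) \<longlongrightarrow> 0) (at (0::real))" by (auto intro!: tendsto_eq_intros)
    show "\<forall>\<^sub>F y in at (0::real). norm ((max 0 y)\<^sup>2 / y) \<le> \<bar>y\<bar>"
      by (intro always_eventually allI) (auto simp: max_def power2_eq_square)
  qed
  then show ?thesis using True by (simp add: has_field_derivative_iff)
qed

lemma bump_denominator_pos: "1 + real n * (max 0 x)\<^sup>2 > 0"
  by (intro add_pos_nonneg mult_nonneg_nonneg) auto

lemma DERIV_bump: "(bump a b n has_real_derivative dbump a b n t) (at t)"
proof -
  have "((\<lambda>t. (t - a) * (b - t)) has_real_derivative (a + b - 2 * t)) (at t)"
    by (auto intro!: derivative_eq_intros simp: algebra_simps)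
  then have "((\<lambda>t. (max 0 ((t - a) * (b - t)))\<^sup>2) has_real_derivative
    (2 * max 0 ((t - a) * (b - t))) * (a + b - 2 * t)) (at t)"
    using DERIV_chain2[OF DERIV_max_0_square] by fast
  moreover have "((\<lambda>t. 1 - 1 / (1 + real n * Q t)) has_real_derivative real n * Q' / (1 + real n * Q t)\<^sup>2) (at t)"
    if "(Q has_real_derivative Q') (at t)" "1 + real n * Q t > 0" for Q Q'
    using that by (auto intro!: derivative_eq_intros simp: power2_eq_square)
  ultimately show ?thesis
    unfolding bump_def [abs_def] dbump_def
    using bump_denominator_pos[of n "(t - a) * (b - t)"] by blast
qed

lemma isCont_dbump: "isCont (dbump a b n) t"
  unfolding dbump_def [abs_def]
  using bump_denominator_pos[of n "(t - a) * (b - t)"]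
  by (intro continuous_intros) auto

lemma isCont_bump: "isCont (bump a b n) t"
  by (rule DERIV_isCont[OF DERIV_bump])

lemma continuous_on_bump: "continuous_on S (bump a b n)"
  using isCont_bump by (auto intro!: continuous_at_imp_continuous_on)

lemma bump_measurable [measurable]: "bump a b n \<in> borel_measurable borel"
  by (rule borel_measurable_continuous_onI[OF continuous_on_bump])

lemma bump_bounds: "0 \<le> bump a b n t" "bump a b n t \<le> 1"
  using bump_denominator_pos[of n "(t - a) * (b - t)"] by (auto simp: bump_def field_simps)

lemma bump_outside: "a \<le> b \<Longrightarrow> t \<notin> {a<..<b} \<Longrightarrow> bump a b n t = 0"
proof -
  assume "a \<le> b" "t \<notin> {a<..<b}"
  then have "(t - a) * (b - t) \<le> 0"
    by (cases "t \<le> a") (auto intro: mult_nonneg_nonpos mult_nonpos_nonneg)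
  then show ?thesis by (simp add: bump_def max_def)
qed

lemma bump_pos: "t \<in> {a<..<b} \<Longrightarrow> 0 < bump a b (Suc n) t"
proof -
  assume "t \<in> {a<..<b}"
  then have q: "(t - a) * (b - t) > 0" by simp
  then have "0 < real (Suc n) * ((t - a) * (b - t))\<^sup>2"
    by (intro mult_pos_pos zero_less_power q) simp
  then show ?thesis using q unfolding bump_def by (simp add: max_def del: of_nat_Suc)
qed

lemma bump_tendsto: "a \<le> b \<Longrightarrow> (\<lambda>n. bump a b n t) \<longlonglongrightarrow> indicator {a<..<b} t"
proof (cases "t \<in> {a<..<b}")
  case True
  then have q: "(max 0 ((t - a) * (b - t)))\<^sup>2 > 0" by (auto simp: max_def not_less mult_le_0_iff)
  have "(\<lambda>n. 1 - 1 / (1 + real n * c)) \<longlonglongrightarrow> 1" if "c > 0" for c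
    using that by real_asymp
  from this[OF q] show ?thesis using True by (simp add: bump_def)
qed (simp add: bump_outside)

text \<open>The primitive is normalised to vanish to the left of the support; the zero mean makes it
  vanish to the right as well.\<close>

lemma compact_support_antiderivative:
  fixes g :: "real \<Rightarrow> real"
  assumes cont: "\<And>t. isCont g t" and supp: "\<And>t. t \<notin> {-R<..<R} \<Longrightarrow> g t = 0"
    and int: "(\<integral>t. g t \<partial>lborel) = 0" and R: "R \<ge> 0"
  obtains \<theta> where "\<And>t. (\<theta> has_real_derivative g t) (at t)" "\<And>t. \<bar>t\<bar> \<ge> R \<Longrightarrow> \<theta> t = 0"
proof -
  obtain F where F: "\<And>t. (F has_real_derivative g t) (at t)"
    using einterval_antiderivative[of "-\<infinity>" "\<infinity>" g] cont
    by (auto simp: has_real_derivative_iff_has_vector_derivative)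
  have FTC: "(\<integral>x. g x * indicator {a .. b} x \<partial>lborel) = F b - F a" if "a \<le> b" for a b
    using that by (intro integral_FTC_Icc_real F cont)
  have l: "F t = F (-R)" if "t \<le> -R" for t
  proof -
    have "(\<lambda>x. g x * indicator {t .. -R} x) = (\<lambda>x. 0)"
      using supp by (auto simp: indicator_def fun_eq_iff)
    then show ?thesis using FTC[OF that] by simp
  qed
  have r: "F t = F (-R)" if "R \<le> t" for t
  proof -
    have "g x * indicator {-R .. t} x = g x" for x
      using supp[of x] that by (cases "x \<in> {-R<..<R}") (auto simp: indicator_def)
    then have "(\<lambda>x. g x * indicator {-R .. t} x) = g" by blast
    then show ?thesis using FTC[of "-R" t] that R int by simp
  qed
  show ?thesis
  proof (rule that[of "\<lambda>t. F t - F (-R)"])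
    show "((\<lambda>t. F t - F (-R)) has_real_derivative g t) (at t)" for t
      using DERIV_diff[OF F DERIV_const] by simp
    show "F t - F (-R) = 0" if "\<bar>t\<bar> \<ge> R" for t
      using l[of t] r[of t] that by (cases "t \<ge> 0") auto
  qed
qed

text \<open>As \<open>g\<close> is merely integrable, the formula comes from Fubini on the triangle
  \<open>r \<le> t\<close>. The condition \<open>\<eta> R = 0\<close> suffices: at the left end the
  boundary term vanishes together with the primitive.\<close>

lemma integral_primitive_by_parts:
  fixes g D \<eta> :: "real \<Rightarrow> real"
  assumes g: "set_integrable lborel {-R..R} g" and D: "\<And>t. isCont D t"
    and \<eta>: "\<And>t. (\<eta> has_real_derivative D t) (at t)" and R: "\<eta> R = 0"
  shows "set_integrable lborel {-R..R} (\<lambda>t. (LBINT r:{-R..t}. g r) * D t)" (is ?int)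
    and "(LBINT t:{-R..R}. (LBINT r:{-R..t}. g r) * D t) = - (LBINT t:{-R..R}. g t * \<eta> t)" (is ?eq)
proof -
  define g0 where "g0 r = indicator {-R..R} r * g r" for r
  have g0: "integrable lborel g0" using g by (simp add: set_integrable_def g0_def[abs_def])
  then have [measurable]: "g0 \<in> borel_measurable borel" by simp
  have Dc: "continuous_on S D" for S using D by (auto intro!: continuous_at_imp_continuous_on)
  then have [measurable]: "D \<in> borel_measurable borel" by (intro borel_measurable_continuous_onI)
  have "bounded (D ` {-R..R})" by (rule compact_imp_bounded[OF compact_continuous_image[OF Dc compact_Icc]])
  then obtain K where K: "\<And>t. t \<in> {-R..R} \<Longrightarrow> \<bar>D t\<bar> \<le> K"
    unfolding bounded_iff by (metis imageI real_norm_def)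
  define h where "h t r = indicator {-R..R} t * D t * (if r \<le> t then g0 r else 0)" for t r
  have h_int: "integrable (lborel \<Otimes>\<^sub>M lborel) (case_prod h)"
  proof (rule Bochner_Integration.integrable_bound)
    show "integrable (lborel \<Otimes>\<^sub>M lborel) (\<lambda>(t, r). (indicator {-R..R} t * K) * g0 r)"
    proof (rule lborel_pair.Fubini_integrable)
      have "integrable lborel (indicator {-R..R} :: real \<Rightarrow> real)" by (simp add: emeasure_lborel_Icc_eq)
      then show "integrable lborel (\<lambda>t. \<integral>r. norm (case (t, r) of (t, r) \<Rightarrow> indicator {-R..R} t * K * g0 r) \<partial>lborel)"
        by (simp add: abs_mult)
    qed (use g0 in \<open>auto simp: split_beta'\<close>)
    show "(\<lambda>(t, r). h t r) \<in> borel_measurable (lborel \<Otimes>\<^sub>M lborel)"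
      unfolding h_def by measurable
    show "AE x in lborel \<Otimes>\<^sub>M lborel. norm (case x of (t, r) \<Rightarrow> h t r) \<le> norm (case x of (t, r) \<Rightarrow> indicator {-R..R} t * K * g0 r)"
    proof (rule AE_I2, clarify)
      fix t r
      show "norm (h t r) \<le> norm (indicator {-R..R} t * K * g0 r)"
      proof (cases "t \<in> {-R..R} \<and> r \<le> t")
        case True
        then have "\<bar>D t\<bar> * \<bar>g0 r\<bar> \<le> \<bar>K\<bar> * \<bar>g0 r\<bar>" using K[of t] by (intro mult_right_mono) auto
        then show ?thesis using True by (simp add: h_def abs_mult)
      qed (auto simp: h_def)
    qed
  qed
  have h_eq: "indicator {-R..R} t *\<^sub>R ((\<integral>r. indicator {-R..t} r *\<^sub>R g r \<partial>lborel) * D t) = (\<integral>r. h t r \<partial>lborel)" for t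
  proof -
    have "(\<integral>r. h t r \<partial>lborel) = (\<integral>r. (indicator {-R..R} t * D t) * (indicator {-R..t} r * g r) \<partial>lborel)"
      by (rule Bochner_Integration.integral_cong) (auto simp: h_def g0_def indicator_def)
    then show ?thesis by simp
  qed
  show ?int
    using lborel_pair.integrable_fst[OF h_int]
    by (simp add: set_integrable_def set_lebesgue_integral_def h_eq[unfolded real_scaleR_def])
  have "(LBINT t:{-R..R}. (LBINT r:{-R..t}. g r) * D t) = (\<integral>t. \<integral>r. h t r \<partial>lborel \<partial>lborel)"
    unfolding set_lebesgue_integral_def h_eq ..
  also have "\<dots> = (\<integral>r. \<integral>t. h t r \<partial>lborel \<partial>lborel)"
    by (rule lborel_pair.Fubini_integral[symmetric]) (rule h_int)
  also have "\<dots> = (\<integral>r. - (indicator {-R..R} r *\<^sub>R (g r * \<eta> r)) \<partial>lborel)"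
  proof (rule Bochner_Integration.integral_cong[OF refl])
    fix r
    show "(\<integral>t. h t r \<partial>lborel) = - (indicator {-R..R} r *\<^sub>R (g r * \<eta> r))"
    proof (cases "r \<in> {-R..R}")
      case True
      have "(\<integral>t. h t r \<partial>lborel) = (\<integral>t. g r * (D t * indicator {r..R} t) \<partial>lborel)"
        using True by (intro Bochner_Integration.integral_cong) (auto simp: h_def g0_def indicator_def)
      also have "\<dots> = g r * (\<eta> R - \<eta> r)"
        using True by (subst integral_mult_right_zero, subst integral_FTC_Icc_real) (auto intro: \<eta> D)
      finally show ?thesis using True R by simp
    next
      case False
      then have "h t r = 0" for t by (auto simp: h_def g0_def)
      then show ?thesis using False by simp
    qed
  qed
  finally show ?eq by (simp add: set_lebesgue_integral_def)
qed

subsection \<open>Vanishing of functions that annihilate boxes\<close>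

abbreviation lebn :: "'i set \<Rightarrow> ('i \<Rightarrow> real) measure" where
  "lebn I \<equiv> \<Pi>\<^sub>M i\<in>I. lborel"

interpretation lebn: product_sigma_finite "\<lambda>_. lborel :: real measure"
  by standard

lemma sigma_finite_lebn: "finite I \<Longrightarrow> sigma_finite_measure (lebn I)"
  by (rule lebn.sigma_finite)

lemma sets_lebn_boxes:
  assumes "finite I"
  shows "sets (lebn I) = sigma_sets (PiE I (\<lambda>_. UNIV)) {PiE I (\<lambda>i. {a i<..<b i}) | a b. True}"
proof -
  define E where "E = range (\<lambda>(a, b). {a<..<b::real})"
  have "sets (lebn I) = sets (\<Pi>\<^sub>M i\<in>I. sigma UNIV E)"
    by (rule sets_PiM_cong) (simp_all add: borel_eq_box E_def box_real)
  also have "\<dots> = sets (sigma (PiE I (\<lambda>_. UNIV)) {{f \<in> PiE I (\<lambda>_. UNIV). \<forall>i\<in>j. f i \<in> A i} | A j. j \<in> {I} \<and> A \<in> Pi j (\<lambda>_. E)})"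
  proof (rule sets_PiM_sigma)
    have "(UNIV :: real set) = (\<Union>n. {- real n<..<real n})"
    proof (intro equalityI subsetI)
      fix x :: real
      obtain n where "\<bar>x\<bar> < real n" using reals_Archimedean2 by blast
      then show "x \<in> (\<Union>n. {- real n<..<real n})" by (auto simp: abs_less_iff intro!: exI[of _ n])
    qed simp
    then show "\<exists>S\<subseteq>E. countable S \<and> UNIV = \<Union> S" if "i \<in> I" for i
      by (intro exI[of _ "range (\<lambda>n. {- real n<..<real n})"]) (auto simp: E_def)
  qed (use assms in auto)
  also have "{{f \<in> PiE I (\<lambda>_. UNIV). \<forall>i\<in>j. f i \<in> A i} | A j. j \<in> {I} \<and> A \<in> Pi j (\<lambda>_. E)}
     = {PiE I (\<lambda>i. {a i<..<b i}) | a b. True}"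
  proof (safe, goal_cases)
    case (1 _ A)
    then have "\<forall>i\<in>I. \<exists>p. A i = {fst p<..<snd p}" by (auto simp: E_def Pi_iff image_iff)
    then obtain p where p: "\<And>i. i \<in> I \<Longrightarrow> A i = {fst (p i)<..<snd (p i)}" by metis
    show ?case by (rule exI[of _ "\<lambda>i. fst (p i)"], rule exI[of _ "\<lambda>i. snd (p i)"]) (auto simp: p PiE_iff extensional_def)
  next
    case (2 _ a b)
    show ?case by (rule exI[of _ "\<lambda>i. {a i<..<b i}"]) (auto simp: E_def PiE_iff extensional_def)
  qed
  finally show ?thesis by (subst (asm) sets_measure_of) (auto simp: PiE_iff)
qed

text \<open>The positive and the negative part of \<open>F\<close> define measures that agree on
  open boxes. These are stable under intersection and generate the sigma-algebra, so the measures
  coincide, and then so do their densities.\<close>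

lemma AE_zero_of_boxes:
  fixes F :: "('i \<Rightarrow> real) \<Rightarrow> real"
  assumes I: "finite I" and F: "integrable (lebn I) F"
    and zero: "\<And>a b. (\<And>i. i \<in> I \<Longrightarrow> a i < b i) \<Longrightarrow>
      (\<integral>x. F x * indicator (PiE I (\<lambda>i. {a i<..<b i})) x \<partial>lebn I) = 0"
  shows "AE x in lebn I. F x = 0"
proof -
  interpret sigma_finite_measure "lebn I" by (rule sigma_finite_lebn[OF I])
  have [measurable]: "F \<in> borel_measurable (lebn I)" using F by auto
  define E where "E = {PiE I (\<lambda>i. {a i<..<b i :: real}) | a b. True}"
  have boxm: "PiE I (\<lambda>i. {a i<..<b i}) \<in> sets (lebn I)" for a b :: "'i \<Rightarrow> real"
    using I by (intro sets_PiM_I_finite) auto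
  have zero': "(\<integral>x. F x * indicator X x \<partial>lebn I) = 0" if X: "X \<in> E" for X
  proof -
    obtain a b where ab: "X = PiE I (\<lambda>i. {a i<..<b i})" using X by (auto simp: E_def)
    show ?thesis
    proof (cases "\<forall>i\<in>I. a i < b i")
      case False
      then obtain i where "i \<in> I" "b i \<le> a i" by (auto simp: not_less)
      then have "X = {}" unfolding ab by (auto simp: PiE_eq_empty_iff)
      then show ?thesis by simp
    qed (use zero[of a b] ab in auto)
  qed
  have fin: "(\<integral>\<^sup>+x. ennreal (s * F x) * indicator X x \<partial>lebn I) = ennreal (\<integral>x. max 0 (s * F x) * indicator X x \<partial>lebn I)"
    if [measurable]: "X \<in> sets (lebn I)" for X s
  proof -
    have "(\<integral>\<^sup>+x. ennreal (s * F x) * indicator X x \<partial>lebn I) = (\<integral>\<^sup>+x. ennreal (max 0 (s * F x) * indicator X x) \<partial>lebn I)"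
      by (intro nn_integral_cong) (auto simp: indicator_def max_def ennreal_neg)
    also have "\<dots> = ennreal (\<integral>x. max 0 (s * F x) * indicator X x \<partial>lebn I)"
      by (rule nn_integral_eq_integral)
        (auto intro!: integrable_real_mult_indicator integrable_max F)
    finally show ?thesis .
  qed
  \<comment> \<open>\<open>ennreal\<close> truncates negative numbers to zero, so the two densities
    are the positive and the negative part of \<open>F\<close>.\<close>
  have "density (lebn I) (\<lambda>x. ennreal (1 * F x)) = density (lebn I) (\<lambda>x. ennreal ((-1) * F x))"
  proof (rule measure_eqI_generator_eq[where \<Omega> = "PiE I (\<lambda>_. UNIV)" and E = E
        and A = "\<lambda>n. PiE I (\<lambda>i. {- real n<..<real n})"])
    show "Int_stable E"
    proof (rule Int_stableI)
      fix X Y assume "X \<in> E" "Y \<in> E"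
      then obtain a b c d where "X = PiE I (\<lambda>i. {a i<..<b i})" "Y = PiE I (\<lambda>i. {c i<..<d i})"
        by (auto simp: E_def)
      then have "X \<inter> Y = PiE I (\<lambda>i. {max (a i) (c i)<..<min (b i) (d i)})"
        by (auto simp: PiE_iff)
      then show "X \<inter> Y \<in> E"
        unfolding E_def by (intro CollectI exI conjI TrueI)
    qed
    show "emeasure (density (lebn I) (\<lambda>x. ennreal (1 * F x))) X = emeasure (density (lebn I) (\<lambda>x. ennreal ((-1) * F x))) X"
      if X: "X \<in> E" for X
    proof -
      have Xm [measurable]: "X \<in> sets (lebn I)" using X boxm by (auto simp: E_def)
      have "(\<integral>x. max 0 (1 * F x) * indicator X x \<partial>lebn I) - (\<integral>x. max 0 ((-1) * F x) * indicator X x \<partial>lebn I)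
        = (\<integral>x. max 0 (1 * F x) * indicator X x - max 0 ((-1) * F x) * indicator X x \<partial>lebn I)"
        by (rule Bochner_Integration.integral_diff[symmetric])
          (auto intro!: integrable_real_mult_indicator integrable_max F)
      also have "\<dots> = (\<integral>x. F x * indicator X x \<partial>lebn I)"
        by (intro Bochner_Integration.integral_cong) (auto simp: max_def indicator_def)
      finally show ?thesis
        using zero'[OF X] fin[OF Xm, of 1] fin[OF Xm, of "-1"] by (simp add: emeasure_density)
    qed
    have "PiE I (\<lambda>i. {- real n<..<real n}) \<in> E" for n
      unfolding E_def by (intro CollectI exI conjI TrueI) (rule refl)
    then show "range (\<lambda>n. PiE I (\<lambda>i. {- real n<..<real n})) \<subseteq> E" by blast
    show "(\<Union>n. PiE I (\<lambda>i. {- real n<..<real n})) = PiE I (\<lambda>_. UNIV)"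
    proof (intro equalityI subsetI)
      fix x :: "'i \<Rightarrow> real" assume x: "x \<in> PiE I (\<lambda>_. UNIV)"
      obtain n where n: "(if I = {} then 0 else Max ((\<lambda>i. \<bar>x i\<bar>) ` I)) < real n"
        using reals_Archimedean2 by blast
      have "\<bar>x i\<bar> < real n" if "i \<in> I" for i
        using n that I Max_ge[of "(\<lambda>i. \<bar>x i\<bar>) ` I" "\<bar>x i\<bar>"] by (auto split: if_splits)
      then have "x i \<in> {- real n<..<real n}" if "i \<in> I" for i
        using that by (force simp: abs_less_iff)
      then have "x \<in> PiE I (\<lambda>i. {- real n<..<real n})" using x by (simp add: PiE_iff)
      then show "x \<in> (\<Union>n. PiE I (\<lambda>i. {- real n<..<real n}))" by blast
    qed (auto simp: PiE_iff)
    show "emeasure (density (lebn I) (\<lambda>x. ennreal (1 * F x))) (PiE I (\<lambda>i. {- real n<..<real n})) \<noteq> \<infinity>" for n :: nat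
      using fin[OF boxm, of 1] boxm by (simp add: emeasure_density)
  qed (auto simp: sets_lebn_boxes[OF I] E_def PiE_iff)
  then have "AE x in lebn I. ennreal (1 * F x) = ennreal ((-1) * F x)"
    by (subst (asm) density_unique_iff) auto
  then show ?thesis
  proof eventually_elim
    case (elim x)
    then show ?case
      using ennreal_eq_0_iff[of "F x"] ennreal_eq_0_iff[of "- F x"] ennreal_neg[of "F x"] ennreal_neg[of "- F x"]
      by (cases "F x \<ge> 0") auto
  qed
qed

text \<open>Product bumps converge boundedly to indicators of boxes, which reduces the claim to
  boxes. Only bumps inside the cube are tested, so that integrability of \<open>F\<close> on this
  cube is enough.\<close>

lemma AE_zero_of_bumps:
  fixes F :: "('i \<Rightarrow> real) \<Rightarrow> real"
  defines "Q \<equiv> \<lambda>I R. PiE I (\<lambda>_. {-R<..<R})"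
  assumes I: "finite I" and F: "integrable (lebn I) (\<lambda>x. F x * indicator (Q I R) x)"
    and zero: "\<And>a b n. (\<And>i. i \<in> I \<Longrightarrow> -R \<le> a i \<and> a i < b i \<and> b i \<le> R) \<Longrightarrow>
      (\<integral>x. F x * (\<Prod>i\<in>I. bump (a i) (b i) n (x i)) \<partial>lebn I) = 0"
  shows "AE x in lebn I. x \<in> Q I R \<longrightarrow> F x = 0"
proof -
  let ?F = "\<lambda>x. F x * indicator (Q I R) x"
  have Fm [measurable]: "?F \<in> borel_measurable (lebn I)" using F by auto
  have "AE x in lebn I. ?F x = 0"
  proof (rule AE_zero_of_boxes[OF I F])
    fix a b :: "'i \<Rightarrow> real"
    \<comment> \<open>An arbitrary box is clipped to the cube, outside of which the truncated
      function vanishes.\<close>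
    define a' where "a' i = max (a i) (- R)" for i
    define b' where "b' i = min (b i) R" for i
    have box: "?F x * indicator (PiE I (\<lambda>i. {a i<..<b i})) x = ?F x * indicator (PiE I (\<lambda>i. {a' i<..<b' i})) x" for x
      by (auto simp: indicator_def Q_def a'_def b'_def PiE_iff)
    have "(\<integral>x. ?F x * indicator (PiE I (\<lambda>i. {a' i<..<b' i})) x \<partial>lebn I) = 0"
    proof (cases "\<forall>i\<in>I. a' i < b' i")
      case False
      then obtain i where "i \<in> I" "b' i \<le> a' i" by (auto simp: not_less)
      then have "PiE I (\<lambda>i. {a' i<..<b' i}) = {}" by (auto simp: PiE_eq_empty_iff)
      then show ?thesis by simp
    next
      case True
      have bm [measurable]: "PiE I (\<lambda>i. {a' i<..<b' i}) \<in> sets (lebn I)"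
        using I by (intro sets_PiM_I_finite) auto
      have "(\<lambda>n. \<integral>x. ?F x * (\<Prod>i\<in>I. bump (a' i) (b' i) n (x i)) \<partial>lebn I)
        \<longlonglongrightarrow> (\<integral>x. ?F x * indicator (PiE I (\<lambda>i. {a' i<..<b' i})) x \<partial>lebn I)"
      proof (rule integral_dominated_convergence)
        show "integrable (lebn I) (\<lambda>x. norm (?F x))" using F by (rule integrable_norm)
        show "AE x in lebn I. (\<lambda>n. ?F x * (\<Prod>i\<in>I. bump (a' i) (b' i) n (x i)))
          \<longlonglongrightarrow> ?F x * indicator (PiE I (\<lambda>i. {a' i<..<b' i})) x"
        proof (rule AE_I2)
          fix x assume x: "x \<in> space (lebn I)"
          have "(\<lambda>n. ?F x * (\<Prod>i\<in>I. bump (a' i) (b' i) n (x i)))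
            \<longlonglongrightarrow> ?F x * (\<Prod>i\<in>I. indicator {a' i<..<b' i} (x i))"
            by (intro tendsto_mult tendsto_const tendsto_prod bump_tendsto)
              (use True in \<open>auto intro: less_imp_le\<close>)
          moreover have "(\<Prod>i\<in>I. indicator {a' i<..<b' i} (x i)) = (indicator (PiE I (\<lambda>i. {a' i<..<b' i})) x :: real)"
            using x I by (auto simp: indicator_def space_PiM PiE_iff prod_zero_iff)
          ultimately show "(\<lambda>n. ?F x * (\<Prod>i\<in>I. bump (a' i) (b' i) n (x i)))
            \<longlonglongrightarrow> ?F x * indicator (PiE I (\<lambda>i. {a' i<..<b' i})) x" by simp
        qed
        have "\<bar>\<Prod>i\<in>I. bump (a' i) (b' i) n (x i)\<bar> \<le> 1" for n x
          by (auto simp: abs_prod bump_bounds intro!: prod_le_1)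
        then show "AE x in lebn I. norm (?F x * (\<Prod>i\<in>I. bump (a' i) (b' i) n (x i))) \<le> norm (?F x)" for n
          unfolding norm_mult by (intro AE_I2 mult_left_le) auto
      qed measurable
      moreover have "(\<integral>x. ?F x * (\<Prod>i\<in>I. bump (a' i) (b' i) n (x i)) \<partial>lebn I) = 0" for n
      proof -
        have "(\<integral>x. ?F x * (\<Prod>i\<in>I. bump (a' i) (b' i) n (x i)) \<partial>lebn I)
          = (\<integral>x. F x * (\<Prod>i\<in>I. bump (a' i) (b' i) n (x i)) \<partial>lebn I)"
        proof (rule Bochner_Integration.integral_cong[OF refl])
          fix x assume x: "x \<in> space (lebn I)"
          show "?F x * (\<Prod>i\<in>I. bump (a' i) (b' i) n (x i)) = F x * (\<Prod>i\<in>I. bump (a' i) (b' i) n (x i))"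
          proof (cases "x \<in> Q I R")
            case False
            then obtain i where i: "i \<in> I" "x i \<notin> {-R<..<R}"
              using x by (auto simp: Q_def space_PiM PiE_iff)
            then have "x i \<notin> {a' i<..<b' i}" by (auto simp: a'_def b'_def)
            then have "bump (a' i) (b' i) n (x i) = 0" using True i by (intro bump_outside) auto
            then have "(\<Prod>i\<in>I. bump (a' i) (b' i) n (x i)) = 0" using I i by (auto simp: prod_zero_iff)
            then show ?thesis by simp
          qed simp
        qed
        also have "\<dots> = 0" using True by (intro zero) (auto simp: a'_def b'_def)
        finally show ?thesis .
      qed
      ultimately show ?thesis by (simp add: LIMSEQ_const_iff)
    qed
    then show "(\<integral>x. ?F x * indicator (PiE I (\<lambda>i. {a i<..<b i})) x \<partial>lebn I) = 0"
      unfolding box .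
  qed
  then show ?thesis by eventually_elim auto
qed

subsection \<open>Integration over one coordinate\<close>

lemma fun_upd_cspace: "x \<in> PiE \<Lambda> (\<lambda>_. UNIV) \<Longrightarrow> j \<in> \<Lambda> \<Longrightarrow> x(j := t) \<in> PiE \<Lambda> (\<lambda>_. UNIV)"
  by (auto simp: PiE_iff extensional_def)

lemma space_lebn: "space (lebn \<Lambda>) = PiE \<Lambda> (\<lambda>_. UNIV)"
  by (simp add: space_PiM)

lemma fun_upd_space_lebn:
  "x \<in> space (lebn (\<Lambda> - {j})) \<Longrightarrow> j \<in> \<Lambda> \<Longrightarrow> x(j := t) \<in> space (lebn \<Lambda>)"
  by (auto simp: space_PiM PiE_iff extensional_def)

lemma measurable_fun_upd_lebn:
  "x \<in> space (lebn (\<Lambda> - {j})) \<Longrightarrow> j \<in> \<Lambda> \<Longrightarrow> (\<lambda>t. x(j := t)) \<in> lborel \<rightarrow>\<^sub>M lebn \<Lambda>"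
  using measurable_component_update[of x "\<Lambda> - {j}" "\<lambda>_. lborel" j] by (simp add: insert_absorb)

lemma measurable_fun_upd_pair_lebn [measurable]:
  "j \<in> \<Lambda> \<Longrightarrow> (\<lambda>(x, t). x(j := t)) \<in> lebn (\<Lambda> - {j}) \<Otimes>\<^sub>M lborel \<rightarrow>\<^sub>M lebn \<Lambda>"
  unfolding split_beta' by (rule measurable_fun_upd[where J = "\<Lambda> - {j}"]) auto

lemma measurable_fun_upd_pair_lebn' [measurable]:
  "j \<in> \<Lambda> \<Longrightarrow> (\<lambda>(x, t). x(j := t)) \<in> lebn \<Lambda> \<Otimes>\<^sub>M lborel \<rightarrow>\<^sub>M lebn \<Lambda>"
  unfolding split_beta' by (rule measurable_fun_upd[where J = "\<Lambda>"]) auto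

lemma nn_integral_lebn_coordinate:
  assumes "finite \<Lambda>" "j \<in> \<Lambda>" "f \<in> borel_measurable (lebn \<Lambda>)"
  shows "(\<integral>\<^sup>+x. f x \<partial>lebn \<Lambda>) = (\<integral>\<^sup>+x. \<integral>\<^sup>+t. f (x(j := t)) \<partial>lborel \<partial>lebn (\<Lambda> - {j}))"
  using lebn.product_nn_integral_insert[of "\<Lambda> - {j}" j f] assms by (simp add: insert_absorb)

lemma integral_lebn_coordinate:
  fixes f :: "('i \<Rightarrow> real) \<Rightarrow> real"
  assumes "finite \<Lambda>" "j \<in> \<Lambda>" "integrable (lebn \<Lambda>) f"
  shows "(\<integral>x. f x \<partial>lebn \<Lambda>) = (\<integral>x. \<integral>t. f (x(j := t)) \<partial>lborel \<partial>lebn (\<Lambda> - {j}))"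
  using lebn.product_integral_insert[of "\<Lambda> - {j}" j f] assms by (simp add: insert_absorb)

lemma AE_lebn_coordinate:
  assumes fin: "finite \<Lambda>" and j: "j \<in> \<Lambda>" and AE: "AE x in lebn \<Lambda>. P x"
  shows "AE x in lebn (\<Lambda> - {j}). AE t in lborel. P (x(j := t))"
proof -
  obtain N where N: "{x \<in> space (lebn \<Lambda>). \<not> P x} \<subseteq> N" "emeasure (lebn \<Lambda>) N = 0" "N \<in> sets (lebn \<Lambda>)"
    using AE by (rule AE_E)
  have [measurable]: "(\<lambda>(x, t). indicator N (x(j := t)) :: ennreal) \<in> borel_measurable (lebn (\<Lambda> - {j}) \<Otimes>\<^sub>M lborel)"
    using measurable_compose[OF measurable_fun_upd_pair_lebn[OF j] borel_measurable_indicator[OF N(3)]]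
    by (simp add: split_beta')
  have "0 = (\<integral>\<^sup>+x. \<integral>\<^sup>+t. indicator N (x(j := t)) \<partial>lborel \<partial>lebn (\<Lambda> - {j}))"
    using N(2,3) nn_integral_lebn_coordinate[OF fin j, of "indicator N"] by simp
  then have "AE x in lebn (\<Lambda> - {j}). (\<integral>\<^sup>+t. indicator N (x(j := t)) \<partial>lborel) = 0"
    by (subst (asm) eq_commute, subst (asm) nn_integral_0_iff_AE)
      (auto intro!: lborel.borel_measurable_nn_integral)
  then show ?thesis
    using AE_space
  proof eventually_elim
    case (elim x)
    note [measurable] = measurable_fun_upd_lebn[OF elim(2) j] N(3)
    have "AE t in lborel. (indicator N (x(j := t)) :: ennreal) = 0"
      using elim(1) by (subst (asm) nn_integral_0_iff_AE) auto
    then show ?case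
    proof eventually_elim
      case (elim t)
      then show ?case
        using N(1) fun_upd_space_lebn[OF \<open>x \<in> space (lebn (\<Lambda> - {j}))\<close> j, of t]
        by (auto simp: indicator_def split: if_splits)
    qed
  qed
qed

lemma AE_integrable_coordinate:
  fixes f :: "('i \<Rightarrow> real) \<Rightarrow> real"
  assumes fin: "finite \<Lambda>" and j: "j \<in> \<Lambda>" and f: "integrable (lebn \<Lambda>) f"
  shows "AE x in lebn (\<Lambda> - {j}). integrable lborel (\<lambda>t. f (x(j := t)))"
proof -
  have fm [measurable]: "f \<in> borel_measurable (lebn \<Lambda>)" using f by auto
  have [measurable]: "(\<lambda>(x, t). f (x(j := t))) \<in> borel_measurable (lebn (\<Lambda> - {j}) \<Otimes>\<^sub>M lborel)"
    using measurable_compose[OF measurable_fun_upd_pair_lebn[OF j] fm] by (simp add: split_beta')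
  have "(\<integral>\<^sup>+x. \<integral>\<^sup>+t. norm (f (x(j := t))) \<partial>lborel \<partial>lebn (\<Lambda> - {j})) \<noteq> \<infinity>"
    using f nn_integral_lebn_coordinate[OF fin j, of "\<lambda>x. ennreal (norm (f x))"]
    by (auto simp: integrable_iff_bounded)
  then have "AE x in lebn (\<Lambda> - {j}). (\<integral>\<^sup>+t. norm (f (x(j := t))) \<partial>lborel) \<noteq> \<infinity>"
    by (intro nn_integral_PInf_AE) measurable
  then show ?thesis
    using AE_space
  proof eventually_elim
    case (elim x)
    note [measurable] = measurable_compose[OF measurable_fun_upd_lebn[OF elim(2) j] fm]
    show ?case using elim(1) by (auto simp: integrable_iff_bounded top.not_eq_extremum)
  qed
qed

text \<open>Meant for quantities built from integrals of \<open>f\<close> along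
  \<open>j\<close>-lines: their bound is the same at all positions on the line, so integrating it
  over \<open>{-R..R}\<close> costs only the length of the interval.\<close>

lemma integrable_of_line_bound:
  fixes f q :: "('i \<Rightarrow> real) \<Rightarrow> real"
  assumes fin: "finite \<Lambda>" and j: "j \<in> \<Lambda>" and f: "integrable (lebn \<Lambda>) f"
    and q [measurable]: "q \<in> borel_measurable (lebn \<Lambda>)"
    and bound: "\<And>x t. x \<in> space (lebn (\<Lambda> - {j})) \<Longrightarrow>
      ennreal \<bar>q (x(j := t))\<bar> \<le> ennreal K * indicator {-R..R} t * (\<integral>\<^sup>+r. ennreal \<bar>f (x(j := r))\<bar> \<partial>lborel)"
  shows "integrable (lebn \<Lambda>) q"
proof (rule integrableI_bounded)
  have fm [measurable]: "f \<in> borel_measurable (lebn \<Lambda>)" using f by auto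
  have [measurable]: "(\<lambda>(x, t). f (x(j := t))) \<in> borel_measurable (lebn (\<Lambda> - {j}) \<Otimes>\<^sub>M lborel)"
    using measurable_compose[OF measurable_fun_upd_pair_lebn[OF j] fm] by (simp add: split_beta')
  have "(\<integral>\<^sup>+x. ennreal (norm (q x)) \<partial>lebn \<Lambda>) = (\<integral>\<^sup>+x. \<integral>\<^sup>+t. ennreal \<bar>q (x(j := t))\<bar> \<partial>lborel \<partial>lebn (\<Lambda> - {j}))"
    by (subst nn_integral_lebn_coordinate[OF fin j]) auto
  also have "\<dots> \<le> (\<integral>\<^sup>+x. \<integral>\<^sup>+t. ennreal K * indicator {-R..R} t * (\<integral>\<^sup>+r. ennreal \<bar>f (x(j := r))\<bar> \<partial>lborel) \<partial>lborel \<partial>lebn (\<Lambda> - {j}))"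
    by (intro nn_integral_mono bound) auto
  also have "\<dots> = (\<integral>\<^sup>+x. (ennreal K * emeasure lborel {-R..R}) * (\<integral>\<^sup>+r. ennreal \<bar>f (x(j := r))\<bar> \<partial>lborel) \<partial>lebn (\<Lambda> - {j}))"
    by (simp add: nn_integral_cmult nn_integral_multc)
  also have "\<dots> = (ennreal K * emeasure lborel {-R..R}) * (\<integral>\<^sup>+x. ennreal \<bar>f x\<bar> \<partial>lebn \<Lambda>)"
    by (subst nn_integral_lebn_coordinate[OF fin j]) (auto intro!: nn_integral_cmult)
  also have "\<dots> < \<infinity>"
    using f by (auto simp: integrable_iff_bounded emeasure_lborel_Icc_eq ennreal_mult_less_top)
  finally show "(\<integral>\<^sup>+x. ennreal (norm (q x)) \<partial>lebn \<Lambda>) < \<infinity>" .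
qed (rule q)

subsection \<open>Test functions\<close>

text \<open>Continuity refers to the product topology on all configurations, measurability to the
  product over \<open>\<Lambda>\<close>. The inclusion is measurable because each coordinate is;
  those outside \<open>\<Lambda>\<close> are constantly \<open>undefined\<close> on the
  space.\<close>

lemma continuous_on_cspace_measurable:
  assumes "continuous_on (cspace \<Lambda>) (\<eta> :: ('d::finite config) \<Rightarrow> real)"
  shows "\<eta> \<in> borel_measurable (leb \<Lambda>)"
proof -
  have "(\<lambda>x. x) \<in> leb \<Lambda> \<rightarrow>\<^sub>M (borel :: 'd config measure)"
  proof (rule measurable_coordinatewise_then_product)
    fix i
    show "(\<lambda>x. x i) \<in> borel_measurable (leb \<Lambda>)"
    proof (cases "i \<in> \<Lambda>")
      case False
      then have "(\<lambda>x. undefined :: real) \<in> borel_measurable (leb \<Lambda>) \<longleftrightarrow> (\<lambda>x. x i) \<in> borel_measurable (leb \<Lambda>)"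
        by (intro measurable_cong) (auto simp: space_PiM PiE_iff extensional_def)
      then show ?thesis by simp
    qed simp
  qed
  then have "(\<lambda>x. x) \<in> leb \<Lambda> \<rightarrow>\<^sub>M restrict_space borel (cspace \<Lambda>)"
    by (rule measurable_restrict_space2[rotated]) (auto simp: space_PiM)
  from measurable_compose[OF this borel_measurable_continuous_on_restrict[OF assms]] show ?thesis .
qed

text \<open>Extensional functions have the fixed value \<open>undefined\<close> off the index set,
  so the cube is a full product of compact sets and Tychonoff's theorem applies.\<close>

lemma compact_cube: "compact (PiE \<Lambda> (\<lambda>_. {-R..R::real}))"
proof -
  have "PiE \<Lambda> (\<lambda>_. {-R..R}) = PiE UNIV (\<lambda>i. if i \<in> \<Lambda> then {-R..R} else {undefined})"
    by (auto simp: PiE_iff extensional_def split: if_splits)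
  moreover have "compactin (product_topology (\<lambda>_. euclidean) UNIV) (PiE UNIV (\<lambda>i. if i \<in> \<Lambda> then {-R..R::real} else {undefined}))"
    by (auto simp: compactin_PiE)
  ultimately show ?thesis by (simp add: euclidean_product_topology)
qed

lemma continuous_on_cspace_bounded:
  assumes "continuous_on (cspace \<Lambda>) (\<eta> :: ('d::finite config) \<Rightarrow> real)"
  obtains K where "K \<ge> 0" "\<And>x. x \<in> PiE \<Lambda> (\<lambda>_. {-R..R}) \<Longrightarrow> \<bar>\<eta> x\<bar> \<le> K"
proof -
  have "continuous_on (PiE \<Lambda> (\<lambda>_. {-R..R})) \<eta>"
    by (rule continuous_on_subset[OF assms]) (auto simp: PiE_iff)
  then have "bounded (\<eta> ` PiE \<Lambda> (\<lambda>_. {-R..R}))"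
    by (intro compact_imp_bounded compact_continuous_image compact_cube)
  then obtain K where "\<forall>x\<in>PiE \<Lambda> (\<lambda>_. {-R..R}). \<bar>\<eta> x\<bar> \<le> K"
    unfolding bounded_iff by (auto simp del: PiE_iff)
  then show ?thesis by (intro that[of "max 0 K"]) (auto simp: le_max_iff_disj)
qed

lemma continuous_on_fun_upd:
  fixes f :: "'a::topological_space \<Rightarrow> 'i \<Rightarrow> real"
  assumes "continuous_on S f" "continuous_on S h"
  shows "continuous_on S (\<lambda>x. (f x)(j := h x))"
proof (rule continuous_on_coordinatewise_then_product)
  show "continuous_on S (\<lambda>x. ((f x)(j := h x)) i)" for i
    using assms continuous_on_product_then_coordinatewise[OF assms(1), of i] by (cases "i = j") auto
qed

lemma continuous_on_line:
  fixes \<eta> :: "'d::finite config \<Rightarrow> real"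
  assumes "continuous_on (cspace \<Lambda>) \<eta>" "x \<in> cspace \<Lambda>" "j \<in> \<Lambda>"
  shows "isCont (\<lambda>t. \<eta> (x(j := t))) t"
proof -
  have "continuous_on UNIV (\<lambda>t. \<eta> (x(j := t)))"
  proof (rule continuous_on_compose2[OF assms(1)])
    show "continuous_on UNIV (\<lambda>t. x(j := t))" by (intro continuous_on_fun_upd continuous_on_const continuous_on_id)
    show "(\<lambda>t. x(j := t)) ` UNIV \<subseteq> cspace \<Lambda>" using fun_upd_cspace[OF assms(2,3)] by blast
  qed
  then show ?thesis by (simp add: continuous_on_eq_continuous_at)
qed

text \<open>\<open>test_fun\<close> asserts differentiability at the base point only; applied to
  \<open>x(j := t)\<close> it gives the derivative everywhere on the line through
  \<open>x\<close>.\<close>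

lemma test_funD:
  assumes "test_fun \<Lambda> \<eta>" "j \<in> \<Lambda>" "x \<in> cspace \<Lambda>"
  shows test_fun_DERIV: "((\<lambda>t. \<eta> (x(j := t))) has_real_derivative partial_deriv j \<eta> (x(j := t))) (at t)"
    and test_fun_isCont: "isCont (\<lambda>t. partial_deriv j \<eta> (x(j := t))) t"
proof -
  have "x(j := t) \<in> cspace \<Lambda>" using assms by (intro fun_upd_cspace)
  then have "(\<lambda>s. \<eta> ((x(j := t))(j := s))) differentiable (at ((x(j := t)) j))"
    using assms unfolding test_fun_def by blast
  then show "((\<lambda>t. \<eta> (x(j := t))) has_real_derivative partial_deriv j \<eta> (x(j := t))) (at t)"
    by (simp add: partial_deriv_def DERIV_deriv_iff_real_differentiable)
  show "isCont (\<lambda>t. partial_deriv j \<eta> (x(j := t))) t"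
    by (rule continuous_on_line) (use assms in \<open>auto simp: test_fun_def simp del: PiE_UNIV_domain\<close>)
qed

lemma test_fun_prod:
  fixes f f' :: "'d::finite site \<Rightarrow> real \<Rightarrow> real"
  assumes fin: "finite \<Lambda>"
    and f: "\<And>i t. i \<in> \<Lambda> \<Longrightarrow> (f i has_real_derivative f' i t) (at t)"
    and f': "\<And>i t. i \<in> \<Lambda> \<Longrightarrow> isCont (f' i) t"
    and supp: "\<And>i t. i \<in> \<Lambda> \<Longrightarrow> \<bar>t\<bar> > R \<Longrightarrow> f i t = 0"
  shows "test_fun \<Lambda> (\<lambda>x. \<Prod>i\<in>\<Lambda>. f i (x i))"
    and "j \<in> \<Lambda> \<Longrightarrow> partial_deriv j (\<lambda>x. \<Prod>i\<in>\<Lambda>. f i (x i)) x = f' j (x j) * (\<Prod>i\<in>\<Lambda> - {j}. f i (x i))"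
proof -
  have split: "(\<Prod>i\<in>\<Lambda>. f i ((x(j := t)) i)) = f j t * (\<Prod>i\<in>\<Lambda> - {j}. f i (x i))" if "j \<in> \<Lambda>" for x j t
    by (subst prod.remove[OF fin that]) (auto intro!: prod.cong arg_cong2[where f = "(*)"])
  have D: "((\<lambda>t. \<Prod>i\<in>\<Lambda>. f i ((x(j := t)) i)) has_real_derivative f' j t * (\<Prod>i\<in>\<Lambda> - {j}. f i (x i))) (at t)"
    if "j \<in> \<Lambda>" for x j t
    unfolding split[OF that] using f[OF that] by (auto intro!: derivative_eq_intros)
  have pd: "partial_deriv j (\<lambda>x. \<Prod>i\<in>\<Lambda>. f i (x i)) x = f' j (x j) * (\<Prod>i\<in>\<Lambda> - {j}. f i (x i))" if "j \<in> \<Lambda>" for x j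
    unfolding partial_deriv_def by (rule DERIV_imp_deriv) (rule D[OF that])
  have coord: "continuous_on S (\<lambda>x :: 'd config. h (x i))" if "\<And>t. isCont h t" for S i and h :: "real \<Rightarrow> real"
    by (rule continuous_on_compose2[where t = UNIV and g = h])
      (use that in \<open>auto intro: continuous_at_imp_continuous_on continuous_on_subset[OF continuous_on_product_coordinates]\<close>)
  show "test_fun \<Lambda> (\<lambda>x. \<Prod>i\<in>\<Lambda>. f i (x i))"
    unfolding test_fun_def
  proof (intro conjI ballI)
    show "continuous_on (cspace \<Lambda>) (\<lambda>x. \<Prod>i\<in>\<Lambda>. f i (x i))"
      by (intro continuous_on_prod coord DERIV_isCont[OF f])
    fix j assume j: "j \<in> \<Lambda>"
    show "(\<lambda>t. \<Prod>i\<in>\<Lambda>. f i ((x(j := t)) i)) differentiable at (x j)" for x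
      using D[OF j] by (auto simp: real_differentiable_def)
    have "partial_deriv j (\<lambda>x. \<Prod>i\<in>\<Lambda>. f i (x i)) = (\<lambda>x. f' j (x j) * (\<Prod>i\<in>\<Lambda> - {j}. f i (x i)))"
      using pd[OF j] by blast
    then show "continuous_on (cspace \<Lambda>) (partial_deriv j (\<lambda>x. \<Prod>i\<in>\<Lambda>. f i (x i)))"
      using j by (auto intro!: continuous_on_mult continuous_on_prod coord DERIV_isCont[OF f] f')
  next
    have "\<bar>x i\<bar> \<le> R" if "(\<Prod>i\<in>\<Lambda>. f i (x i)) \<noteq> 0" "i \<in> \<Lambda>" for x :: "'d config" and i
    proof (rule ccontr)
      assume "\<not> \<bar>x i\<bar> \<le> R"
      then have "f i (x i) = 0" using supp that by simp
      then show False using that fin by (auto simp: prod_zero_iff)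
    qed
    then show "\<exists>R. \<forall>x\<in>cspace \<Lambda>. (\<Prod>i\<in>\<Lambda>. f i (x i)) \<noteq> 0 \<longrightarrow> (\<forall>i\<in>\<Lambda>. \<bar>x i\<bar> \<le> R)"
      by blast
  qed
  show "j \<in> \<Lambda> \<Longrightarrow> partial_deriv j (\<lambda>x. \<Prod>i\<in>\<Lambda>. f i (x i)) x = f' j (x j) * (\<Prod>i\<in>\<Lambda> - {j}. f i (x i))"
    by (rule pd)
qed

subsection \<open>Local integrability\<close>

lemma cube_measurable [measurable]: "finite \<Lambda> \<Longrightarrow> PiE \<Lambda> (\<lambda>_. {-R..R::real}) \<in> sets (lebn \<Lambda>)"
  by (intro sets_PiM_I_finite) auto

lemma cspace_in_cube:
  fixes x :: "'i \<Rightarrow> real"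
  assumes "finite \<Lambda>"
  shows "\<exists>n0::nat. \<forall>i\<in>\<Lambda>. \<bar>x i\<bar> < real n0"
proof -
  obtain n :: nat where n: "(\<Sum>i\<in>\<Lambda>. \<bar>x i\<bar>) < real n" using reals_Archimedean2 by blast
  have "\<bar>x i\<bar> \<le> (\<Sum>i\<in>\<Lambda>. \<bar>x i\<bar>)" if "i \<in> \<Lambda>" for i
    using assms that by (intro member_le_sum) auto
  then show ?thesis using n by (intro exI[of _ n]) force
qed

lemma locally_integrableD:
  assumes "locally_integrable \<Lambda> f"
  shows "integrable (leb \<Lambda>) (\<lambda>x. indicator (PiE \<Lambda> (\<lambda>_. {-R..R})) x * f x)"
  using assms by (auto simp: locally_integrable_def set_integrable_def)

lemma locally_integrableI_nat:
  assumes fin: "finite \<Lambda>"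
    and "\<And>n::nat. n \<ge> n0 \<Longrightarrow> integrable (leb \<Lambda>) (\<lambda>x. indicator (PiE \<Lambda> (\<lambda>_. {-real n..real n})) x * f x)"
  shows "locally_integrable \<Lambda> f"
  unfolding locally_integrable_def
proof
  fix R :: real
  obtain m :: nat where m: "R \<le> real m" using real_arch_simple by blast
  have "set_integrable (leb \<Lambda>) (PiE \<Lambda> (\<lambda>_. {-real (max m n0)..real (max m n0)})) f"
    using assms(2)[of "max m n0"] by (simp add: set_integrable_def)
  then show "set_integrable (leb \<Lambda>) (PiE \<Lambda> (\<lambda>_. {-R..R})) f"
    by (rule set_integrable_subset) (use m fin in \<open>auto simp: cube_measurable intro!: PiE_mono\<close>)
qed

lemma locally_integrable_measurable:
  assumes fin: "finite \<Lambda>" and f: "locally_integrable \<Lambda> f"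
  shows "f \<in> borel_measurable (leb \<Lambda>)"
proof (rule borel_measurable_LIMSEQ_real)
  show "(\<lambda>n. indicator (PiE \<Lambda> (\<lambda>_. {-real n..real n})) x * f x) \<longlonglongrightarrow> f x" if "x \<in> space (leb \<Lambda>)" for x
  proof (rule tendsto_eventually)
    obtain n0 where "\<forall>i\<in>\<Lambda>. \<bar>x i\<bar> < real n0" using cspace_in_cube[OF fin] by blast
    then have "x \<in> PiE \<Lambda> (\<lambda>_. {-real n..real n})" if "n \<ge> n0" for n
      using that \<open>x \<in> space (leb \<Lambda>)\<close> by (force simp: space_PiM PiE_iff abs_le_iff)
    then show "\<forall>\<^sub>F n in sequentially. indicator (PiE \<Lambda> (\<lambda>_. {-real n..real n})) x * f x = f x"
      by (auto simp: eventually_sequentially intro!: exI[of _ n0])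
  qed
  show "(\<lambda>x. indicator (PiE \<Lambda> (\<lambda>_. {-real n..real n})) x * f x) \<in> borel_measurable (leb \<Lambda>)" for n
    using locally_integrableD[OF f] by auto
qed

lemma locally_integrable_times_bounded:
  assumes fin: "finite \<Lambda>" and f: "locally_integrable \<Lambda> f" and h [measurable]: "h \<in> borel_measurable (leb \<Lambda>)"
    and bound: "\<And>x. x \<in> PiE \<Lambda> (\<lambda>_. {-R..R}) \<Longrightarrow> \<bar>h x\<bar> \<le> K"
    and supp: "\<And>x. x \<in> cspace \<Lambda> \<Longrightarrow> x \<notin> PiE \<Lambda> (\<lambda>_. {-R..R}) \<Longrightarrow> h x = 0"
  shows "integrable (leb \<Lambda>) (\<lambda>x. f x * h x)"
proof (rule Bochner_Integration.integrable_bound)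
  note [measurable] = locally_integrable_measurable[OF fin f]
  show "integrable (leb \<Lambda>) (\<lambda>x. K * (indicator (PiE \<Lambda> (\<lambda>_. {-R..R})) x * f x))"
    using locally_integrableD[OF f] by (intro integrable_mult_right)
  show "AE x in leb \<Lambda>. norm (f x * h x) \<le> norm (K * (indicator (PiE \<Lambda> (\<lambda>_. {-R..R})) x * f x))"
  proof (rule AE_I2)
    fix x assume x: "x \<in> space (leb \<Lambda>)"
    show "norm (f x * h x) \<le> norm (K * (indicator (PiE \<Lambda> (\<lambda>_. {-R..R})) x * f x))"
    proof (cases "x \<in> PiE \<Lambda> (\<lambda>_. {-R..R})")
      case True
      then have "\<bar>f x\<bar> * \<bar>h x\<bar> \<le> \<bar>f x\<bar> * \<bar>K\<bar>"
        using bound[OF True] by (intro mult_left_mono) auto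
      then show ?thesis using True by (simp add: abs_mult mult.commute)
    next
      case False
      then show ?thesis using supp[of x] x by (simp add: space_PiM)
    qed
  qed
  show "(\<lambda>x. f x * h x) \<in> borel_measurable (leb \<Lambda>)"
    by (intro borel_measurable_times locally_integrable_measurable[OF fin f] h)
qed

subsection \<open>Weak derivatives and absolute continuity on lines\<close>

lemma cube_iff: "x \<in> PiE \<Lambda> (\<lambda>_. UNIV) \<Longrightarrow> x \<in> PiE \<Lambda> (\<lambda>_. {-R..R::real}) \<longleftrightarrow> (\<forall>i\<in>\<Lambda>. \<bar>x i\<bar> \<le> R)"
  unfolding PiE_iff abs_le_iff by (simp, meson minus_le_iff)

lemma open_cube_iff: "x \<in> PiE \<Lambda> (\<lambda>_. UNIV) \<Longrightarrow> x \<in> PiE \<Lambda> (\<lambda>_. {-R<..<R::real}) \<longleftrightarrow> (\<forall>i\<in>\<Lambda>. \<bar>x i\<bar> < R)"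
  unfolding PiE_iff abs_less_iff by (simp, meson minus_less_iff)

text \<open>The base point of the primitive moves with the cube, which keeps all integrals unsigned.\<close>

definition line_primitive ::
    "'d::finite site set \<Rightarrow> 'd site \<Rightarrow> ('d config \<Rightarrow> real) \<Rightarrow> ('d config \<Rightarrow> real) \<Rightarrow> nat \<Rightarrow> ('d config \<Rightarrow> real) \<Rightarrow> bool" where
  "line_primitive \<Lambda> j f g n c \<longleftrightarrow> (AE x in leb \<Lambda>. (\<forall>i\<in>\<Lambda>. \<bar>x i\<bar> < real n) \<longrightarrow>
        f x = c (x(j := 0)) + (LBINT r:{- real n..x j}. g (x(j := r))))"

text \<open>Absolute continuity on lines. A cofinal family of cubes suffices, each with its own
  constant of integration; the free radius can later be chosen beyond any given coordinates.\<close>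

definition acl ::
    "'d::finite site set \<Rightarrow> 'd site \<Rightarrow> ('d config \<Rightarrow> real) \<Rightarrow> ('d config \<Rightarrow> real) \<Rightarrow> bool" where
  "acl \<Lambda> j f g \<longleftrightarrow> locally_integrable \<Lambda> f \<and> locally_integrable \<Lambda> g \<and>
     (\<forall>N. \<exists>n\<ge>N. \<exists>c. line_primitive \<Lambda> j f g n c)"

lemma has_weak_partialD:
  assumes "has_weak_partial \<Lambda> i f g" "test_fun \<Lambda> \<eta>"
  shows "(\<integral>x. f x * partial_deriv i \<eta> x \<partial>leb \<Lambda>) = - (\<integral>x. g x * \<eta> x \<partial>leb \<Lambda>)"
  using assms by (simp add: has_weak_partial_def)

text \<open>The difference of two weak derivatives annihilates every product of bumps, hence
  vanishes on each cube; countably many cubes exhaust the space.\<close>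

lemma weak_partial_unique:
  assumes fin: "finite \<Lambda>" and g: "has_weak_partial \<Lambda> j f g" and h: "has_weak_partial \<Lambda> j f h"
  shows "AE x in leb \<Lambda>. g x = h x"
proof -
  have lg: "locally_integrable \<Lambda> g" and lh: "locally_integrable \<Lambda> h"
    using g h by (auto simp: has_weak_partial_def)
  note [measurable] = locally_integrable_measurable[OF fin lg] locally_integrable_measurable[OF fin lh]
  have *: "AE x in leb \<Lambda>. x \<in> PiE \<Lambda> (\<lambda>_. {-real n<..<real n}) \<longrightarrow> g x - h x = 0" for n :: nat
  proof (rule AE_zero_of_bumps[OF fin])
    have "integrable (leb \<Lambda>) (\<lambda>x. indicator (PiE \<Lambda> (\<lambda>_. {-real n..real n})) x * g x - indicator (PiE \<Lambda> (\<lambda>_. {-real n..real n})) x * h x)"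
      by (intro Bochner_Integration.integrable_diff locally_integrableD lg lh)
    moreover have "PiE \<Lambda> (\<lambda>_. {-real n<..<real n}) \<in> sets (leb \<Lambda>)" using fin by (intro sets_PiM_I_finite) auto
    ultimately have i: "integrable (leb \<Lambda>) (\<lambda>x. (indicator (PiE \<Lambda> (\<lambda>_. {-real n..real n})) x * g x
        - indicator (PiE \<Lambda> (\<lambda>_. {-real n..real n})) x * h x) * indicator (PiE \<Lambda> (\<lambda>_. {-real n<..<real n})) x)"
      by (intro integrable_real_mult_indicator)
    have eq: "(indicator (PiE \<Lambda> (\<lambda>_. {-real n..real n})) x * g x
        - indicator (PiE \<Lambda> (\<lambda>_. {-real n..real n})) x * h x) * indicator (PiE \<Lambda> (\<lambda>_. {-real n<..<real n})) x
        = (g x - h x) * indicator (PiE \<Lambda> (\<lambda>_. {-real n<..<real n})) x" for x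
    proof -
      have sub: "PiE \<Lambda> (\<lambda>_. {-real n<..<real n}) \<subseteq> PiE \<Lambda> (\<lambda>_. {-real n..real n})"
        by (rule PiE_mono) auto
      show ?thesis
      proof (cases "x \<in> PiE \<Lambda> (\<lambda>_. {-real n<..<real n})")
        case True
        then have "x \<in> PiE \<Lambda> (\<lambda>_. {-real n..real n})" using sub by (rule subsetD[rotated])
        then show ?thesis using True by simp
      qed simp
    qed
    show "integrable (leb \<Lambda>) (\<lambda>x. (g x - h x) * indicator (PiE \<Lambda> (\<lambda>_. {-real n<..<real n})) x)"
      using i unfolding eq .
    fix a b :: "'a site \<Rightarrow> real" and m
    assume ab: "\<And>i. i \<in> \<Lambda> \<Longrightarrow> - real n \<le> a i \<and> a i < b i \<and> b i \<le> real n"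
    let ?\<eta> = "\<lambda>x. \<Prod>i\<in>\<Lambda>. bump (a i) (b i) m (x i)"
    have supp: "bump (a i) (b i) m t = 0" if "i \<in> \<Lambda>" "\<bar>t\<bar> > real n" for i t
      using ab[OF that(1)] that(2) by (intro bump_outside) auto
    have test: "test_fun \<Lambda> ?\<eta>"
      by (rule test_fun_prod(1)[OF fin DERIV_bump isCont_dbump]) (rule supp)
    have int: "integrable (leb \<Lambda>) (\<lambda>x. k x * ?\<eta> x)" if "locally_integrable \<Lambda> k" for k
    proof (rule locally_integrable_times_bounded[OF fin that, where R = "real n" and K = 1])
      show "?\<eta> \<in> borel_measurable (leb \<Lambda>)" by measurable
      show "\<bar>?\<eta> x\<bar> \<le> 1" for x by (auto simp: abs_prod bump_bounds intro!: prod_le_1)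
      show "?\<eta> x = 0" if x: "x \<in> cspace \<Lambda>" "x \<notin> PiE \<Lambda> (\<lambda>_. {-real n..real n})" for x
      proof -
        obtain i where i: "i \<in> \<Lambda>" "\<bar>x i\<bar> > real n" using x cube_iff[OF x(1)] by (auto simp: not_le)
        then have "bump (a i) (b i) m (x i) = 0" by (intro supp)
        then show ?thesis using i fin by (auto simp: prod_zero_iff)
      qed
    qed
    have "- (\<integral>x. g x * ?\<eta> x \<partial>leb \<Lambda>) = - (\<integral>x. h x * ?\<eta> x \<partial>leb \<Lambda>)"
      by (rule trans[OF has_weak_partialD[OF g test, symmetric] has_weak_partialD[OF h test]])
    then show "(\<integral>x. (g x - h x) * ?\<eta> x \<partial>leb \<Lambda>) = 0"
      unfolding left_diff_distrib Bochner_Integration.integral_diff[OF int[OF lg] int[OF lh]] by simp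
  qed
  have "AE x in leb \<Lambda>. \<forall>n::nat. x \<in> PiE \<Lambda> (\<lambda>_. {-real n<..<real n}) \<longrightarrow> g x - h x = 0"
    by (subst AE_all_countable) (rule allI, rule *)
  then show ?thesis
    using AE_space
  proof eventually_elim
    case (elim x)
    obtain n where n: "\<forall>i\<in>\<Lambda>. \<bar>x i\<bar> < real n" using cspace_in_cube[OF fin] by blast
    then have "x \<in> PiE \<Lambda> (\<lambda>_. {-real n<..<real n})"
      using elim(2) by (subst open_cube_iff) (simp_all add: space_PiM)
    then show ?case using elim(1) by auto
  qed
qed

lemma weak_partial_AE_eq:
  assumes "finite \<Lambda>" "has_weak_partial \<Lambda> j f g"
  shows "AE x in leb \<Lambda>. weak_partial \<Lambda> j f x = g x"
  unfolding weak_partial_def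
  by (rule weak_partial_unique[OF assms(1) someI[of "has_weak_partial \<Lambda> j f" g, OF assms(2)] assms(2)])

lemma has_weak_partial_weak_partial:
  "has_weak_partial \<Lambda> j f g \<Longrightarrow> has_weak_partial \<Lambda> j f (weak_partial \<Lambda> j f)"
  unfolding weak_partial_def by (rule someI[of "has_weak_partial \<Lambda> j f" g])

lemma aclE:
  assumes "acl \<Lambda> j f g"
  obtains S :: "nat set" and c where "\<And>N. \<exists>n\<in>S. N \<le> n"
    and "\<And>n. n \<in> S \<Longrightarrow> line_primitive \<Lambda> j f g n (c n)"
proof -
  define S where "S = {n. \<exists>c. line_primitive \<Lambda> j f g n c}"
  have "\<forall>n\<in>S. \<exists>c. line_primitive \<Lambda> j f g n c" by (simp add: S_def)
  from bchoice[OF this] obtain c where c: "\<forall>n\<in>S. line_primitive \<Lambda> j f g n (c n)" ..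
  have "\<exists>n\<in>S. N \<le> n" for N
    using assms unfolding acl_def S_def by blast
  then show ?thesis using c by (intro that[of S c]) auto
qed

text \<open>In contrast to a test function, \<open>\<eta>\<close> has to be regular and compactly
  supported in the direction \<open>j\<close> only. This is needed when \<open>\<eta>\<close>
  contains a conditional density, whose support in the block spins is unbounded; integrability of
  the two products then has to be assumed.\<close>

lemma acl_integration_by_parts:
  fixes f g \<eta> D :: "'d::finite config \<Rightarrow> real"
  assumes fin: "finite \<Lambda>" and j: "j \<in> \<Lambda>" and acl: "acl \<Lambda> j f g"
    and \<eta>: "\<And>x t. x \<in> cspace \<Lambda> \<Longrightarrow> ((\<lambda>t. \<eta> (x(j := t))) has_real_derivative D (x(j := t))) (at t)"
    and D: "\<And>x t. x \<in> cspace \<Lambda> \<Longrightarrow> isCont (\<lambda>t. D (x(j := t))) t"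
    and supp: "\<And>x. x \<in> cspace \<Lambda> \<Longrightarrow> \<bar>x j\<bar> > R \<Longrightarrow> \<eta> x = 0 \<and> D x = 0"
    and int: "integrable (leb \<Lambda>) (\<lambda>x. f x * D x)" "integrable (leb \<Lambda>) (\<lambda>x. g x * \<eta> x)"
  shows "(\<integral>x. f x * D x \<partial>leb \<Lambda>) = - (\<integral>x. g x * \<eta> x \<partial>leb \<Lambda>)"
proof -
  obtain S c where S: "\<And>N. \<exists>n\<in>S. N \<le> n"
    and c: "\<And>n. n \<in> S \<Longrightarrow> line_primitive \<Lambda> j f g n (c n)"
    using aclE[OF acl] by metis
  have lg: "locally_integrable \<Lambda> g" using acl by (simp add: acl_def)
  have "AE x in leb \<Lambda>. \<forall>n. n \<in> S \<longrightarrow> (\<forall>i\<in>\<Lambda>. \<bar>x i\<bar> < real n) \<longrightarrow>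
        f x = c n (x(j := 0)) + (LBINT r:{- real n..x j}. g (x(j := r)))"
  proof (subst AE_all_countable, rule allI)
    fix n
    show "AE x in leb \<Lambda>. n \<in> S \<longrightarrow> (\<forall>i\<in>\<Lambda>. \<bar>x i\<bar> < real n) \<longrightarrow>
        f x = c n (x(j := 0)) + (LBINT r:{- real n..x j}. g (x(j := r)))"
    proof (cases "n \<in> S")
      case True
      show ?thesis using c[OF True] unfolding line_primitive_def by (rule eventually_mono) blast
    qed simp
  qed
  from AE_lebn_coordinate[OF fin j this]
  have ae1: "AE x in leb (\<Lambda> - {j}). AE t in lborel. \<forall>n. n \<in> S \<longrightarrow> (\<forall>i\<in>\<Lambda>. \<bar>(x(j := t)) i\<bar> < real n) \<longrightarrow>
        f (x(j := t)) = c n (x(j := 0)) + (LBINT r:{- real n..t}. g (x(j := r)))"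
    by (simp only: fun_upd_upd fun_upd_same)
  have ae2: "AE x in leb (\<Lambda> - {j}). \<forall>n::nat. integrable lborel (\<lambda>t. indicator (PiE \<Lambda> (\<lambda>_. {-real n..real n})) (x(j := t)) * g (x(j := t)))"
    by (subst AE_all_countable) (rule allI, rule AE_integrable_coordinate[OF fin j locally_integrableD[OF lg]])
  have "AE x in leb (\<Lambda> - {j}). (\<integral>t. f (x(j := t)) * D (x(j := t)) \<partial>lborel) = - (\<integral>t. g (x(j := t)) * \<eta> (x(j := t)) \<partial>lborel)"
    using ae1 ae2 AE_space
  proof eventually_elim
    case (elim x)
    have xc: "x(j := t) \<in> cspace \<Lambda>" for t
      using fun_upd_space_lebn[OF elim(3) j, of t] by (simp add: space_PiM)
    have \<eta>': "((\<lambda>t. \<eta> (x(j := t))) has_real_derivative D (x(j := t))) (at t)" for t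
      using \<eta>[OF xc[of 0], of t] by simp
    have D': "isCont (\<lambda>t. D (x(j := t))) t" for t
      using D[OF xc[of 0], of t] by simp
    have supp': "\<eta> (x(j := t)) = 0" "D (x(j := t)) = 0" if "\<bar>t\<bar> > R" for t
      using supp[OF xc[of t]] that by auto
    obtain n0 where n0: "\<forall>i\<in>\<Lambda>. \<bar>x i\<bar> < real n0" using cspace_in_cube[OF fin] by blast
    obtain m :: nat where m: "R < real m" using reals_Archimedean2 by blast
    \<comment> \<open>The radius exceeds the fixed coordinates of \<open>x\<close> and the support
      of \<open>\<eta>\<close> on the line, so the primitive formula holds almost everywhere on the
      set where \<open>D\<close> does not vanish.\<close>
    obtain n where n: "n \<in> S" "max n0 m \<le> n" using S by blast
    have xn: "\<bar>x i\<bar> < real n" if "i \<in> \<Lambda>" for i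
    proof -
      have "real n0 \<le> real n" using n(2) by simp
      then show ?thesis using n0 that by (meson less_le_trans)
    qed
    have Rn: "R < real n" using m n(2) by auto
    have box: "x(j := t) \<in> PiE \<Lambda> (\<lambda>_. {-real n..real n}) \<longleftrightarrow> t \<in> {-real n..real n}" for t
    proof -
      have "x(j := t) \<in> PiE \<Lambda> (\<lambda>_. {-real n..real n}) \<longleftrightarrow> \<bar>t\<bar> \<le> real n"
        unfolding cube_iff[OF xc] using less_imp_le[OF xn] j by auto
      then show ?thesis by auto
    qed
    have gi: "set_integrable lborel {-real n..real n} (\<lambda>t. g (x(j := t)))"
      using elim(2)[rule_format, of n] unfolding set_integrable_def
      by (simp add: indicator_def box)
    have ends: "\<eta> (x(j := real n)) = 0" "\<eta> (x(j := - real n)) = 0"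
      using Rn by (auto intro!: supp')
    let ?P = "\<lambda>t. (LBINT r:{- real n..t}. g (x(j := r)))"
    note ibp = integral_primitive_by_parts[OF gi D' \<eta>' ends(1)]
    have n_nn: "- real n \<le> real n" by simp
    note FTC = integral_FTC_Icc_real[OF n_nn \<eta>' D'] has_bochner_integral_FTC_Icc_real[OF n_nn \<eta>' D']
    have comm: "indicator {-real n..real n} t * D (x(j := t)) = D (x(j := t)) * indicator {-real n..real n} t" for t
      by (rule mult.commute)
    have intD: "integrable lborel (\<lambda>t. indicator {-real n..real n} t * D (x(j := t)))"
      unfolding comm by (rule integrable.intros[OF FTC(2)])
    have "(\<integral>t. f (x(j := t)) * D (x(j := t)) \<partial>lborel)
      = (\<integral>t. c n (x(j := 0)) * (indicator {-real n..real n} t * D (x(j := t)))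
          + indicator {-real n..real n} t *\<^sub>R (?P t * D (x(j := t))) \<partial>lborel)"
    proof (rule integral_cong_AE)
      have "AE t in lborel. f (x(j := t)) * D (x(j := t)) = c n (x(j := 0)) * (indicator {-real n..real n} t * D (x(j := t)))
          + indicator {-real n..real n} t *\<^sub>R (?P t * D (x(j := t)))"
        using elim(1)
      proof eventually_elim
        case (elim t)
        show ?case
        proof (cases "\<bar>t\<bar> < real n")
          case True
          then have "\<forall>i\<in>\<Lambda>. \<bar>(x(j := t)) i\<bar> < real n" using xn by simp
          then have f_eq: "f (x(j := t)) = c n (x(j := 0)) + ?P t" using elim n(1) by blast
          have "t \<in> {-real n..real n}" using True by auto
          then show ?thesis unfolding f_eq by (simp add: distrib_right)
        next
          case False
          then have "D (x(j := t)) = 0" using Rn by (intro supp') auto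
          then show ?thesis by simp
        qed
      qed
      then show "AE t in lborel. f (x(j := t)) * D (x(j := t)) = c n (x(j := 0)) * (indicator {-real n..real n} t * D (x(j := t)))
          + indicator {-real n..real n} t *\<^sub>R (?P t * D (x(j := t)))" .
      show "(\<lambda>t. c n (x(j := 0)) * (indicator {-real n..real n} t * D (x(j := t)))
          + indicator {-real n..real n} t *\<^sub>R (?P t * D (x(j := t)))) \<in> borel_measurable lborel"
        by (rule borel_measurable_add[OF borel_measurable_times[OF borel_measurable_const borel_measurable_integrable[OF intD]]
              borel_measurable_integrable[OF ibp(1)[unfolded set_integrable_def]]])
      show "(\<lambda>t. f (x(j := t)) * D (x(j := t))) \<in> borel_measurable lborel"
        using measurable_compose[OF measurable_fun_upd_lebn[OF elim(3) j] borel_measurable_integrable[OF int(1)]]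
        by simp
    qed
    also have "\<dots> = c n (x(j := 0)) * (\<integral>t. indicator {-real n..real n} t * D (x(j := t)) \<partial>lborel)
      + (LBINT t:{-real n..real n}. ?P t * D (x(j := t)))"
      unfolding set_lebesgue_integral_def
      by (subst Bochner_Integration.integral_add[OF integrable_mult_right[OF intD] ibp(1)[unfolded set_integrable_def set_lebesgue_integral_def]])
        simp
    \<comment> \<open>The constant of integration drops out because \<open>\<eta>\<close> vanishes
      at both ends of the interval.\<close>
    also have "(\<integral>t. indicator {-real n..real n} t * D (x(j := t)) \<partial>lborel) = 0"
      unfolding comm FTC(1) ends by simp
    also have "(LBINT t:{-real n..real n}. ?P t * D (x(j := t))) = - (LBINT t:{-real n..real n}. g (x(j := t)) * \<eta> (x(j := t)))"
      by (rule ibp(2))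
    also have "(LBINT t:{-real n..real n}. g (x(j := t)) * \<eta> (x(j := t))) = (\<integral>t. g (x(j := t)) * \<eta> (x(j := t)) \<partial>lborel)"
      unfolding set_lebesgue_integral_def
    proof (rule Bochner_Integration.integral_cong[OF refl])
      fix t
      show "indicator {-real n..real n} t *\<^sub>R (g (x(j := t)) * \<eta> (x(j := t))) = g (x(j := t)) * \<eta> (x(j := t))"
      proof (cases "t \<in> {-real n..real n}")
        case False
        then have "\<eta> (x(j := t)) = 0" using Rn by (intro supp') auto
        then show ?thesis by simp
      qed simp
    qed
    finally show ?case by (simp only: mult_zero_right add_0)
  qed
  then have "(\<integral>x. \<integral>t. f (x(j := t)) * D (x(j := t)) \<partial>lborel \<partial>leb (\<Lambda> - {j}))
    = (\<integral>x. - (\<integral>t. g (x(j := t)) * \<eta> (x(j := t)) \<partial>lborel) \<partial>leb (\<Lambda> - {j}))"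
  proof (rule integral_cong_AE[rotated 2])
    have *: "(\<lambda>x. \<integral>t. h (x(j := t)) \<partial>lborel) \<in> borel_measurable (leb (\<Lambda> - {j}))"
      if "h \<in> borel_measurable (leb \<Lambda>)" for h :: "'d config \<Rightarrow> real"
      using measurable_compose[OF measurable_fun_upd_pair_lebn[OF j] that]
      by (intro lborel.borel_measurable_lebesgue_integral) (simp add: split_beta')
    show "(\<lambda>x. \<integral>t. f (x(j := t)) * D (x(j := t)) \<partial>lborel) \<in> borel_measurable (leb (\<Lambda> - {j}))"
      using *[OF borel_measurable_integrable[OF int(1)]] .
    show "(\<lambda>x. - (\<integral>t. g (x(j := t)) * \<eta> (x(j := t)) \<partial>lborel)) \<in> borel_measurable (leb (\<Lambda> - {j}))"
      using *[OF borel_measurable_integrable[OF int(2)]] by simp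
  qed
  then show ?thesis
    by (simp add: integral_lebn_coordinate[OF fin j int(1)] integral_lebn_coordinate[OF fin j int(2)])
qed

lemma test_fun_support:
  assumes \<eta>: "test_fun \<Lambda> \<eta>"
  obtains R where "\<And>x i. x \<in> cspace \<Lambda> \<Longrightarrow> i \<in> \<Lambda> \<Longrightarrow> \<bar>x i\<bar> > R \<Longrightarrow> \<eta> x = 0"
    and "\<And>j x i. j \<in> \<Lambda> \<Longrightarrow> x \<in> cspace \<Lambda> \<Longrightarrow> i \<in> \<Lambda> \<Longrightarrow> \<bar>x i\<bar> > R \<Longrightarrow> partial_deriv j \<eta> x = 0"
proof -
  obtain R where R: "\<And>x i. x \<in> cspace \<Lambda> \<Longrightarrow> \<eta> x \<noteq> 0 \<Longrightarrow> i \<in> \<Lambda> \<Longrightarrow> \<bar>x i\<bar> \<le> R"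
    using \<eta> unfolding test_fun_def by metis
  have D0: "partial_deriv j \<eta> x = 0" if j: "j \<in> \<Lambda>" and x: "x \<in> cspace \<Lambda>" and i: "i \<in> \<Lambda>" "\<bar>x i\<bar> > R" for j x i
  proof -
    have z: "\<eta> (x(j := t)) = 0" if "i \<noteq> j \<or> \<bar>t\<bar> > R" for t
    proof (rule ccontr)
      assume "\<eta> (x(j := t)) \<noteq> 0"
      from R[OF fun_upd_cspace[OF x j, of t] this i(1)] show False using i(2) that by (auto split: if_splits)
    qed
    have "((\<lambda>t. \<eta> (x(j := t))) has_real_derivative 0) (at (x j))"
    proof (cases "i = j")
      case True
      show ?thesis
      proof (rule has_field_derivative_transform_within_open[OF DERIV_const[of 0]])
        show "open {t :: real. \<bar>t\<bar> > R}"
          by (intro open_Collect_less continuous_intros)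
      qed (use True i z in auto)
    qed (simp add: z)
    then show ?thesis unfolding partial_deriv_def by (rule DERIV_imp_deriv)
  qed
  show ?thesis
  proof (rule that[of R])
    show "\<eta> x = 0" if "x \<in> cspace \<Lambda>" "i \<in> \<Lambda>" "\<bar>x i\<bar> > R" for x i
      using R[OF that(1) _ that(2)] that(3) by (meson not_le)
  qed (rule D0)
qed

lemma integrable_times_compact_support:
  assumes fin: "finite \<Lambda>" and k: "locally_integrable \<Lambda> k" and h: "continuous_on (cspace \<Lambda>) h"
    and s: "\<And>x i. x \<in> cspace \<Lambda> \<Longrightarrow> i \<in> \<Lambda> \<Longrightarrow> \<bar>x i\<bar> > R \<Longrightarrow> h x = 0"
  shows "integrable (leb \<Lambda>) (\<lambda>x. k x * h x)"
proof -
  obtain K where K: "\<And>x. x \<in> PiE \<Lambda> (\<lambda>_. {-R..R}) \<Longrightarrow> \<bar>h x\<bar> \<le> K"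
    using continuous_on_cspace_bounded[OF h] by metis
  show ?thesis
  proof (rule locally_integrable_times_bounded[OF fin k continuous_on_cspace_measurable[OF h] K])
    fix x assume x: "x \<in> cspace \<Lambda>" "x \<notin> PiE \<Lambda> (\<lambda>_. {-R..R})"
    then obtain i where "i \<in> \<Lambda>" "\<bar>x i\<bar> > R" using cube_iff[OF x(1)] by (auto simp: not_le)
    then show "h x = 0" using s x by blast
  qed
qed

lemma test_fun_continuous:
  assumes "test_fun \<Lambda> \<eta>"
  shows "continuous_on (cspace \<Lambda>) \<eta>" "j \<in> \<Lambda> \<Longrightarrow> continuous_on (cspace \<Lambda>) (partial_deriv j \<eta>)"
  using assms by (auto simp: test_fun_def)

lemma integrable_times_test_fun:
  assumes fin: "finite \<Lambda>" and k: "locally_integrable \<Lambda> k" and \<eta>: "test_fun \<Lambda> \<eta>"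
  shows "integrable (leb \<Lambda>) (\<lambda>x. k x * \<eta> x)"
    and "j \<in> \<Lambda> \<Longrightarrow> integrable (leb \<Lambda>) (\<lambda>x. k x * partial_deriv j \<eta> x)"
proof -
  obtain R where R: "\<And>x i. x \<in> cspace \<Lambda> \<Longrightarrow> i \<in> \<Lambda> \<Longrightarrow> \<bar>x i\<bar> > R \<Longrightarrow> \<eta> x = 0"
    "\<And>j x i. j \<in> \<Lambda> \<Longrightarrow> x \<in> cspace \<Lambda> \<Longrightarrow> i \<in> \<Lambda> \<Longrightarrow> \<bar>x i\<bar> > R \<Longrightarrow> partial_deriv j \<eta> x = 0"
    using test_fun_support[OF \<eta>] by metis
  show "integrable (leb \<Lambda>) (\<lambda>x. k x * \<eta> x)"
    by (rule integrable_times_compact_support[OF fin k test_fun_continuous(1)[OF \<eta>] R(1)])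
  show "integrable (leb \<Lambda>) (\<lambda>x. k x * partial_deriv j \<eta> x)" if "j \<in> \<Lambda>"
    by (rule integrable_times_compact_support[OF fin k test_fun_continuous(2)[OF \<eta> that] R(2)[OF that]])
qed

lemma acl_imp_has_weak_partial:
  assumes fin: "finite \<Lambda>" and j: "j \<in> \<Lambda>" and acl: "acl \<Lambda> j f g"
  shows "has_weak_partial \<Lambda> j f g"
  unfolding has_weak_partial_def
proof (intro conjI allI impI)
  show l: "locally_integrable \<Lambda> f" "locally_integrable \<Lambda> g" using acl by (simp_all add: acl_def)
  fix \<eta> assume \<eta>: "test_fun \<Lambda> \<eta>"
  obtain R where R: "\<And>x i. x \<in> cspace \<Lambda> \<Longrightarrow> i \<in> \<Lambda> \<Longrightarrow> \<bar>x i\<bar> > R \<Longrightarrow> \<eta> x = 0"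
    "\<And>j x i. j \<in> \<Lambda> \<Longrightarrow> x \<in> cspace \<Lambda> \<Longrightarrow> i \<in> \<Lambda> \<Longrightarrow> \<bar>x i\<bar> > R \<Longrightarrow> partial_deriv j \<eta> x = 0"
    using test_fun_support[OF \<eta>] by metis
  show "(\<integral>x. f x * partial_deriv j \<eta> x \<partial>leb \<Lambda>) = - (\<integral>x. g x * \<eta> x \<partial>leb \<Lambda>)"
  proof (rule acl_integration_by_parts[OF fin j acl])
    show "\<eta> x = 0 \<and> partial_deriv j \<eta> x = 0" if "x \<in> cspace \<Lambda>" "\<bar>x j\<bar> > R" for x
      using R(1)[OF that(1) j that(2)] R(2)[OF j that(1) j that(2)] by simp
    show "integrable (leb \<Lambda>) (\<lambda>x. f x * partial_deriv j \<eta> x)" "integrable (leb \<Lambda>) (\<lambda>x. g x * \<eta> x)"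
      using integrable_times_test_fun[OF fin _ \<eta>] l j by blast+
  qed (use test_fun_DERIV[OF \<eta> j] test_fun_isCont[OF \<eta> j] in auto)
qed

lemma ennreal_abs_integral_le:
  fixes h :: "'a \<Rightarrow> real"
  shows "ennreal \<bar>\<integral>x. h x \<partial>M\<bar> \<le> (\<integral>\<^sup>+x. ennreal \<bar>h x\<bar> \<partial>M)"
proof (cases "integrable M h")
  case True
  then show ?thesis using integral_norm_bound_ennreal[OF True] by simp
next
  case False
  then show ?thesis by (simp add: not_integrable_integral_eq)
qed

lemma integral_bump_pos: "R > 0 \<Longrightarrow> 0 < (\<integral>t. bump (-R) R 1 t \<partial>lborel)"
proof -
  assume R: "R > 0"
  have int: "integrable lborel (bump (-R) R 1)"
  proof (rule Bochner_Integration.integrable_bound)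
    show "integrable lborel (indicator {-R..R} :: real \<Rightarrow> real)" by (simp add: emeasure_lborel_Icc_eq)
    have "norm (bump (-R) R 1 t) \<le> norm (indicator {-R..R} t :: real)" for t
    proof (cases "t \<in> {-R<..<R}")
      case False
      then show ?thesis using bump_outside[of "-R" R t 1] R by simp
    qed (use bump_bounds[of "-R" R 1 t] in auto)
    then show "AE t in lborel. norm (bump (-R) R 1 t) \<le> norm (indicator {-R..R} t :: real)" by (rule AE_I2)
  qed simp
  have nn: "0 \<le> (\<integral>t. bump (-R) R 1 t \<partial>lborel)" by (rule integral_nonneg_AE) (simp add: bump_bounds)
  have "(\<integral>t. bump (-R) R 1 t \<partial>lborel) \<noteq> 0"
  proof
    assume "(\<integral>t. bump (-R) R 1 t \<partial>lborel) = 0"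
    then have "AE t in lborel. bump (-R) R 1 t = 0"
      using int by (subst (asm) integral_nonneg_eq_0_iff_AE) (auto simp: bump_bounds)
    then have "AE t in lborel. t \<notin> {-R<..<R}"
      by (rule eventually_mono) (use bump_pos[of _ "-R" R 0] in force)
    then have "emeasure lborel {t \<in> space lborel. t \<in> {-R<..<R}} = 0" by (rule emeasure_eq_0_AE)
    moreover have "{t \<in> space lborel. t \<in> {-R<..<R}} = {-R<..<R}" by auto
    ultimately have "emeasure lborel {-R<..<R} = 0" by (simp only:)
    then show False using R by simp
  qed
  with nn show ?thesis by simp
qed

text \<open>Du Bois-Reymond: subtracting a primitive of \<open>g\<close> leaves a function with vanishing weak derivative.
  A test function in the direction \<open>j\<close> is a derivative once its mean is removed by a multiple of a
  fixed bump \<open>k\<close>, so this function equals its \<open>k\<close>-average along lines.\<close>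

lemma weak_partial_line_primitive:
  fixes f g :: "'d::finite config \<Rightarrow> real"
  assumes fin: "finite \<Lambda>" and j: "j \<in> \<Lambda>" and weak: "has_weak_partial \<Lambda> j f g" and n: "n \<ge> 1"
  shows "\<exists>c. line_primitive \<Lambda> j f g n c"
proof -
  define R where "R = real n"
  have R: "R > 0" "R \<ge> 0" "- R \<le> R" using n by (auto simp: R_def)
  have lf: "locally_integrable \<Lambda> f" and lg: "locally_integrable \<Lambda> g"
    using weak by (auto simp: has_weak_partial_def)
  note fm [measurable] = locally_integrable_measurable[OF fin lf]
  note gm [measurable] = locally_integrable_measurable[OF fin lg]
  define Q where "Q = PiE \<Lambda> (\<lambda>_. {-R..R})"
  have Qm [measurable]: "Q \<in> sets (leb \<Lambda>)" unfolding Q_def by (rule cube_measurable[OF fin])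
  have fQ: "integrable (leb \<Lambda>) (\<lambda>x. indicator Q x * f x)" and gQ: "integrable (leb \<Lambda>) (\<lambda>x. indicator Q x * g x)"
    unfolding Q_def by (intro locally_integrableD lf lg)+
  have upd: "x(j := t) \<in> cspace \<Lambda>" if "x \<in> space (leb (\<Lambda> - {j}))" for x t
    using fun_upd_space_lebn[OF that j, of t] unfolding space_lebn .
  have Qupd: "x(j := t) \<in> Q \<longleftrightarrow> (\<forall>i\<in>\<Lambda> - {j}. \<bar>x i\<bar> \<le> R) \<and> \<bar>t\<bar> \<le> R" if "x \<in> space (leb (\<Lambda> - {j}))" for x t
    unfolding Q_def cube_iff[OF upd[OF that]] using j by auto
  have meas2: "(\<lambda>x. \<integral>r. u (x(j := r)) * v x r \<partial>lborel) \<in> borel_measurable (leb \<Lambda>)"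
    if u: "u \<in> borel_measurable (leb \<Lambda>)" and v: "(\<lambda>(x, r). v x r) \<in> borel_measurable (leb \<Lambda> \<Otimes>\<^sub>M lborel)"
    for u :: "'d config \<Rightarrow> real" and v :: "'d config \<Rightarrow> real \<Rightarrow> real"
  proof (rule lborel.borel_measurable_lebesgue_integral)
    show "(\<lambda>(x, r). u (x(j := r)) * v x r) \<in> borel_measurable (leb \<Lambda> \<Otimes>\<^sub>M lborel)"
      using borel_measurable_times[OF measurable_compose[OF measurable_fun_upd_pair_lebn'[OF j] u] v]
      by (simp add: split_beta')
  qed
  define p where "p x = (LBINT r:{-R..x j}. g (x(j := r)))" for x
  have p_alt: "p x = (\<integral>r. g (x(j := r)) * (if -R \<le> r \<and> r \<le> x j then 1 else 0) \<partial>lborel)" for x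
    unfolding p_def set_lebesgue_integral_def by (intro Bochner_Integration.integral_cong refl) (simp add: indicator_def)
  have pm [measurable]: "p \<in> borel_measurable (leb \<Lambda>)"
  proof -
    have "(\<lambda>(x, r). if -R \<le> r \<and> r \<le> x j then 1 else 0 :: real) \<in> borel_measurable (leb \<Lambda> \<Otimes>\<^sub>M lborel)"
    proof -
      have [measurable]: "(\<lambda>x. x j) \<in> borel_measurable (leb \<Lambda>)" using j by measurable
      show ?thesis by measurable
    qed
    from meas2[OF gm this] show ?thesis by (simp only: p_alt[abs_def])
  qed
  have pQ: "integrable (leb \<Lambda>) (\<lambda>x. indicator Q x * p x)"
  proof (rule integrable_of_line_bound[OF fin j gQ, where K = 1 and R = R])
    show "(\<lambda>x. indicator Q x * p x) \<in> borel_measurable (leb \<Lambda>)" by measurable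
    fix x :: "'d config" and t assume x: "x \<in> space (leb (\<Lambda> - {j}))"
    show "ennreal \<bar>indicator Q (x(j := t)) * p (x(j := t))\<bar> \<le>
      ennreal 1 * indicator {-R..R} t * (\<integral>\<^sup>+r. ennreal \<bar>indicator Q (x(j := r)) * g (x(j := r))\<bar> \<partial>lborel)"
    proof (cases "x(j := t) \<in> Q")
      case True
      then have t: "t \<in> {-R..R}" using Qupd[OF x] by auto
      have "ennreal \<bar>p (x(j := t))\<bar> \<le> (\<integral>\<^sup>+r. ennreal \<bar>g (x(j := r)) * (if -R \<le> r \<and> r \<le> t then 1 else 0)\<bar> \<partial>lborel)"
        unfolding p_alt fun_upd_upd fun_upd_same by (rule ennreal_abs_integral_le)
      also have "\<dots> \<le> (\<integral>\<^sup>+r. ennreal \<bar>indicator Q (x(j := r)) * g (x(j := r))\<bar> \<partial>lborel)"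
      proof (rule nn_integral_mono, rule ennreal_leI)
        fix r
        have "x(j := r) \<in> Q" if "-R \<le> r" "r \<le> t"
          using True t that unfolding Qupd[OF x] by auto
        then show "\<bar>g (x(j := r)) * (if -R \<le> r \<and> r \<le> t then 1 else 0)\<bar> \<le> \<bar>indicator Q (x(j := r)) * g (x(j := r))\<bar>"
          by (cases "-R \<le> r \<and> r \<le> t") auto
      qed
      finally show ?thesis using True t by simp
    qed simp
  qed
  \<comment> \<open>It remains to see that \<open>w\<close> is constant along
    \<open>j\<close>-lines; \<open>c\<close> below is the candidate for this constant, a weighted
    mean of \<open>w\<close> over the line.\<close>
  define w where "w x = f x - p x" for x
  have wm [measurable]: "w \<in> borel_measurable (leb \<Lambda>)" unfolding w_def by measurable
  have wQ: "integrable (leb \<Lambda>) (\<lambda>x. indicator Q x * w x)"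
    unfolding w_def right_diff_distrib by (rule Bochner_Integration.integrable_diff[OF fQ pQ])
  define k where "k = bump (-R) R 1"
  have kz: "k t = 0" if "\<bar>t\<bar> \<ge> R" for t unfolding k_def using that R by (intro bump_outside) auto
  have kb: "0 \<le> k t" "k t \<le> 1" for t unfolding k_def by (rule bump_bounds)+
  have kc: "isCont k t" for t unfolding k_def by (rule isCont_bump)
  have km [measurable]: "k \<in> borel_measurable borel" unfolding k_def by simp
  define \<kappa> where "\<kappa> = (\<integral>t. k t \<partial>lborel)"
  have \<kappa>: "\<kappa> > 0" unfolding \<kappa>_def k_def by (rule integral_bump_pos[OF R(1)])
  define c where "c x = (\<integral>r. w (x(j := r)) * k r \<partial>lborel) / \<kappa>" for x
  have c_upd: "c (x(j := t)) = c x" for x t by (simp only: c_def fun_upd_upd)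
  have cm [measurable]: "c \<in> borel_measurable (leb \<Lambda>)"
  proof -
    have "(\<lambda>(x, r). k r) \<in> borel_measurable (leb \<Lambda> \<Otimes>\<^sub>M lborel)" by measurable
    from meas2[OF wm this] show ?thesis unfolding c_def[abs_def] by (rule borel_measurable_divide) simp
  qed
  have cQ: "integrable (leb \<Lambda>) (\<lambda>x. indicator Q x * c x)"
  proof (rule integrable_of_line_bound[OF fin j wQ, where K = "1 / \<kappa>" and R = R])
    show "(\<lambda>x. indicator Q x * c x) \<in> borel_measurable (leb \<Lambda>)" by measurable
    fix x :: "'d config" and t assume x: "x \<in> space (leb (\<Lambda> - {j}))"
    show "ennreal \<bar>indicator Q (x(j := t)) * c (x(j := t))\<bar> \<le>
      ennreal (1 / \<kappa>) * indicator {-R..R} t * (\<integral>\<^sup>+r. ennreal \<bar>indicator Q (x(j := r)) * w (x(j := r))\<bar> \<partial>lborel)"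
    proof (cases "x(j := t) \<in> Q")
      case True
      then have t: "t \<in> {-R..R}" using Qupd[OF x] by auto
      have "ennreal \<bar>c (x(j := t))\<bar> = ennreal (1 / \<kappa>) * ennreal \<bar>\<integral>r. w (x(j := r)) * k r \<partial>lborel\<bar>"
        unfolding c_upd c_def using \<kappa> by (subst ennreal_mult[symmetric]) (auto simp: abs_divide)
      also have "\<dots> \<le> ennreal (1 / \<kappa>) * (\<integral>\<^sup>+r. ennreal \<bar>w (x(j := r)) * k r\<bar> \<partial>lborel)"
        by (intro mult_left_mono ennreal_abs_integral_le) simp
      also have "\<dots> \<le> ennreal (1 / \<kappa>) * (\<integral>\<^sup>+r. ennreal \<bar>indicator Q (x(j := r)) * w (x(j := r))\<bar> \<partial>lborel)"
      proof (intro mult_left_mono nn_integral_mono ennreal_leI)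
        fix r
        show "\<bar>w (x(j := r)) * k r\<bar> \<le> \<bar>indicator Q (x(j := r)) * w (x(j := r))\<bar>"
        proof (cases "\<bar>r\<bar> \<le> R")
          case r: True
          then have "x(j := r) \<in> Q" using True unfolding Qupd[OF x] by auto
          moreover have "\<bar>w (x(j := r))\<bar> * \<bar>k r\<bar> \<le> \<bar>w (x(j := r))\<bar> * 1"
            using kb[of r] by (intro mult_left_mono) auto
          ultimately show ?thesis by (simp add: abs_mult)
        qed (simp add: kz)
      qed simp
      finally show ?thesis using True t by simp
    qed simp
  qed
  have F_int: "integrable (leb \<Lambda>) (\<lambda>x. u x * v x)"
    if u: "u \<in> borel_measurable (leb \<Lambda>)" "integrable (leb \<Lambda>) (\<lambda>x. indicator Q x * u x)"
      and v: "v \<in> borel_measurable (leb \<Lambda>)" "\<And>x. \<bar>v x\<bar> \<le> K" "\<And>x. x \<in> cspace \<Lambda> \<Longrightarrow> x \<notin> Q \<Longrightarrow> v x = 0" for u v :: "'d config \<Rightarrow> real" and K :: real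
  proof (rule Bochner_Integration.integrable_bound)
    show "integrable (leb \<Lambda>) (\<lambda>x. K * (indicator Q x * u x))" by (rule integrable_mult_right[OF u(2)])
    show "AE x in leb \<Lambda>. norm (u x * v x) \<le> norm (K * (indicator Q x * u x))"
    proof (rule AE_I2)
      fix x assume x: "x \<in> space (leb \<Lambda>)"
      have "\<bar>u x\<bar> * \<bar>v x\<bar> \<le> \<bar>u x\<bar> * \<bar>K\<bar>" using v(2)[of x] by (intro mult_left_mono) auto
      then show "norm (u x * v x) \<le> norm (K * (indicator Q x * u x))"
        using v(3)[of x] x by (cases "x \<in> Q") (auto simp: space_lebn abs_mult mult.commute)
    qed
    show "(\<lambda>x. u x * v x) \<in> borel_measurable (leb \<Lambda>)" by (rule borel_measurable_times[OF u(1) v(1)])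
  qed
  have "AE x in leb \<Lambda>. x \<in> PiE \<Lambda> (\<lambda>_. {-R<..<R}) \<longrightarrow> w x - c x = 0"
  proof (rule AE_zero_of_bumps[OF fin])
    have wcQ: "integrable (leb \<Lambda>) (\<lambda>x. indicator Q x * (w x - c x))"
      unfolding right_diff_distrib by (rule Bochner_Integration.integrable_diff[OF wQ cQ])
    show "integrable (leb \<Lambda>) (\<lambda>x. (w x - c x) * indicator (PiE \<Lambda> (\<lambda>_. {-R<..<R})) x)"
    proof (rule F_int[OF _ wcQ, where K = 1])
      have "PiE \<Lambda> (\<lambda>_. {-R<..<R}) \<subseteq> Q" unfolding Q_def by (rule PiE_mono) auto
      then show "indicator (PiE \<Lambda> (\<lambda>_. {-R<..<R})) x = (0::real)" if "x \<notin> Q" for x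
        using that by (metis indicator_simps(2) subsetD)
      show "indicator (PiE \<Lambda> (\<lambda>_. {-R<..<R})) \<in> borel_measurable (leb \<Lambda>)"
        using fin by (intro borel_measurable_indicator sets_PiM_I_finite) auto
    qed auto
    fix a b :: "'d site \<Rightarrow> real" and m
    assume ab: "\<And>i. i \<in> \<Lambda> \<Longrightarrow> - R \<le> a i \<and> a i < b i \<and> b i \<le> R"
    define h where "h x = (\<Prod>i\<in>\<Lambda> - {j}. bump (a i) (b i) m (x i))" for x
    define \<theta>0 where "\<theta>0 = bump (a j) (b j) m"
    have \<theta>0c: "isCont \<theta>0 t" for t unfolding \<theta>0_def by (rule isCont_bump)
    have \<theta>0z: "\<theta>0 t = 0" if "\<bar>t\<bar> \<ge> R" for t
      unfolding \<theta>0_def using that ab[OF j] by (intro bump_outside) auto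
    have h_upd: "h (x(j := t)) = h x" for x t unfolding h_def by (intro prod.cong) auto
    have hb: "\<bar>h x\<bar> \<le> 1" for x unfolding h_def by (auto simp: abs_prod bump_bounds intro!: prod_le_1)
    have hm [measurable]: "h \<in> borel_measurable (leb \<Lambda>)" unfolding h_def by measurable
    have bump0: "bump (a i) (b i) m t = 0" if "i \<in> \<Lambda>" "\<bar>t\<bar> > R" for i t
      using ab[OF that(1)] that(2) by (intro bump_outside) auto
    have h0: "h x = 0" if "i \<in> \<Lambda> - {j}" "\<bar>x i\<bar> > R" for x i
    proof -
      have "bump (a i) (b i) m (x i) = 0" using that by (intro bump0) auto
      then show ?thesis unfolding h_def using fin that(1) by (intro prod_zero) auto
    qed
    have I: "integrable (leb \<Lambda>) (\<lambda>x. u x * (F (x j) * h x))"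
      if u: "u \<in> borel_measurable (leb \<Lambda>)" "integrable (leb \<Lambda>) (\<lambda>x. indicator Q x * u x)"
        and Fc: "\<And>t. isCont F t" and F0: "\<And>t. \<bar>t\<bar> \<ge> R \<Longrightarrow> F t = 0" for u and F :: "real \<Rightarrow> real"
    proof -
      have Fco: "continuous_on S F" for S using Fc by (auto intro!: continuous_at_imp_continuous_on)
      have [measurable]: "F \<in> borel_measurable borel" by (rule borel_measurable_continuous_onI[OF Fco])
      have "bounded (F ` {-R..R})" by (intro compact_imp_bounded compact_continuous_image Fco compact_Icc)
      then obtain K where K: "\<And>t. t \<in> {-R..R} \<Longrightarrow> \<bar>F t\<bar> \<le> K"
        unfolding bounded_iff by (metis imageI real_norm_def)
      have K': "\<bar>F t\<bar> \<le> \<bar>K\<bar>" for t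
      proof (cases "t \<in> {-R..R}")
        case False
        then have "F t = 0" by (intro F0) auto
        then show ?thesis by simp
      qed (use K[of t] in auto)
      have [measurable]: "(\<lambda>x. x j) \<in> borel_measurable (leb \<Lambda>)" using j by measurable
      show ?thesis
      proof (rule F_int[OF u, where K = "\<bar>K\<bar>"])
        show "(\<lambda>x. F (x j) * h x) \<in> borel_measurable (leb \<Lambda>)" by measurable
        show "\<bar>F (x j) * h x\<bar> \<le> \<bar>K\<bar>" for x
        proof -
          have "\<bar>F (x j)\<bar> * \<bar>h x\<bar> \<le> \<bar>K\<bar> * 1" by (intro mult_mono K' hb) auto
          then show ?thesis by (simp add: abs_mult)
        qed
        fix x assume x: "x \<in> cspace \<Lambda>" "x \<notin> Q"
        then obtain i where i: "i \<in> \<Lambda>" "\<bar>x i\<bar> > R" unfolding Q_def using cube_iff[OF x(1)] not_le by blast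
        show "F (x j) * h x = 0"
        proof (cases "i = j")
          case True
          then show ?thesis using F0[of "x j"] i by simp
        next
          case False
          then show ?thesis using h0[of i x] i by simp
        qed
      qed
    qed
    define m0 where "m0 = (\<integral>t. \<theta>0 t \<partial>lborel)"
    have int1: "integrable lborel F" if "\<And>t. isCont F t" "\<And>t. \<bar>t\<bar> \<ge> R \<Longrightarrow> F t = 0" for F :: "real \<Rightarrow> real"
    proof -
      have "integrable lborel (\<lambda>t. indicator {-R..R} t *\<^sub>R F t)"
        by (rule borel_integrable_compact[OF compact_Icc]) (use that in \<open>auto intro: continuous_at_imp_continuous_on\<close>)
      moreover have "indicator {-R..R} t *\<^sub>R F t = F t" for t
        using that(2)[of t] by (cases "t \<in> {-R..R}") auto
      ultimately show ?thesis by (simp only:)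
    qed
    define G where "G t = \<theta>0 t - (m0 / \<kappa>) * k t" for t
    have Gc: "isCont G t" for t unfolding G_def by (intro continuous_intros \<theta>0c kc)
    have Gz: "G t = 0" if "\<bar>t\<bar> \<ge> R" for t unfolding G_def using that kz \<theta>0z by simp
    have Gint: "(\<integral>t. G t \<partial>lborel) = 0"
      unfolding G_def using int1[of \<theta>0] int1[of k] \<theta>0c \<theta>0z kc kz \<kappa>
      by (subst Bochner_Integration.integral_diff) (auto simp: m0_def[symmetric] \<kappa>_def[symmetric])
    obtain \<theta> where \<theta>: "\<And>t. (\<theta> has_real_derivative G t) (at t)" "\<And>t. \<bar>t\<bar> \<ge> R \<Longrightarrow> \<theta> t = 0"
      using compact_support_antiderivative[of G R] Gc Gz Gint R(2) by (metis abs_less_iff greaterThanLessThan_iff minus_less_iff not_le)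
    have \<theta>c: "isCont \<theta> t" for t by (rule DERIV_isCont[OF \<theta>(1)])
    have W: "(\<integral>x. f x * (G (x j) * h x) \<partial>leb \<Lambda>) = - (\<integral>x. g x * (\<theta> (x j) * h x) \<partial>leb \<Lambda>)"
    proof -
      define fm where "fm i = (if i = j then \<theta> else bump (a i) (b i) m)" for i
      define fm' where "fm' i = (if i = j then G else dbump (a i) (b i) m)" for i
      have 1: "(fm i has_real_derivative fm' i t) (at t)" for i t
        by (simp add: fm_def fm'_def \<theta>(1) DERIV_bump)
      have 2: "isCont (fm' i) t" for i t by (simp add: fm'_def Gc isCont_dbump)
      have 3: "fm i t = 0" if "i \<in> \<Lambda>" "\<bar>t\<bar> > R" for i t
        using that bump0[OF that] by (simp add: fm_def \<theta>(2))
      have hfm: "(\<Prod>i\<in>\<Lambda> - {j}. fm i (x i)) = h x" for x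
        unfolding h_def by (intro prod.cong) (auto simp: fm_def)
      have prod: "(\<Prod>i\<in>\<Lambda>. fm i (x i)) = \<theta> (x j) * h x" for x
        by (simp only: prod.remove[OF fin j] hfm) (simp add: fm_def)
      have pd: "partial_deriv j (\<lambda>x. \<Prod>i\<in>\<Lambda>. fm i (x i)) x = G (x j) * h x" for x
      proof -
        have "partial_deriv j (\<lambda>x. \<Prod>i\<in>\<Lambda>. fm i (x i)) x = fm' j (x j) * (\<Prod>i\<in>\<Lambda> - {j}. fm i (x i))"
          by (rule test_fun_prod(2)[where f = fm and f' = fm' and R = R]) (auto intro: fin 1 2 3 j)
        then show ?thesis by (simp only: hfm) (simp add: fm'_def)
      qed
      have test: "test_fun \<Lambda> (\<lambda>x. \<Prod>i\<in>\<Lambda>. fm i (x i))"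
        by (rule test_fun_prod(1)[where f = fm and f' = fm' and R = R]) (auto intro: fin 1 2 3)
      show ?thesis
        using has_weak_partialD[OF weak test] by (simp only: pd) (simp only: prod)
    qed
    \<comment> \<open>The primitive \<open>p\<close> obeys the same identity as \<open>f\<close>,
      here by Fubini on each line instead of the weak formulation. Hence \<open>w\<close> integrates
      to zero against \<open>G (x j) * h x\<close>, and its pairing with \<open>\<theta>0\<close>
      depends on the mean of \<open>\<theta>0\<close> only.\<close>
    have P: "(\<integral>x. p x * (G (x j) * h x) \<partial>leb \<Lambda>) = - (\<integral>x. g x * (\<theta> (x j) * h x) \<partial>leb \<Lambda>)"
    proof -
      have ip: "integrable (leb \<Lambda>) (\<lambda>x. p x * (G (x j) * h x))" by (rule I[OF pm pQ Gc Gz])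
      have ig: "integrable (leb \<Lambda>) (\<lambda>x. g x * (\<theta> (x j) * h x))" by (rule I[OF gm gQ \<theta>c \<theta>(2)])
      have "(\<integral>x. p x * (G (x j) * h x) \<partial>leb \<Lambda>)
        = (\<integral>x. \<integral>t. p (x(j := t)) * (G t * h x) \<partial>lborel \<partial>leb (\<Lambda> - {j}))"
        by (subst integral_lebn_coordinate[OF fin j ip]) (simp only: h_upd fun_upd_same)
      also have "\<dots> = (\<integral>x. \<integral>t. - (g (x(j := t)) * (\<theta> t * h x)) \<partial>lborel \<partial>leb (\<Lambda> - {j}))"
      proof (rule integral_cong_AE)
        have meas1: "(\<lambda>x. \<integral>t. u (x(j := t)) \<partial>lborel) \<in> borel_measurable (leb (\<Lambda> - {j}))"
          if "u \<in> borel_measurable (leb \<Lambda>)" for u :: "'d config \<Rightarrow> real"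
          using measurable_compose[OF measurable_fun_upd_pair_lebn[OF j] that]
          by (intro lborel.borel_measurable_lebesgue_integral) (simp add: split_beta')
        show "(\<lambda>x. \<integral>t. p (x(j := t)) * (G t * h x) \<partial>lborel) \<in> borel_measurable (leb (\<Lambda> - {j}))"
          using meas1[OF borel_measurable_integrable[OF ip]] unfolding h_upd fun_upd_same .
        show "(\<lambda>x. \<integral>t. - (g (x(j := t)) * (\<theta> t * h x)) \<partial>lborel) \<in> borel_measurable (leb (\<Lambda> - {j}))"
          using meas1[OF borel_measurable_uminus[OF borel_measurable_integrable[OF ig]]] unfolding h_upd fun_upd_same .
        show "AE x in leb (\<Lambda> - {j}). (\<integral>t. p (x(j := t)) * (G t * h x) \<partial>lborel) = (\<integral>t. - (g (x(j := t)) * (\<theta> t * h x)) \<partial>lborel)"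
          using AE_integrable_coordinate[OF fin j gQ] AE_space
        proof eventually_elim
          case (elim x)
          show ?case
          proof (cases "\<forall>i\<in>\<Lambda> - {j}. \<bar>x i\<bar> \<le> R")
            case False
            then obtain i where "i \<in> \<Lambda> - {j}" "\<bar>x i\<bar> > R" by (auto simp: not_le)
            then have "h x = 0" by (rule h0)
            then show ?thesis by simp
          next
            case True
            have gi: "set_integrable lborel {-R..R} (\<lambda>t. g (x(j := t)))"
            proof -
              have "indicator Q (x(j := t)) = (indicator {-R..R} t :: real)" for t
              proof -
                have "x(j := t) \<in> Q \<longleftrightarrow> t \<in> {-R..R}" unfolding Qupd[OF elim(2)] using True by auto
                then show ?thesis by (auto simp: indicator_def)
              qed
              then show ?thesis using elim(1) unfolding set_integrable_def by simp
            qed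
            have z: "\<theta> R = 0" using R by (intro \<theta>(2)) simp
            have "(\<integral>t. p (x(j := t)) * (G t * h x) \<partial>lborel)
              = h x * (LBINT t:{-R..R}. (LBINT r:{-R..t}. g (x(j := r))) * G t)"
              unfolding set_lebesgue_integral_def integral_mult_right_zero[symmetric]
            proof (rule Bochner_Integration.integral_cong[OF refl])
              fix t
              show "p (x(j := t)) * (G t * h x) = h x * (indicator {-R..R} t *\<^sub>R ((\<integral>r. indicator {-R..t} r *\<^sub>R g (x(j := r)) \<partial>lborel) * G t))"
                unfolding p_def fun_upd_same fun_upd_upd set_lebesgue_integral_def
                using Gz[of t] by (cases "t \<in> {-R..R}") auto
            qed
            also have "\<dots> = h x * - (LBINT t:{-R..R}. g (x(j := t)) * \<theta> t)"
              by (simp only: integral_primitive_by_parts(2)[OF gi Gc \<theta>(1) z])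
            also have "\<dots> = (\<integral>t. - (g (x(j := t)) * (\<theta> t * h x)) \<partial>lborel)"
              unfolding set_lebesgue_integral_def integral_minus[symmetric] integral_mult_right_zero[symmetric]
            proof (rule Bochner_Integration.integral_cong[OF refl])
              fix t
              show "h x * - (indicator {-R..R} t *\<^sub>R (g (x(j := t)) * \<theta> t)) = - (g (x(j := t)) * (\<theta> t * h x))"
                using \<theta>(2)[of t] by (cases "t \<in> {-R..R}") auto
            qed
            finally show ?thesis .
          qed
        qed
      qed
      also have "\<dots> = - (\<integral>x. g x * (\<theta> (x j) * h x) \<partial>leb \<Lambda>)"
        by (subst integral_lebn_coordinate[OF fin j ig]) (simp only: h_upd fun_upd_same integral_minus)
      finally show ?thesis .
    qed
    have iw: "integrable (leb \<Lambda>) (\<lambda>x. w x * (\<theta>0 (x j) * h x))" by (rule I[OF wm wQ \<theta>0c \<theta>0z])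
    have ik: "integrable (leb \<Lambda>) (\<lambda>x. w x * (k (x j) * h x))" by (rule I[OF wm wQ kc kz])
    have ic: "integrable (leb \<Lambda>) (\<lambda>x. c x * (\<theta>0 (x j) * h x))" by (rule I[OF cm cQ \<theta>0c \<theta>0z])
    have if_: "integrable (leb \<Lambda>) (\<lambda>x. f x * (G (x j) * h x))" by (rule I[OF locally_integrable_measurable[OF fin lf] fQ Gc Gz])
    have ip: "integrable (leb \<Lambda>) (\<lambda>x. p x * (G (x j) * h x))" by (rule I[OF pm pQ Gc Gz])
    have "(\<integral>x. w x * (G (x j) * h x) \<partial>leb \<Lambda>) = (\<integral>x. f x * (G (x j) * h x) - p x * (G (x j) * h x) \<partial>leb \<Lambda>)"
      by (simp only: w_def left_diff_distrib)
    also have "\<dots> = (\<integral>x. f x * (G (x j) * h x) \<partial>leb \<Lambda>) - (\<integral>x. p x * (G (x j) * h x) \<partial>leb \<Lambda>)"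
      by (rule Bochner_Integration.integral_diff[OF if_ ip])
    also have "\<dots> = 0" unfolding W P by (rule diff_self)
    finally have "(\<integral>x. w x * (G (x j) * h x) \<partial>leb \<Lambda>) = 0" .
    moreover have "(\<integral>x. w x * (G (x j) * h x) \<partial>leb \<Lambda>)
      = (\<integral>x. w x * (\<theta>0 (x j) * h x) - (m0 / \<kappa>) * (w x * (k (x j) * h x)) \<partial>leb \<Lambda>)"
      by (intro Bochner_Integration.integral_cong refl) (simp add: G_def algebra_simps)
    moreover have "\<dots> = (\<integral>x. w x * (\<theta>0 (x j) * h x) \<partial>leb \<Lambda>) - (m0 / \<kappa>) * (\<integral>x. w x * (k (x j) * h x) \<partial>leb \<Lambda>)"
      by (subst Bochner_Integration.integral_diff[OF iw integrable_mult_right[OF ik]]) simp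
    ultimately have w1: "(\<integral>x. w x * (\<theta>0 (x j) * h x) \<partial>leb \<Lambda>) = (m0 / \<kappa>) * (\<integral>x. w x * (k (x j) * h x) \<partial>leb \<Lambda>)"
      by linarith
    \<comment> \<open>\<open>c\<close> does not change along the line, so its pairing with
      \<open>\<theta>0\<close> sees only the mean \<open>m0\<close>; the result is the right-hand
      side of \<open>w1\<close>.\<close>
    have "(\<integral>x. c x * (\<theta>0 (x j) * h x) \<partial>leb \<Lambda>) = (\<integral>x. \<integral>t. c x * (\<theta>0 t * h x) \<partial>lborel \<partial>leb (\<Lambda> - {j}))"
      by (subst integral_lebn_coordinate[OF fin j ic]) (simp only: h_upd fun_upd_same c_upd)
    also have "\<dots> = (\<integral>x. (m0 / \<kappa>) * (\<integral>t. w (x(j := t)) * (k t * h x) \<partial>lborel) \<partial>leb (\<Lambda> - {j}))"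
    proof (rule Bochner_Integration.integral_cong[OF refl])
      fix x
      have "(\<integral>t. c x * (\<theta>0 t * h x) \<partial>lborel) = c x * h x * m0"
        unfolding m0_def by (simp add: mult.commute[of _ "h x"] mult.assoc)
      moreover have "(\<integral>t. w (x(j := t)) * (k t * h x) \<partial>lborel) = (c x * \<kappa>) * h x"
        using \<kappa> unfolding c_def by (simp add: mult.assoc[symmetric])
      ultimately show "(\<integral>t. c x * (\<theta>0 t * h x) \<partial>lborel) = (m0 / \<kappa>) * (\<integral>t. w (x(j := t)) * (k t * h x) \<partial>lborel)"
        using \<kappa> by simp
    qed
    also have "\<dots> = (m0 / \<kappa>) * (\<integral>x. w x * (k (x j) * h x) \<partial>leb \<Lambda>)"
      by (subst integral_lebn_coordinate[OF fin j ik]) (simp only: h_upd fun_upd_same integral_mult_right_zero)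
    finally have c1: "(\<integral>x. c x * (\<theta>0 (x j) * h x) \<partial>leb \<Lambda>) = (m0 / \<kappa>) * (\<integral>x. w x * (k (x j) * h x) \<partial>leb \<Lambda>)" .
    have prod: "(\<Prod>i\<in>\<Lambda>. bump (a i) (b i) m (x i)) = \<theta>0 (x j) * h x" for x
      unfolding h_def \<theta>0_def by (rule prod.remove[OF fin j])
    show "(\<integral>x. (w x - c x) * (\<Prod>i\<in>\<Lambda>. bump (a i) (b i) m (x i)) \<partial>leb \<Lambda>) = 0"
      unfolding prod left_diff_distrib
      by (subst Bochner_Integration.integral_diff[OF iw ic]) (simp only: w1 c1 diff_self)
  qed
  then have "line_primitive \<Lambda> j f g n c"
    unfolding line_primitive_def using AE_space
  proof eventually_elim
    case (elim x)
    show ?case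
    proof
      assume "\<forall>i\<in>\<Lambda>. \<bar>x i\<bar> < real n"
      then have "x \<in> PiE \<Lambda> (\<lambda>_. {-R<..<R})"
        using elim(2) unfolding space_lebn by (subst open_cube_iff) (auto simp: R_def)
      then have "w x - c x = 0" using elim(1) by blast
      then show "f x = c (x(j := 0)) + (LBINT r:{- real n..x j}. g (x(j := r)))"
        unfolding c_upd w_def p_def R_def[symmetric] by linarith
    qed
  qed
  then show "\<exists>c. line_primitive \<Lambda> j f g n c" by (intro exI[of _ c])
qed

lemma has_weak_partial_imp_acl:
  assumes "finite \<Lambda>" "j \<in> \<Lambda>" "has_weak_partial \<Lambda> j f g"
  shows "acl \<Lambda> j f g"
  unfolding acl_def
proof (intro conjI allI)
  show "locally_integrable \<Lambda> f" "locally_integrable \<Lambda> g" using assms(3) by (auto simp: has_weak_partial_def)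
  show "\<exists>n\<ge>N. \<exists>c. line_primitive \<Lambda> j f g n c" for N
    using weak_partial_line_primitive[OF assms, of "Suc N"] by (intro exI[of _ "Suc N"]) auto
qed

subsection \<open>Sections\<close>

lemma sigma_finite_pair_lebn:
  assumes "finite A" "finite B"
  shows "pair_sigma_finite (lebn B) (lebn A)"
  using assms by (simp add: pair_sigma_finite_def sigma_finite_lebn)

lemma merge_cspace: "merge B A (z, y) \<in> PiE (B \<union> A) (\<lambda>_. UNIV)"
  by (simp add: PiE_iff)

lemma AE_lebn_merge:
  assumes fin: "finite A" "finite B" and disj: "B \<inter> A = {}" and AE: "AE x in lebn (B \<union> A). P x"
  shows "AE z in lebn B. AE y in lebn A. P (merge B A (z, y))"
proof -
  interpret pair_sigma_finite "lebn B" "lebn A" by (rule sigma_finite_pair_lebn[OF fin])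
  have "AE p in lebn B \<Otimes>\<^sub>M lebn A. P (merge B A p)"
    by (rule AE_distrD[OF measurable_merge]) (use AE in \<open>simp only: lebn.distr_merge[OF disj fin(2,1)]\<close>)
  then show ?thesis by (rule AE_pair)
qed

lemma integrable_lebn_merge_pair:
  fixes F :: "('i \<Rightarrow> real) \<Rightarrow> real"
  assumes fin: "finite A" "finite B" and disj: "B \<inter> A = {}" and F: "integrable (lebn (B \<union> A)) F"
  shows "integrable (lebn B \<Otimes>\<^sub>M lebn A) (\<lambda>p. F (merge B A p))"
  by (rule integrable_distr[OF measurable_merge]) (use F in \<open>simp only: lebn.distr_merge[OF disj fin(2,1)]\<close>)

lemma AE_integrable_merge:
  fixes F :: "('i \<Rightarrow> real) \<Rightarrow> real"
  assumes fin: "finite A" "finite B" and disj: "B \<inter> A = {}" and F: "integrable (lebn (B \<union> A)) F"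
  shows "AE z in lebn B. integrable (lebn A) (\<lambda>y. F (merge B A (z, y)))"
proof -
  interpret pair_sigma_finite "lebn B" "lebn A" by (rule sigma_finite_pair_lebn[OF fin])
  show ?thesis by (rule AE_integrable_fst'[OF integrable_lebn_merge_pair[OF assms]])
qed

lemma locally_integrable_merge:
  assumes fin: "finite A" "finite B" and disj: "B \<inter> A = {}" and f: "locally_integrable (B \<union> A) f"
  shows "AE z in leb B. locally_integrable A (\<lambda>y. f (merge B A (z, y)))"
proof -
  have "AE z in leb B. \<forall>n::nat. integrable (leb A) (\<lambda>y. indicator (PiE (B \<union> A) (\<lambda>_. {-real n..real n})) (merge B A (z, y)) * f (merge B A (z, y)))"
    by (subst AE_all_countable) (rule allI, rule AE_integrable_merge[OF fin disj locally_integrableD[OF f]])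
  then show ?thesis
  proof eventually_elim
    case (elim z)
    obtain n0 where n0: "\<forall>i\<in>B. \<bar>z i\<bar> < real n0" using cspace_in_cube[OF fin(2)] by blast
    show ?case
    proof (rule locally_integrableI_nat[OF fin(1), of n0])
      fix n :: nat assume n: "n \<ge> n0"
      have zn: "\<bar>z i\<bar> \<le> real n" if "i \<in> B" for i
      proof -
        have "real n0 \<le> real n" using n by simp
        then show ?thesis using n0 that by (meson less_le_trans less_imp_le)
      qed
      have "integrable (leb A) (\<lambda>y. indicator (PiE (B \<union> A) (\<lambda>_. {-real n..real n})) (merge B A (z, y)) * f (merge B A (z, y)))
        \<longleftrightarrow> integrable (leb A) (\<lambda>y. indicator (PiE A (\<lambda>_. {-real n..real n})) y * f (merge B A (z, y)))"
      proof (rule Bochner_Integration.integrable_cong[OF refl])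
        fix y assume y: "y \<in> space (leb A)"
        have "merge B A (z, y) \<in> PiE (B \<union> A) (\<lambda>_. {-real n..real n}) \<longleftrightarrow> y \<in> PiE A (\<lambda>_. {-real n..real n})"
          unfolding cube_iff[OF merge_cspace] cube_iff[OF y[unfolded space_lebn]]
          using disj zn by (auto simp: merge_def)
        then show "indicator (PiE (B \<union> A) (\<lambda>_. {-real n..real n})) (merge B A (z, y)) * f (merge B A (z, y))
          = indicator (PiE A (\<lambda>_. {-real n..real n})) y * f (merge B A (z, y))"
          by (simp add: indicator_def)
      qed
      then show "integrable (leb A) (\<lambda>y. indicator (PiE A (\<lambda>_. {-real n..real n})) y * f (merge B A (z, y)))"
        using elim by blast
    qed
  qed
qed

lemma acl_merge:
  assumes fin: "finite A" "finite B" and disj: "B \<inter> A = {}" and j: "j \<in> A"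
    and acl: "acl (B \<union> A) j f g"
  shows "AE z in leb B. acl A j (\<lambda>y. f (merge B A (z, y))) (\<lambda>y. g (merge B A (z, y)))"
proof -
  have lf: "locally_integrable (B \<union> A) f" and lg: "locally_integrable (B \<union> A) g"
    using acl by (auto simp: acl_def)
  obtain S c where S: "\<And>N. \<exists>n\<in>S. N \<le> n"
    and c: "\<And>n. n \<in> S \<Longrightarrow> line_primitive (B \<union> A) j f g n (c n)"
    using aclE[OF acl] by metis
  have upd: "(merge B A (z, y))(j := r) = merge B A (z, y(j := r))" for z y r
    using j disj by (auto simp: merge_def fun_eq_iff)
  have "AE x in leb (B \<union> A). \<forall>n. n \<in> S \<longrightarrow> (\<forall>i\<in>B \<union> A. \<bar>x i\<bar> < real n) \<longrightarrow>
        f x = c n (x(j := 0)) + (LBINT r:{- real n..x j}. g (x(j := r)))"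
  proof (subst AE_all_countable, rule allI)
    fix n
    show "AE x in leb (B \<union> A). n \<in> S \<longrightarrow> (\<forall>i\<in>B \<union> A. \<bar>x i\<bar> < real n) \<longrightarrow>
        f x = c n (x(j := 0)) + (LBINT r:{- real n..x j}. g (x(j := r)))"
    proof (cases "n \<in> S")
      case True
      show ?thesis using c[OF True] unfolding line_primitive_def by (rule eventually_mono) blast
    qed simp
  qed
  from AE_lebn_merge[OF fin disj this] locally_integrable_merge[OF fin disj lf] locally_integrable_merge[OF fin disj lg]
  show ?thesis
  proof eventually_elim
    case (elim z)
    obtain n0 where n0: "\<forall>i\<in>B. \<bar>z i\<bar> < real n0" using cspace_in_cube[OF fin(2)] by blast
    show ?case unfolding acl_def
    proof (intro conjI allI elim(2,3))
      fix N
      obtain n where n: "n \<in> S" "max N n0 \<le> n" using S by blast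
      have zn: "\<bar>z i\<bar> < real n" if "i \<in> B" for i
      proof -
        have "real n0 \<le> real n" using n by simp
        then show ?thesis using n0 that by (meson less_le_trans)
      qed
      have "line_primitive A j (\<lambda>y. f (merge B A (z, y))) (\<lambda>y. g (merge B A (z, y))) n (\<lambda>y. c n (merge B A (z, y)))"
        unfolding line_primitive_def using elim(1)
      proof (rule eventually_mono, intro impI)
        fix y assume H: "\<forall>n. n \<in> S \<longrightarrow> (\<forall>i\<in>B \<union> A. \<bar>merge B A (z, y) i\<bar> < real n) \<longrightarrow>
          f (merge B A (z, y)) = c n ((merge B A (z, y))(j := 0)) + (LBINT r:{- real n..merge B A (z, y) j}. g ((merge B A (z, y))(j := r)))"
          and y: "\<forall>i\<in>A. \<bar>y i\<bar> < real n"
        have "\<forall>i\<in>B \<union> A. \<bar>merge B A (z, y) i\<bar> < real n" using y zn by (auto simp: merge_def)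
        then have "f (merge B A (z, y)) = c n ((merge B A (z, y))(j := 0)) + (LBINT r:{- real n..merge B A (z, y) j}. g ((merge B A (z, y))(j := r)))"
          using H n(1) by blast
        moreover have "merge B A (z, y) j = y j" using j disj by (auto simp: merge_def)
        ultimately show "f (merge B A (z, y)) = c n (merge B A (z, y(j := 0))) + (LBINT r:{- real n..y j}. g (merge B A (z, y(j := r))))"
          unfolding upd by (simp only:)
      qed
      then show "\<exists>n\<ge>N. \<exists>c. line_primitive A j (\<lambda>y. f (merge B A (z, y))) (\<lambda>y. g (merge B A (z, y))) n c"
        using n(2) by (intro exI[of _ n]) auto
    qed
  qed
qed

subsection \<open>Gibbs measures\<close>

text \<open>Completing the square: one half of the quadratic term absorbs the linear one, and the
  other half is a normal density up to a constant.\<close>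

lemma integrable_gauss_tilt:
  assumes "d > (0::real)"
  shows "integrable lborel (\<lambda>r::real. exp (\<beta> * \<bar>r\<bar> - d * r\<^sup>2))"
proof (rule Bochner_Integration.integrable_bound)
  define \<sigma> where "\<sigma> = sqrt (1 / d)"
  have \<sigma>: "\<sigma> > 0" "\<sigma>\<^sup>2 = 1 / d" using assms by (auto simp: \<sigma>_def)
  show "integrable lborel (\<lambda>r. exp (\<beta>\<^sup>2 / (2 * d)) * sqrt (2 * pi * \<sigma>\<^sup>2) * normal_density 0 \<sigma> r)"
    using integrable_normal_density[OF \<sigma>(1)] by (rule integrable_mult_right)
  show "AE r in lborel. norm (exp (\<beta> * \<bar>r\<bar> - d * r\<^sup>2)) \<le> norm (exp (\<beta>\<^sup>2 / (2 * d)) * sqrt (2 * pi * \<sigma>\<^sup>2) * normal_density 0 \<sigma> r)"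
  proof (rule AE_I2)
    fix r :: real
    have "0 \<le> (d * \<bar>r\<bar> - \<beta>)\<^sup>2 / (2 * d)" using assms by simp
    also have "\<dots> = d * r\<^sup>2 / 2 - \<beta> * \<bar>r\<bar> + \<beta>\<^sup>2 / (2 * d)"
      using assms by (simp add: power2_diff power_mult_distrib field_simps power2_eq_square)
    finally have "\<beta> * \<bar>r\<bar> - d * r\<^sup>2 \<le> \<beta>\<^sup>2 / (2 * d) + (- d * r\<^sup>2 / 2)" by (simp add: field_simps)
    then have "exp (\<beta> * \<bar>r\<bar> - d * r\<^sup>2) \<le> exp (\<beta>\<^sup>2 / (2 * d)) * exp (- d * r\<^sup>2 / 2)"
      by (simp flip: exp_add)
    also have "exp (- d * r\<^sup>2 / 2) = sqrt (2 * pi * \<sigma>\<^sup>2) * normal_density 0 \<sigma> r"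
      using \<sigma> assms by (simp add: normal_density_def)
    finally show "norm (exp (\<beta> * \<bar>r\<bar> - d * r\<^sup>2)) \<le> norm (exp (\<beta>\<^sup>2 / (2 * d)) * sqrt (2 * pi * \<sigma>\<^sup>2) * normal_density 0 \<sigma> r)"
      by (simp add: mult.assoc)
  qed
qed simp

lemma density_pos_integral:
  fixes g :: "('i \<Rightarrow> real) \<Rightarrow> real"
  assumes fin: "finite \<Lambda>" and int: "integrable (lebn \<Lambda>) g" and pos: "\<And>x. g x > 0"
  shows "(\<integral>x. g x \<partial>lebn \<Lambda>) > 0"
proof -
  have "(\<integral>x. g x \<partial>lebn \<Lambda>) \<noteq> 0"
  proof
    assume "(\<integral>x. g x \<partial>lebn \<Lambda>) = 0"
    then have "AE x in lebn \<Lambda>. g x = 0"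
      using int pos by (subst (asm) integral_nonneg_eq_0_iff_AE) (auto intro: less_imp_le)
    then have "AE x in lebn \<Lambda>. \<not> x \<in> space (lebn \<Lambda>)"
      by (rule eventually_mono) (use pos in \<open>auto simp: less_le\<close>)
    then have "emeasure (lebn \<Lambda>) {x \<in> space (lebn \<Lambda>). x \<in> space (lebn \<Lambda>)} = 0" by (rule emeasure_eq_0_AE)
    moreover have "{x \<in> space (lebn \<Lambda>). x \<in> space (lebn \<Lambda>)} = PiE \<Lambda> (\<lambda>_. UNIV :: real set)"
      by (simp add: space_lebn)
    moreover have "emeasure (lebn \<Lambda>) (PiE \<Lambda> (\<lambda>_. UNIV)) = (\<Prod>i\<in>\<Lambda>. emeasure lborel (UNIV :: real set))"
      using fin by (subst lebn.emeasure_PiM) auto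
    ultimately show False by (simp add: prod_zero_iff[OF fin])
  qed
  moreover have "(\<integral>x. g x \<partial>lebn \<Lambda>) \<ge> 0" by (rule integral_nonneg_AE) (use pos in \<open>auto intro: less_imp_le\<close>)
  ultimately show ?thesis by simp
qed

section \<open>Densities and moments of Gibbs measures with a general linear field\<close>

locale spin_system =
  fixes \<psi> :: "'d::finite site \<Rightarrow> real \<Rightarrow> real" and M :: "'d site \<Rightarrow> 'd site \<Rightarrow> real"
    and \<delta> C :: real
  assumes sym: "M i j = M j i" and dd: "diag_dominant \<delta> M" and \<delta>: "\<delta> > 0"
    and pc: "perturbed_convex C \<psi>"
begin

text \<open>The external field and the boundary condition enter the Hamiltonian only through the
  coefficient \<open>b\<close> of its linear part.\<close>

definition U :: "'d site set \<Rightarrow> ('d site \<Rightarrow> real) \<Rightarrow> 'd config \<Rightarrow> real" where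
  "U \<Lambda> b x = (\<Sum>i\<in>\<Lambda>. \<psi> i (x i) + b i * x i) + (\<Sum>i\<in>\<Lambda>. \<Sum>j\<in>\<Lambda>. M i j * x i * x j)"

definition Z :: "'d site set \<Rightarrow> ('d site \<Rightarrow> real) \<Rightarrow> real" where
  "Z \<Lambda> b = (\<integral>x. exp (- U \<Lambda> b x) \<partial>leb \<Lambda>)"

definition dens :: "'d site set \<Rightarrow> ('d site \<Rightarrow> real) \<Rightarrow> 'd config \<Rightarrow> real" where
  "dens \<Lambda> b x = exp (- U \<Lambda> b x) / Z \<Lambda> b"

definition gm :: "'d site set \<Rightarrow> ('d site \<Rightarrow> real) \<Rightarrow> 'd config measure" where
  "gm \<Lambda> b = density (leb \<Lambda>) (\<lambda>x. ennreal (dens \<Lambda> b x))"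

lemma hamiltonian_eq_U:
  "hamiltonian \<psi> s M \<Lambda> \<omega> x = U \<Lambda> (\<lambda>i. s i + 2 * (\<Sum>\<^sub>\<infinity>j\<in>- \<Lambda>. M i j * \<omega> j)) x"
proof -
  have "(\<Sum>\<^sub>\<infinity>j\<in>- \<Lambda>. M i j * x i * \<omega> j) = x i * (\<Sum>\<^sub>\<infinity>j\<in>- \<Lambda>. M i j * \<omega> j)" for i
    by (subst infsum_cmult_right'[symmetric]) (simp add: mult_ac)
  then show ?thesis
    by (simp add: hamiltonian_def U_def sum.distrib sum_distrib_left algebra_simps)
qed

lemma gibbs_eq_gm:
  "gibbs \<psi> s M \<Lambda> \<omega> = gm \<Lambda> (\<lambda>i. s i + 2 * (\<Sum>\<^sub>\<infinity>j\<in>- \<Lambda>. M i j * \<omega> j))"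
  by (simp add: gibbs_def gm_def dens_def Z_def hamiltonian_eq_U)

lemma \<psi>_isCont: "isCont (\<psi> i) r"
proof -
  obtain \<psi>b \<psi>c where *: "\<And>i r. \<psi> i r = \<psi>b i r + \<psi>c i r"
    "\<And>i r. \<psi>c i differentiable (at r)" "\<And>i r. \<psi>b i differentiable (at r)"
    using pc unfolding perturbed_convex_def by blast
  have "\<psi> i = (\<lambda>r. \<psi>b i r + \<psi>c i r)" using *(1) by blast
  moreover have "isCont (\<lambda>r. \<psi>b i r + \<psi>c i r) r"
    by (intro continuous_intros differentiable_imp_continuous_within *)
  ultimately show ?thesis by simp
qed

lemma \<psi>_measurable [measurable]: "\<psi> i \<in> borel_measurable borel"
  by (rule borel_measurable_continuous_onI) (simp add: \<psi>_isCont continuous_at_imp_continuous_on)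

text \<open>The convex part lies above its tangent at 0, and the other part is bounded below by
  \<open>- C\<close>.\<close>

lemma \<psi>_lower_bound: "\<exists>a c. \<forall>r. \<psi> i r \<ge> - a - c * \<bar>r\<bar>"
proof -
  obtain \<psi>b \<psi>c where *: "\<And>i r. \<psi> i r = \<psi>b i r + \<psi>c i r"
    "\<And>i r. \<psi>c i differentiable (at r)" "\<And>i r. deriv (\<psi>c i) differentiable (at r)"
    "\<And>i r. deriv (deriv (\<psi>c i)) r \<ge> 0" "\<And>i r. \<bar>\<psi>b i r\<bar> + \<bar>deriv (\<psi>b i) r\<bar> \<le> C"
    using pc unfolding perturbed_convex_def by blast
  have "\<psi> i r \<ge> - (C - \<psi>c i 0) - \<bar>deriv (\<psi>c i) 0\<bar> * \<bar>r\<bar>" for r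
  proof -
    have "deriv (\<psi>c i) 0 * (r - 0) \<le> \<psi>c i r - \<psi>c i 0"
    proof (rule f''_imp_f'[where C = UNIV and f'' = "deriv (deriv (\<psi>c i))"])
      show "(\<psi>c i has_real_derivative deriv (\<psi>c i) x) (at x)" for x
        using *(2) by (simp add: DERIV_deriv_iff_real_differentiable)
      show "(deriv (\<psi>c i) has_real_derivative deriv (deriv (\<psi>c i)) x) (at x)" for x
        using *(3) by (simp add: DERIV_deriv_iff_real_differentiable)
    qed (use *(4) in auto)
    moreover have "- (\<bar>deriv (\<psi>c i) 0\<bar> * \<bar>r\<bar>) \<le> deriv (\<psi>c i) 0 * r"
      using abs_ge_minus_self[of "deriv (\<psi>c i) 0 * r"] by (simp add: abs_mult)
    moreover have "- C \<le> \<psi>b i r" using *(5)[of i r] by linarith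
    ultimately show ?thesis using *(1)[of i r] by simp
  qed
  then show ?thesis by blast
qed

text \<open>Off-diagonal terms are estimated by half the sum of the squares of the two spins. By
  symmetry of \<open>M\<close> the two halves add up to the row sums, which the diagonal dominates
  with the margin \<open>\<delta>\<close>.\<close>

lemma quadratic_form_ge:
  assumes fin: "finite \<Lambda>"
  shows "\<delta> * (\<Sum>i\<in>\<Lambda>. (x i)\<^sup>2) \<le> (\<Sum>i\<in>\<Lambda>. \<Sum>j\<in>\<Lambda>. M i j * x i * x j)"
proof -
  have row: "\<delta> + (\<Sum>j\<in>\<Lambda> - {i}. \<bar>M i j\<bar>) \<le> M i i" for i
  proof -
    have s: "(\<lambda>j. \<bar>M i j\<bar>) summable_on (- {i})" "\<delta> + (\<Sum>\<^sub>\<infinity>j\<in>- {i}. \<bar>M i j\<bar>) \<le> M i i"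
      using dd by (auto simp: diag_dominant_def)
    have "(\<Sum>j\<in>\<Lambda> - {i}. \<bar>M i j\<bar>) \<le> (\<Sum>\<^sub>\<infinity>j\<in>- {i}. \<bar>M i j\<bar>)"
      using fin by (intro finite_sum_le_infsum s) auto
    then show ?thesis using s(2) by linarith
  qed
  have split: "(\<Sum>j\<in>\<Lambda>. h j) = h i + (\<Sum>j\<in>\<Lambda> - {i}. h j)" if "i \<in> \<Lambda>" for h :: "'d site \<Rightarrow> real" and i
    by (rule sum.remove[OF fin that])
  have swap: "(\<Sum>i\<in>\<Lambda>. \<Sum>j\<in>\<Lambda> - {i}. \<bar>M i j\<bar> * (x j)\<^sup>2) = (\<Sum>i\<in>\<Lambda>. \<Sum>j\<in>\<Lambda> - {i}. \<bar>M i j\<bar> * (x i)\<^sup>2)"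
  proof -
    have "(\<Sum>i\<in>\<Lambda>. \<Sum>j\<in>\<Lambda> - {i}. h i j) = (\<Sum>i\<in>\<Lambda>. \<Sum>j\<in>\<Lambda>. if i = j then 0 else h i j)" for h :: "'d site \<Rightarrow> 'd site \<Rightarrow> real"
      by (intro sum.cong refl sum.mono_neutral_cong_left) (use fin in auto)
    then show ?thesis
      by (simp only:, subst sum.swap) (auto intro!: sum.cong simp: sym)
  qed
  have "\<delta> * (\<Sum>i\<in>\<Lambda>. (x i)\<^sup>2) = (\<Sum>i\<in>\<Lambda>. \<delta> * (x i)\<^sup>2)" by (simp add: sum_distrib_left)
  also have "\<dots> \<le> (\<Sum>i\<in>\<Lambda>. (M i i - (\<Sum>j\<in>\<Lambda> - {i}. \<bar>M i j\<bar>)) * (x i)\<^sup>2)"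
    using row by (intro sum_mono mult_right_mono) (auto simp: algebra_simps)
  also have "\<dots> = (\<Sum>i\<in>\<Lambda>. M i i * (x i)\<^sup>2) - (\<Sum>i\<in>\<Lambda>. \<Sum>j\<in>\<Lambda> - {i}. \<bar>M i j\<bar> * (x i)\<^sup>2)"
    by (simp add: left_diff_distrib sum_subtractf sum_distrib_right)
  also have "\<dots> = (\<Sum>i\<in>\<Lambda>. M i i * (x i)\<^sup>2) - (\<Sum>i\<in>\<Lambda>. \<Sum>j\<in>\<Lambda> - {i}. \<bar>M i j\<bar> * ((x i)\<^sup>2 + (x j)\<^sup>2) / 2)"
    using swap by (simp add: distrib_left add_divide_distrib sum.distrib flip: sum_divide_distrib)
  also have "\<dots> \<le> (\<Sum>i\<in>\<Lambda>. M i i * (x i)\<^sup>2) + (\<Sum>i\<in>\<Lambda>. \<Sum>j\<in>\<Lambda> - {i}. M i j * x i * x j)"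
  proof -
    have "- (\<bar>M i j\<bar> * ((x i)\<^sup>2 + (x j)\<^sup>2) / 2) \<le> M i j * x i * x j" for i j
    proof -
      have "\<bar>x i * x j\<bar> \<le> ((x i)\<^sup>2 + (x j)\<^sup>2) / 2"
        using sum_squares_bound[of "\<bar>x i\<bar>" "\<bar>x j\<bar>"] by (simp add: abs_mult)
      then have "\<bar>M i j\<bar> * \<bar>x i * x j\<bar> \<le> \<bar>M i j\<bar> * (((x i)\<^sup>2 + (x j)\<^sup>2) / 2)" by (intro mult_left_mono) auto
      then show ?thesis using abs_ge_minus_self[of "M i j * x i * x j"] by (simp add: abs_mult mult.assoc)
    qed
    then have "- (\<Sum>i\<in>\<Lambda>. \<Sum>j\<in>\<Lambda> - {i}. \<bar>M i j\<bar> * ((x i)\<^sup>2 + (x j)\<^sup>2) / 2) \<le> (\<Sum>i\<in>\<Lambda>. \<Sum>j\<in>\<Lambda> - {i}. M i j * x i * x j)"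
      unfolding sum_negf[symmetric] by (intro sum_mono)
    then show ?thesis by linarith
  qed
  also have "\<dots> = (\<Sum>i\<in>\<Lambda>. \<Sum>j\<in>\<Lambda>. M i j * x i * x j)"
    unfolding sum.distrib[symmetric] by (intro sum.cong refl) (simp add: split power2_eq_square mult.assoc)
  finally show ?thesis .
qed

lemma U_measurable [measurable]: "finite \<Lambda> \<Longrightarrow> U \<Lambda> b \<in> borel_measurable (leb \<Lambda>)"
proof -
  assume fin: "finite \<Lambda>"
  have c: "(\<lambda>x. x i) \<in> borel_measurable (leb \<Lambda>)" if "i \<in> \<Lambda>" for i using that by measurable
  have "(\<lambda>x. \<psi> i (x i)) \<in> borel_measurable (leb \<Lambda>)" if "i \<in> \<Lambda>" for i
    by (rule measurable_compose[OF c[OF that] \<psi>_measurable])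
  then show ?thesis unfolding U_def[abs_def]
    by (intro borel_measurable_add borel_measurable_sum borel_measurable_times c borel_measurable_const) auto
qed

text \<open>The quadratic form provides Gaussian decay with rate \<open>\<delta>\<close> in every
  spin, while \<open>\<psi>\<close> and the field cost at most a linear term; a product of tilted
  Gaussians dominates.\<close>

lemma integrable_exp_U:
  assumes fin: "finite \<Lambda>"
  shows "integrable (leb \<Lambda>) (\<lambda>x. exp (- U \<Lambda> b x))"
proof -
  obtain a c where ac: "\<And>i r. \<psi> i r \<ge> - a i - c i * \<bar>r\<bar>" using \<psi>_lower_bound by metis
  define h where "h i r = exp (a i) * exp ((c i + \<bar>b i\<bar>) * \<bar>r\<bar> - \<delta> * r\<^sup>2)" for i and r :: real
  show ?thesis
  proof (rule Bochner_Integration.integrable_bound)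
    show "integrable (leb \<Lambda>) (\<lambda>x. \<Prod>i\<in>\<Lambda>. h i (x i))"
      unfolding h_def by (intro lebn.product_integrable_prod fin integrable_mult_right integrable_gauss_tilt \<delta>)
    show "AE x in leb \<Lambda>. norm (exp (- U \<Lambda> b x)) \<le> norm (\<Prod>i\<in>\<Lambda>. h i (x i))"
    proof (rule AE_I2)
      fix x
      have "- U \<Lambda> b x \<le> - (\<Sum>i\<in>\<Lambda>. \<psi> i (x i) + b i * x i) - (\<Sum>i\<in>\<Lambda>. \<delta> * (x i)\<^sup>2)"
        using quadratic_form_ge[OF fin, of x] by (simp add: U_def sum_distrib_left)
      also have "\<dots> = (\<Sum>i\<in>\<Lambda>. - (\<psi> i (x i) + b i * x i) - \<delta> * (x i)\<^sup>2)"
        by (simp add: sum_subtractf sum_negf sum.distrib)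
      also have "\<dots> \<le> (\<Sum>i\<in>\<Lambda>. a i + ((c i + \<bar>b i\<bar>) * \<bar>x i\<bar> - \<delta> * (x i)\<^sup>2))"
      proof (rule sum_mono)
        fix i
        have "- (\<bar>b i\<bar> * \<bar>x i\<bar>) \<le> b i * x i" using abs_ge_minus_self[of "b i * x i"] by (simp add: abs_mult)
        then show "- (\<psi> i (x i) + b i * x i) - \<delta> * (x i)\<^sup>2 \<le> a i + ((c i + \<bar>b i\<bar>) * \<bar>x i\<bar> - \<delta> * (x i)\<^sup>2)"
          using ac[of i "x i"] by (simp add: distrib_right)
      qed
      finally have "exp (- U \<Lambda> b x) \<le> exp (\<Sum>i\<in>\<Lambda>. a i + ((c i + \<bar>b i\<bar>) * \<bar>x i\<bar> - \<delta> * (x i)\<^sup>2))" by simp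
      also have "\<dots> = (\<Prod>i\<in>\<Lambda>. h i (x i))" by (simp add: exp_sum fin h_def exp_add[symmetric])
      finally show "norm (exp (- U \<Lambda> b x)) \<le> norm (\<Prod>i\<in>\<Lambda>. h i (x i))" by simp
    qed
  qed (use fin in measurable)
qed

lemma Z_pos: "finite \<Lambda> \<Longrightarrow> Z \<Lambda> b > 0"
  unfolding Z_def by (intro density_pos_integral integrable_exp_U) auto

lemma dens_pos: "finite \<Lambda> \<Longrightarrow> dens \<Lambda> b x > 0"
  unfolding dens_def using Z_pos by simp

lemma dens_measurable [measurable]: "finite \<Lambda> \<Longrightarrow> dens \<Lambda> b \<in> borel_measurable (leb \<Lambda>)"
  unfolding dens_def[abs_def] by measurable

lemma integrable_dens: "finite \<Lambda> \<Longrightarrow> integrable (leb \<Lambda>) (dens \<Lambda> b)"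
  unfolding dens_def[abs_def] by (intro integrable_divide_zero) (auto intro: integrable_exp_U)

lemma integral_dens: "finite \<Lambda> \<Longrightarrow> (\<integral>x. dens \<Lambda> b x \<partial>leb \<Lambda>) = 1"
  unfolding dens_def using Z_pos[of \<Lambda> b] by (simp add: Z_def)

lemma sets_gm [simp, measurable_cong]: "sets (gm \<Lambda> b) = sets (leb \<Lambda>)"
  by (simp add: gm_def)

lemma space_gm [simp]: "space (gm \<Lambda> b) = space (leb \<Lambda>)"
  by (simp add: gm_def)

lemma prob_space_gm: "finite \<Lambda> \<Longrightarrow> prob_space (gm \<Lambda> b)"
proof (rule prob_spaceI)
  assume fin: "finite \<Lambda>"
  have "emeasure (gm \<Lambda> b) (space (gm \<Lambda> b)) = (\<integral>\<^sup>+x. ennreal (dens \<Lambda> b x) \<partial>leb \<Lambda>)"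
    using fin by (simp add: gm_def emeasure_density cong: nn_integral_cong)
  also have "\<dots> = ennreal (\<integral>x. dens \<Lambda> b x \<partial>leb \<Lambda>)"
    by (rule nn_integral_eq_integral[OF integrable_dens[OF fin]]) (simp add: dens_pos[OF fin] less_imp_le)
  finally show "emeasure (gm \<Lambda> b) (space (gm \<Lambda> b)) = 1" by (simp add: integral_dens[OF fin])
qed

lemma integrable_gm:
  fixes F :: "'d config \<Rightarrow> real"
  assumes "finite \<Lambda>" "F \<in> borel_measurable (leb \<Lambda>)"
  shows "integrable (gm \<Lambda> b) F \<longleftrightarrow> integrable (leb \<Lambda>) (\<lambda>x. dens \<Lambda> b x * F x)"
  unfolding gm_def using assms dens_pos[OF assms(1)]
  by (subst integrable_density) (auto intro: less_imp_le)

lemma integral_gm: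
  fixes F :: "'d config \<Rightarrow> real"
  assumes "finite \<Lambda>" "F \<in> borel_measurable (leb \<Lambda>)"
  shows "(\<integral>x. F x \<partial>gm \<Lambda> b) = (\<integral>x. dens \<Lambda> b x * F x \<partial>leb \<Lambda>)"
  unfolding gm_def using assms dens_pos[OF assms(1)]
  by (subst integral_density) (auto intro: less_imp_le)

lemma AE_gm: "finite \<Lambda> \<Longrightarrow> (AE x in gm \<Lambda> b. P x) \<longleftrightarrow> (AE x in leb \<Lambda>. P x)"
  unfolding gm_def by (subst AE_density) (auto simp: dens_pos)

lemma U_shift: "U \<Lambda> (\<lambda>i. b i + t * m i) x = U \<Lambda> b x + t * (\<Sum>i\<in>\<Lambda>. m i * x i)"
  by (simp add: U_def sum.distrib sum_distrib_left algebra_simps)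

text \<open>A tilt by a linear function is a change of the field, and integrability is known for
  every field. Thus all exponential moments of linear functions are finite.\<close>

lemma integrable_exp_U_tilt:
  assumes fin: "finite \<Lambda>"
  shows "integrable (leb \<Lambda>) (\<lambda>x. exp (- U \<Lambda> b x) * exp (t * (\<Sum>i\<in>\<Lambda>. m i * x i)))"
proof -
  have "exp (- U \<Lambda> b x) * exp (t * (\<Sum>i\<in>\<Lambda>. m i * x i)) = exp (- U \<Lambda> (\<lambda>i. b i + (- t) * m i) x)" for x
    by (simp only: U_shift) (simp flip: exp_add)
  then show ?thesis using integrable_exp_U[OF fin, of "\<lambda>i. b i + (- t) * m i"] by (simp only:)
qed

lemma linear_measurable: "(\<lambda>x. \<Sum>i\<in>\<Lambda>. m i * x i :: real) \<in> borel_measurable (leb \<Lambda>)"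
  by (intro borel_measurable_sum borel_measurable_times borel_measurable_const) measurable

lemma exp_U_measurable: "finite \<Lambda> \<Longrightarrow> (\<lambda>x. exp (- U \<Lambda> b x)) \<in> borel_measurable (leb \<Lambda>)"
  by measurable

lemma integrable_exp_U_tilt1:
  assumes fin: "finite \<Lambda>"
  shows "integrable (leb \<Lambda>) (\<lambda>x. exp (- U \<Lambda> b x) * (\<Sum>i\<in>\<Lambda>. m i * x i) * exp (t * (\<Sum>i\<in>\<Lambda>. m i * x i)))"
  by (rule integrable_mult_Laplace[OF exp_U_measurable[OF fin] linear_measurable integrable_exp_U_tilt[OF fin]])

lemma integrable_exp_U_tilt2:
  assumes fin: "finite \<Lambda>"
  shows "integrable (leb \<Lambda>) (\<lambda>x. exp (- U \<Lambda> b x) * (\<Sum>i\<in>\<Lambda>. m i * x i) * (\<Sum>i\<in>\<Lambda>. m i * x i) * exp (t * (\<Sum>i\<in>\<Lambda>. m i * x i)))"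
  by (rule integrable_mult_Laplace[OF borel_measurable_times[OF exp_U_measurable[OF fin] linear_measurable]
        linear_measurable integrable_exp_U_tilt1[OF fin]])

lemma linear_L2:
  assumes fin: "finite \<Lambda>"
  shows "(\<lambda>x. \<Sum>i\<in>\<Lambda>. m i * x i) \<in> L2 (gm \<Lambda> b)"
proof -
  \<comment> \<open>The second moment is the twice multiplied tilted density at tilt 0.\<close>
  have eq: "dens \<Lambda> b x * (\<Sum>i\<in>\<Lambda>. m i * x i)\<^sup>2 =
    (1 / Z \<Lambda> b) * (exp (- U \<Lambda> b x) * (\<Sum>i\<in>\<Lambda>. m i * x i) * (\<Sum>i\<in>\<Lambda>. m i * x i) * exp (0 * (\<Sum>i\<in>\<Lambda>. m i * x i)))" for x
    by (simp add: dens_def power2_eq_square)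
  have "integrable (leb \<Lambda>) (\<lambda>x. dens \<Lambda> b x * (\<Sum>i\<in>\<Lambda>. m i * x i)\<^sup>2)"
    unfolding eq by (rule integrable_mult_right[OF integrable_exp_U_tilt2[OF fin]])
  moreover have "(\<lambda>x. (\<Sum>i\<in>\<Lambda>. m i * x i)\<^sup>2) \<in> borel_measurable (leb \<Lambda>)"
    using linear_measurable by (intro borel_measurable_power)
  ultimately show ?thesis
    using linear_measurable by (auto simp: L2_def integrable_gm[OF fin])
qed

lemma U_bounded_on_cube:
  assumes fin: "finite \<Lambda>"
  shows "\<exists>K. \<forall>x\<in>PiE \<Lambda> (\<lambda>_. {-R..R}). U \<Lambda> b x \<le> K"
proof -
  have "\<exists>k. \<forall>r\<in>{-R..R}. \<psi> i r \<le> k" for i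
  proof -
    have "bounded (\<psi> i ` {-R..R})"
      by (intro compact_imp_bounded compact_continuous_image continuous_at_imp_continuous_on ballI \<psi>_isCont compact_Icc)
    then obtain k where "\<forall>r\<in>{-R..R}. \<bar>\<psi> i r\<bar> \<le> k" unfolding bounded_iff by (metis imageI real_norm_def)
    then show ?thesis by (intro exI[of _ k]) (auto intro: order_trans[OF abs_ge_self])
  qed
  then obtain k where k: "\<And>i r. r \<in> {-R..R} \<Longrightarrow> \<psi> i r \<le> k i" by metis
  have "U \<Lambda> b x \<le> (\<Sum>i\<in>\<Lambda>. k i + \<bar>b i\<bar> * R) + (\<Sum>i\<in>\<Lambda>. \<Sum>j\<in>\<Lambda>. \<bar>M i j\<bar> * R * R)" if x: "x \<in> PiE \<Lambda> (\<lambda>_. {-R..R})" for x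
    unfolding U_def
  proof (intro add_mono sum_mono)
    fix i assume i: "i \<in> \<Lambda>"
    have xi: "x i \<in> {-R..R}" using x i by auto
    then have xa: "\<bar>x i\<bar> \<le> R" by auto
    show "\<psi> i (x i) \<le> k i" using k[OF xi] .
    have "b i * x i \<le> \<bar>b i\<bar> * \<bar>x i\<bar>" using abs_ge_self[of "b i * x i"] by (simp add: abs_mult)
    also have "\<dots> \<le> \<bar>b i\<bar> * R" using xa by (intro mult_left_mono) auto
    finally show "b i * x i \<le> \<bar>b i\<bar> * R" .
    fix j assume j: "j \<in> \<Lambda>"
    then have xj: "\<bar>x j\<bar> \<le> R" using x by force
    have "M i j * x i * x j \<le> \<bar>M i j\<bar> * \<bar>x i\<bar> * \<bar>x j\<bar>" using abs_ge_self[of "M i j * x i * x j"] by (simp add: abs_mult)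
    also have "\<dots> \<le> \<bar>M i j\<bar> * R * R" using xa xj by (intro mult_mono) auto
    finally show "M i j * x i * x j \<le> \<bar>M i j\<bar> * R * R" .
  qed
  then show ?thesis by blast
qed

lemma dens_lower_bound:
  assumes fin: "finite \<Lambda>"
  obtains \<epsilon> where "\<epsilon> > 0" "\<And>x. x \<in> PiE \<Lambda> (\<lambda>_. {-R..R}) \<Longrightarrow> \<epsilon> \<le> dens \<Lambda> b x"
proof -
  obtain K where K: "\<And>x. x \<in> PiE \<Lambda> (\<lambda>_. {-R..R}) \<Longrightarrow> U \<Lambda> b x \<le> K"
    using U_bounded_on_cube[OF fin] by blast
  show ?thesis
  proof (rule that[of "exp (- K) / Z \<Lambda> b"])
    show "exp (- K) / Z \<Lambda> b > 0" using Z_pos[OF fin] by simp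
    show "exp (- K) / Z \<Lambda> b \<le> dens \<Lambda> b x" if "x \<in> PiE \<Lambda> (\<lambda>_. {-R..R})" for x
      unfolding dens_def using K[OF that] Z_pos[OF fin, of b] by (intro divide_right_mono) auto
  qed
qed

text \<open>Weak derivatives live under Lebesgue measure, \<open>L2\<close> under the Gibbs measure.
  The density is bounded below on each cube, which gives the passage from the second to the
  first.\<close>

lemma locally_integrable_gm:
  assumes fin: "finite \<Lambda>" and h: "integrable (gm \<Lambda> b) h"
  shows "locally_integrable \<Lambda> h"
  unfolding locally_integrable_def set_integrable_def
proof
  fix R :: real
  have hm [measurable]: "h \<in> borel_measurable (leb \<Lambda>)" using borel_measurable_integrable[OF h] by simp
  obtain \<epsilon> where \<epsilon>: "\<epsilon> > 0" "\<And>x. x \<in> PiE \<Lambda> (\<lambda>_. {-R..R}) \<Longrightarrow> \<epsilon> \<le> dens \<Lambda> b x"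
    using dens_lower_bound[OF fin] by metis
  show "integrable (leb \<Lambda>) (\<lambda>x. indicator (PiE \<Lambda> (\<lambda>_. {-R..R})) x *\<^sub>R h x)"
  proof (rule Bochner_Integration.integrable_bound)
    show "integrable (leb \<Lambda>) (\<lambda>x. (dens \<Lambda> b x * h x) / \<epsilon>)"
      using h integrable_gm[OF fin hm] by (intro integrable_divide_zero) auto
    show "(\<lambda>x. indicator (PiE \<Lambda> (\<lambda>_. {-R..R})) x *\<^sub>R h x) \<in> borel_measurable (leb \<Lambda>)"
      using cube_measurable[OF fin, of R] by measurable
    show "AE x in leb \<Lambda>. norm (indicator (PiE \<Lambda> (\<lambda>_. {-R..R})) x *\<^sub>R h x) \<le> norm ((dens \<Lambda> b x * h x) / \<epsilon>)"
    proof (rule AE_I2)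
      fix x
      show "norm (indicator (PiE \<Lambda> (\<lambda>_. {-R..R})) x *\<^sub>R h x) \<le> norm ((dens \<Lambda> b x * h x) / \<epsilon>)"
      proof (cases "x \<in> PiE \<Lambda> (\<lambda>_. {-R..R})")
        case True
        have "\<epsilon> * \<bar>h x\<bar> \<le> dens \<Lambda> b x * \<bar>h x\<bar>" using \<epsilon>(2)[OF True] by (intro mult_right_mono) auto
        then show ?thesis using True \<epsilon>(1) dens_pos[OF fin, of b x] by (simp add: abs_mult field_simps)
      qed simp
    qed
  qed
qed

text \<open>The conditional density is differentiated along the line \<open>b + t m\<close>, the direction in which
  the effective field moves when one boundary spin is changed.\<close>

lemma
  fixes b m :: "'d site \<Rightarrow> real"
  assumes fin: "finite \<Lambda>"
  defines "bt \<equiv> \<lambda>t i. b i + t * m i"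
  defines "l \<equiv> \<lambda>x. \<Sum>i\<in>\<Lambda>. m i * x i"
  defines "e \<equiv> \<lambda>t. \<integral>x. l x \<partial>gm \<Lambda> (bt t)"
  shows DERIV_dens: "((\<lambda>t. dens \<Lambda> (bt t) x) has_real_derivative - dens \<Lambda> (bt t) x * (l x - e t)) (at t)"
    and isCont_gm_linear: "isCont e t"
proof -
  have lm: "l \<in> borel_measurable (leb \<Lambda>)" unfolding l_def by (rule linear_measurable)
  have Um: "(\<lambda>x. exp (- U \<Lambda> b x)) \<in> borel_measurable (leb \<Lambda>)" by (rule exp_U_measurable[OF fin])
  \<comment> \<open>The density carries \<open>exp (- U)\<close>, so the Laplace transforms are
    taken of \<open>- l\<close>.\<close>
  have nl: "(\<Sum>i\<in>\<Lambda>. (- m i) * x i) = - l x" for x unfolding l_def by (simp add: sum_negf)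
  have lm': "(\<lambda>x. - l x) \<in> borel_measurable (leb \<Lambda>)" using lm by (rule borel_measurable_uminus)
  have i0: "integrable (leb \<Lambda>) (\<lambda>x. exp (- U \<Lambda> b x) * exp (t * - l x))" for t
    using integrable_exp_U_tilt[OF fin, of b t "\<lambda>i. - m i"] by (simp only: nl)
  have i1: "integrable (leb \<Lambda>) (\<lambda>x. exp (- U \<Lambda> b x) * - l x * exp (t * - l x))" for t
    using integrable_exp_U_tilt1[OF fin, of b "\<lambda>i. - m i" t] by (simp only: nl)
  have U_bt: "exp (- U \<Lambda> (bt t) x) = exp (- U \<Lambda> b x) * exp (t * - l x)" for t x
    unfolding bt_def U_shift l_def by (simp flip: exp_add)
  define N where "N t = (\<integral>x. exp (- U \<Lambda> b x) * - l x * exp (t * - l x) \<partial>leb \<Lambda>)" for t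
  have Z_eq: "Z \<Lambda> (bt t) = (\<integral>x. exp (- U \<Lambda> b x) * exp (t * - l x) \<partial>leb \<Lambda>)" for t
    unfolding Z_def U_bt ..
  have dZ: "((\<lambda>t. Z \<Lambda> (bt t)) has_real_derivative N t) (at t)" for t
    unfolding Z_eq N_def by (rule DERIV_Laplace[OF Um lm' i0])
  have dN: "(N has_real_derivative (\<integral>x. exp (- U \<Lambda> b x) * - l x * - l x * exp (t * - l x) \<partial>leb \<Lambda>)) (at t)" for t
    unfolding N_def[abs_def]
    by (rule DERIV_Laplace[OF borel_measurable_times[OF Um lm'] lm' i1])
  have Zp: "Z \<Lambda> (bt t) > 0" for t by (rule Z_pos[OF fin])
  \<comment> \<open>The mean of \<open>l\<close> is minus the logarithmic derivative of the
    partition function. The numerator is itself a differentiable Laplace transform, which yields the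
    continuity of \<open>e\<close>.\<close>
  have e: "e t = - N t / Z \<Lambda> (bt t)" for t
  proof -
    have "e t = (\<integral>x. dens \<Lambda> (bt t) x * l x \<partial>leb \<Lambda>)" unfolding e_def by (rule integral_gm[OF fin lm])
    also have "\<dots> = (\<integral>x. - (exp (- U \<Lambda> b x) * - l x * exp (t * - l x) / Z \<Lambda> (bt t)) \<partial>leb \<Lambda>)"
      unfolding dens_def U_bt by (intro Bochner_Integration.integral_cong refl) simp
    also have "\<dots> = - N t / Z \<Lambda> (bt t)" unfolding N_def by (simp only: integral_minus integral_divide_zero minus_divide_left)
    finally show ?thesis .
  qed
  have "((\<lambda>t. exp (- U \<Lambda> b x) * exp (t * - l x) / Z \<Lambda> (bt t)) has_real_derivative
    (exp (- U \<Lambda> b x) * (exp (t * - l x) * - l x) * Z \<Lambda> (bt t) - exp (- U \<Lambda> b x) * exp (t * - l x) * N t) / (Z \<Lambda> (bt t) * Z \<Lambda> (bt t))) (at t)"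
    using Zp[of t] by (intro DERIV_divide dZ DERIV_cmult) (auto intro!: derivative_eq_intros)
  then show "((\<lambda>t. dens \<Lambda> (bt t) x) has_real_derivative - dens \<Lambda> (bt t) x * (l x - e t)) (at t)"
    unfolding dens_def U_bt e using Zp[of t]
    by (elim DERIV_cong) (simp add: field_simps)
  show "isCont e t"
    unfolding e[abs_def] using Zp[of t]
    by (intro continuous_intros DERIV_isCont[OF dN] DERIV_isCont[OF dZ]) auto
qed

end

subsection \<open>Square integrable functions\<close>

lemma L2_D: "f \<in> L2 N \<Longrightarrow> f \<in> borel_measurable N" "f \<in> L2 N \<Longrightarrow> integrable N (\<lambda>x. (f x)\<^sup>2)"
  by (auto simp: L2_def)

lemma L2_mult_integrable:
  assumes "f \<in> L2 N" "g \<in> L2 N"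
  shows "integrable N (\<lambda>x. f x * g x)"
proof (rule Bochner_Integration.integrable_bound)
  show "integrable N (\<lambda>x. (f x)\<^sup>2 + (g x)\<^sup>2)"
    by (intro Bochner_Integration.integrable_add L2_D assms)
  show "AE x in N. norm (f x * g x) \<le> norm ((f x)\<^sup>2 + (g x)\<^sup>2)"
  proof (rule AE_I2)
    fix x
    have "2 * \<bar>f x\<bar> * \<bar>g x\<bar> \<le> (f x)\<^sup>2 + (g x)\<^sup>2" using sum_squares_bound[of "\<bar>f x\<bar>" "\<bar>g x\<bar>"] by simp
    moreover have "0 \<le> \<bar>f x\<bar> * \<bar>g x\<bar>" by simp
    ultimately have "\<bar>f x\<bar> * \<bar>g x\<bar> \<le> (f x)\<^sup>2 + (g x)\<^sup>2" by linarith
    then show "norm (f x * g x) \<le> norm ((f x)\<^sup>2 + (g x)\<^sup>2)" by (simp add: abs_mult)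
  qed
  show "(\<lambda>x. f x * g x) \<in> borel_measurable N" by (intro borel_measurable_times L2_D assms)
qed

lemma L2_cmult: "f \<in> L2 N \<Longrightarrow> (\<lambda>x. c * f x) \<in> L2 N"
  unfolding L2_def by (auto simp: power_mult_distrib)

lemma L2_add:
  assumes "f \<in> L2 N" "g \<in> L2 N"
  shows "(\<lambda>x. f x + g x) \<in> L2 N"
proof -
  have "integrable N (\<lambda>x. (f x)\<^sup>2 + (g x)\<^sup>2 + 2 * (f x * g x))"
    by (intro Bochner_Integration.integrable_add integrable_mult_right L2_mult_integrable L2_D assms)
  moreover have "(f x + g x)\<^sup>2 = (f x)\<^sup>2 + (g x)\<^sup>2 + 2 * (f x * g x)" for x
    by (simp add: power2_sum)
  ultimately show ?thesis
    unfolding L2_def using L2_D(1)[OF assms(1)] L2_D(1)[OF assms(2)] by simp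
qed

lemma L2_diff: "f \<in> L2 N \<Longrightarrow> g \<in> L2 N \<Longrightarrow> (\<lambda>x. f x - g x) \<in> L2 N"
  using L2_add[of f N "\<lambda>x. (-1) * g x"] L2_cmult[of g N "-1"] by simp

lemma L2_sum: "finite A \<Longrightarrow> (\<And>i. i \<in> A \<Longrightarrow> f i \<in> L2 N) \<Longrightarrow> (\<lambda>x. \<Sum>i\<in>A. f i x) \<in> L2 N"
proof (induction A rule: finite_induct)
  case empty
  then show ?case by (simp add: L2_def)
next
  case (insert a A)
  then show ?case using L2_add[of "f a" N "\<lambda>x. \<Sum>i\<in>A. f i x"] by simp
qed

lemma L2_AE_cong:
  assumes "f \<in> L2 N" "g \<in> borel_measurable N" "AE x in N. f x = g x"
  shows "g \<in> L2 N"
proof -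
  have "AE x in N. (f x)\<^sup>2 = (g x)\<^sup>2" using assms(3) by eventually_elim simp
  then have "integrable N (\<lambda>x. (g x)\<^sup>2)"
    using L2_D(2)[OF assms(1)] L2_D(1)[OF assms(1)] assms(2)
    by (subst integrable_cong_AE[symmetric]) (auto intro: borel_measurable_power)
  then show ?thesis using assms(2) by (simp add: L2_def)
qed

text \<open>The square of \<open>f - (c / V) * g\<close> has nonnegative integral. Using a positive
  upper bound \<open>V\<close> instead of the integral of the square of \<open>g\<close> avoids a
  division by zero.\<close>

lemma integral_Cauchy_Schwarz_bound:
  fixes f g :: "'a \<Rightarrow> real"
  assumes f: "f \<in> L2 N" and g: "g \<in> L2 N" and V: "(\<integral>x. (g x)\<^sup>2 \<partial>N) \<le> V" "V > 0"
  shows "(\<integral>x. f x * g x \<partial>N)\<^sup>2 \<le> (\<integral>x. (f x)\<^sup>2 \<partial>N) * V"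
proof -
  define c where "c = (\<integral>x. f x * g x \<partial>N)"
  have "0 \<le> (\<integral>x. (f x - (c / V) * g x)\<^sup>2 \<partial>N)" by simp
  also have "\<dots> = (\<integral>x. (f x)\<^sup>2 - (2 * c / V) * (f x * g x) + (c / V)\<^sup>2 * (g x)\<^sup>2 \<partial>N)"
    by (intro Bochner_Integration.integral_cong refl) (simp add: power2_diff power_mult_distrib power_divide)
  also have "\<dots> = (\<integral>x. (f x)\<^sup>2 \<partial>N) - (2 * c / V) * c + (c / V)\<^sup>2 * (\<integral>x. (g x)\<^sup>2 \<partial>N)"
    using L2_D(2)[OF f] L2_D(2)[OF g] L2_mult_integrable[OF f g]
    by (simp add: c_def)
  also have "\<dots> \<le> (\<integral>x. (f x)\<^sup>2 \<partial>N) - (2 * c / V) * c + (c / V)\<^sup>2 * V"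
    using V(1) by (intro add_left_mono mult_left_mono) auto
  also have "\<dots> = (\<integral>x. (f x)\<^sup>2 \<partial>N) - c\<^sup>2 / V"
    using V(2) by (simp add: power2_eq_square field_simps)
  finally have "c\<^sup>2 / V \<le> (\<integral>x. (f x)\<^sup>2 \<partial>N)" by simp
  then show ?thesis using V(2) by (simp add: c_def field_simps)
qed

lemma integral_Cauchy_Schwarz:
  fixes f g :: "'a \<Rightarrow> real"
  assumes f: "f \<in> L2 N" and g: "g \<in> L2 N"
  shows "\<bar>\<integral>x. f x * g x \<partial>N\<bar> \<le> sqrt (\<integral>x. (f x)\<^sup>2 \<partial>N) * sqrt (\<integral>x. (g x)\<^sup>2 \<partial>N)"
proof -
  define F where "F = (\<integral>x. (f x)\<^sup>2 \<partial>N)"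
  define G where "G = (\<integral>x. (g x)\<^sup>2 \<partial>N)"
  have nn: "F \<ge> 0" "G \<ge> 0" by (simp_all add: F_def G_def)
  have "(\<integral>x. f x * g x \<partial>N)\<^sup>2 \<le> F * G"
  proof (rule field_le_epsilon)
    fix e :: real assume e: "e > 0"
    have "(\<integral>x. f x * g x \<partial>N)\<^sup>2 \<le> F * (G + e / (F + 1))"
      unfolding F_def by (rule integral_Cauchy_Schwarz_bound[OF f g])
        (use e nn in \<open>auto simp: F_def[symmetric] G_def[symmetric] intro!: add_nonneg_pos\<close>)
    also have "\<dots> \<le> F * G + e"
    proof -
      have "F * (e / (F + 1)) \<le> e" using e nn by (simp add: field_simps)
      then show ?thesis by (simp add: distrib_left)
    qed
    finally show "(\<integral>x. f x * g x \<partial>N)\<^sup>2 \<le> F * G + e" .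
  qed
  then have "sqrt ((\<integral>x. f x * g x \<partial>N)\<^sup>2) \<le> sqrt (F * G)" by (rule real_sqrt_le_mono)
  then show ?thesis by (simp add: real_sqrt_mult F_def G_def)
qed

context prob_space
begin

lemma L2_integrable: "f \<in> L2 M \<Longrightarrow> integrable M f"
  by (rule square_integrable_imp_integrable) (auto simp: L2_def)

lemma L2_const: "(\<lambda>x. c) \<in> L2 M"
  by (simp add: L2_def)

lemma L2_variance:
  assumes f: "f \<in> L2 M"
  shows "(\<integral>x. (f x - expectation f)\<^sup>2 \<partial>M) = (\<integral>x. (f x)\<^sup>2 \<partial>M) - (expectation f)\<^sup>2"
  by (rule variance_eq[OF L2_integrable[OF f] L2_D(2)[OF f]])

lemma L2_expectation_square_le:
  assumes f: "f \<in> L2 M"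
  shows "(expectation f)\<^sup>2 \<le> (\<integral>x. (f x)\<^sup>2 \<partial>M)"
proof -
  have "0 \<le> (\<integral>x. (f x - expectation f)\<^sup>2 \<partial>M)" by (rule integral_nonneg_AE) simp
  then show ?thesis unfolding L2_variance[OF f] by linarith
qed

lemma L2_covariance:
  assumes f: "f \<in> L2 M" and g: "g \<in> L2 M"
  shows "(\<integral>x. (f x - expectation f) * (g x - expectation g) \<partial>M) = (\<integral>x. f x * g x \<partial>M) - expectation f * expectation g"
proof -
  note i = L2_integrable[OF f] L2_integrable[OF g] L2_mult_integrable[OF f g]
  have "(\<integral>x. (f x - expectation f) * (g x - expectation g) \<partial>M)
    = (\<integral>x. f x * g x - expectation g * f x - expectation f * g x + expectation f * expectation g \<partial>M)"
    by (intro Bochner_Integration.integral_cong refl) (simp add: algebra_simps)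
  also have "\<dots> = (\<integral>x. f x * g x \<partial>M) - expectation g * expectation f - expectation f * expectation g + expectation f * expectation g"
    using i by (simp add: prob_space)
  finally show ?thesis by simp
qed

lemma L2_centered: "f \<in> L2 M \<Longrightarrow> (\<lambda>x. f x - expectation f) \<in> L2 M"
  by (rule L2_diff[OF _ L2_const])

text \<open>Expansion of the square of \<open>\<rho> * F + G\<close>. The weights are such that a
  Poincare inequality with constant \<open>\<rho>\<close> turns \<open>\<rho>\<close> times the
  variance of \<open>f\<close> into a plain Dirichlet form, half of which can be absorbed.\<close>

lemma covariance_AM_GM:
  assumes f: "f \<in> L2 M" and g: "g \<in> L2 M" and \<rho>: "\<rho> > 0"
  shows "- ((\<integral>x. f x * g x \<partial>M) - expectation f * expectation g)
    \<le> (\<rho> * (\<integral>x. (f x - expectation f)\<^sup>2 \<partial>M) + (\<integral>x. (g x - expectation g)\<^sup>2 \<partial>M) / \<rho>) / 2"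
proof -
  define F where "F x = f x - expectation f" for x
  define G where "G x = g x - expectation g" for x
  have FG: "F \<in> L2 M" "G \<in> L2 M" unfolding F_def[abs_def] G_def[abs_def] by (intro L2_centered f g)+
  have "0 \<le> (\<integral>x. (\<rho> * F x + G x)\<^sup>2 \<partial>M)" by simp
  also have "\<dots> = (\<integral>x. \<rho>\<^sup>2 * (F x)\<^sup>2 + (2 * \<rho>) * (F x * G x) + (G x)\<^sup>2 \<partial>M)"
    by (intro Bochner_Integration.integral_cong refl) (simp add: power2_sum power_mult_distrib)
  also have "\<dots> = \<rho>\<^sup>2 * (\<integral>x. (F x)\<^sup>2 \<partial>M) + (2 * \<rho>) * (\<integral>x. F x * G x \<partial>M) + (\<integral>x. (G x)\<^sup>2 \<partial>M)"
    using L2_D(2)[OF FG(1)] L2_D(2)[OF FG(2)] L2_mult_integrable[OF FG] by simp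
  finally have nn: "0 \<le> \<rho>\<^sup>2 * (\<integral>x. (F x)\<^sup>2 \<partial>M) + (2 * \<rho>) * (\<integral>x. F x * G x \<partial>M) + (\<integral>x. (G x)\<^sup>2 \<partial>M)" .
  have "- c \<le> (\<rho> * a + d / \<rho>) / 2" if "0 \<le> \<rho>\<^sup>2 * a + (2 * \<rho>) * c + d" for a c d :: real
  proof -
    have "0 \<le> (\<rho>\<^sup>2 * a + (2 * \<rho>) * c + d) / \<rho>" using that \<rho> by simp
    also have "\<dots> = \<rho> * a + 2 * c + d / \<rho>" using \<rho> by (simp add: field_simps power2_eq_square)
    finally show ?thesis by simp
  qed
  from this[OF nn] have "- (\<integral>x. F x * G x \<partial>M) \<le> (\<rho> * (\<integral>x. (F x)\<^sup>2 \<partial>M) + (\<integral>x. (G x)\<^sup>2 \<partial>M) / \<rho>) / 2" .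
  then show ?thesis using L2_covariance[OF f g] by (simp add: F_def G_def)
qed

end

subsection \<open>Conditioning on the spins outside a block\<close>

text \<open>\<open>A\<close> is the block that is averaged out, \<open>B\<close> carries the
  remaining spins of the volume, and \<open>b\<close> is the field felt by the whole volume, the
  effect of its boundary condition included.\<close>

locale block = spin_system \<psi> M \<delta> C
  for \<psi> :: "'d::finite site \<Rightarrow> real \<Rightarrow> real" and M :: "'d site \<Rightarrow> 'd site \<Rightarrow> real" and \<delta> C :: real +
  fixes A B :: "'d site set" and b :: "'d site \<Rightarrow> real"
  assumes finA: "finite A" and finB: "finite B" and disj: "B \<inter> A = {}"
begin

text \<open>Frozen spins act on the block as an additional field. The factor 2 appears because the
  energy sums over ordered pairs of sites.\<close>

definition bc :: "'d config \<Rightarrow> 'd site \<Rightarrow> real" where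
  "bc z i = b i + 2 * (\<Sum>j\<in>B. M i j * z j)"

abbreviation mg :: "'d config \<Rightarrow> 'd config \<Rightarrow> 'd config" where
  "mg z y \<equiv> merge B A (z, y)"

abbreviation mu :: "'d config measure" where
  "mu \<equiv> gm (B \<union> A) b"

abbreviation mz :: "'d config \<Rightarrow> 'd config measure" where
  "mz z \<equiv> gm A (bc z)"

text \<open>The density, with respect to Lebesgue measure, of the marginal law of the spins in
  \<open>B\<close>.\<close>

definition wt :: "'d config \<Rightarrow> real" where
  "wt z = exp (- U B b z) * Z A (bc z) / Z (B \<union> A) b"

text \<open>A pointwise defined version of the conditional expectation given the spins in
  \<open>B\<close>, as a function of these spins alone; composition with \<open>restrict\<close>
  makes it a function on the whole volume.\<close>

definition E :: "('d config \<Rightarrow> real) \<Rightarrow> 'd config \<Rightarrow> real" where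
  "E F z = (\<integral>y. F (mg z y) \<partial>mz z)"

lemma fin: "finite (B \<union> A)" using finA finB by simp

lemma mg_A: "i \<in> A \<Longrightarrow> mg z y i = y i" and mg_B: "i \<in> B \<Longrightarrow> mg z y i = z i"
  using disj by (auto simp: merge_def)

lemma restrict_mg_B: "z \<in> space (leb B) \<Longrightarrow> restrict (mg z y) B = z"
  using disj by (simp add: space_lebn PiE_iff extensional_restrict)

lemma restrict_mg_A: "y \<in> space (leb A) \<Longrightarrow> restrict (mg z y) A = y"
  using disj by (simp add: space_lebn PiE_iff extensional_restrict)

text \<open>The interaction between \<open>A\<close> and \<open>B\<close> occurs once for each order
  of the two sites; symmetry of \<open>M\<close> merges both occurrences into the field
  \<open>bc z\<close>.\<close>

lemma U_merge: "U (B \<union> A) b (mg z y) = U A (bc z) y + U B b z"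
proof -
  let ?x = "mg z y"
  have s: "(\<Sum>i\<in>B \<union> A. h i) = (\<Sum>i\<in>B. h i) + (\<Sum>i\<in>A. h i)" for h :: "'d site \<Rightarrow> real"
    by (rule sum.union_disjoint[OF finB finA disj])
  have BA: "(\<Sum>i\<in>B. \<Sum>j\<in>A. M i j * z i * y j) = (\<Sum>i\<in>A. \<Sum>j\<in>B. M i j * z j * y i)"
    by (subst sum.swap) (simp add: sym mult_ac)
  have "U (B \<union> A) b ?x = (\<Sum>i\<in>B. \<psi> i (z i) + b i * z i) + (\<Sum>i\<in>A. \<psi> i (y i) + b i * y i)
    + ((\<Sum>i\<in>B. (\<Sum>j\<in>B. M i j * z i * z j) + (\<Sum>j\<in>A. M i j * z i * y j))
      + (\<Sum>i\<in>A. (\<Sum>j\<in>B. M i j * y i * z j) + (\<Sum>j\<in>A. M i j * y i * y j)))"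
    unfolding U_def s by (simp add: mg_A mg_B cong: sum.cong)
  also have "\<dots> = U A (bc z) y + U B b z"
    using BA by (simp add: U_def bc_def sum.distrib sum_distrib_left sum_distrib_right distrib_right algebra_simps)
  finally show ?thesis .
qed

lemma wt_pos: "wt z > 0"
  unfolding wt_def using Z_pos[OF finA] Z_pos[OF fin] by simp

lemma dens_merge: "dens (B \<union> A) b (mg z y) = wt z * dens A (bc z) y"
  unfolding dens_def wt_def U_merge using Z_pos[OF finA, of "bc z"]
  by (simp add: exp_add exp_minus exp_diff field_simps)

lemma section_measurable:
  assumes "F \<in> borel_measurable (leb (B \<union> A))" "z \<in> space (leb B)"
  shows "(\<lambda>y. F (mg z y)) \<in> borel_measurable (leb A)"
  using measurable_compose[OF measurable_compose[OF measurable_Pair1'[OF assms(2)] measurable_merge] assms(1)] .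

lemma section_measurable':
  assumes "F \<in> borel_measurable (leb (B \<union> A))" "y \<in> space (leb A)"
  shows "(\<lambda>z. F (mg z y)) \<in> borel_measurable (leb B)"
  using measurable_compose[OF measurable_compose[OF measurable_Pair2'[OF assms(2)] measurable_merge] assms(1)] .

lemma prob_mz: "prob_space (mz z)" by (rule prob_space_gm[OF finA])

lemma wt_E:
  assumes "F \<in> borel_measurable (leb (B \<union> A))" "z \<in> space (leb B)"
  shows "wt z * E F z = (\<integral>y. dens (B \<union> A) b (mg z y) * F (mg z y) \<partial>leb A)"
proof -
  have "wt z * E F z = wt z * (\<integral>y. dens A (bc z) y * F (mg z y) \<partial>leb A)"
    unfolding E_def by (subst integral_gm[OF finA section_measurable[OF assms]]) (rule refl)
  also have "\<dots> = (\<integral>y. wt z * (dens A (bc z) y * F (mg z y)) \<partial>leb A)" by simp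
  finally show ?thesis by (simp only: dens_merge mult.assoc)
qed

text \<open>Multiplied by the weight, \<open>E F\<close> is an integral over the block of a jointly
  measurable function; measurability of \<open>wt\<close> and of \<open>E F\<close> is then deduced
  from this.\<close>

lemma wt_E_measurable:
  assumes "F \<in> borel_measurable (leb (B \<union> A))"
  shows "(\<lambda>z. wt z * E F z) \<in> borel_measurable (leb B)"
proof -
  interpret sigma_finite_measure "leb A" by (rule sigma_finite_lebn[OF finA])
  have m: "(\<lambda>x. dens (B \<union> A) b x * F x) \<in> borel_measurable (leb (B \<union> A))"
    by (rule borel_measurable_times[OF dens_measurable[OF fin] assms])
  have "(\<lambda>z. \<integral>y. dens (B \<union> A) b (mg z y) * F (mg z y) \<partial>leb A) \<in> borel_measurable (leb B)"
    by (rule borel_measurable_lebesgue_integral) (use measurable_compose[OF measurable_merge m] in \<open>simp add: split_beta'\<close>)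
  then show ?thesis
    by (rule measurable_cong[THEN iffD1, rotated]) (simp add: wt_E[OF assms])
qed

lemma E_const: "E (\<lambda>_. c) z = c"
  using prob_space.prob_space[OF prob_mz] by (simp add: E_def)

lemma wt_measurable: "wt \<in> borel_measurable (leb B)"
  using wt_E_measurable[of "\<lambda>_. 1"] by (simp add: E_const)

lemma E_measurable:
  assumes "F \<in> borel_measurable (leb (B \<union> A))"
  shows "E F \<in> borel_measurable (leb B)"
proof -
  have "E F = (\<lambda>z. (wt z * E F z) / wt z)" using wt_pos by (auto simp: fun_eq_iff less_imp_neq[THEN not_sym])
  then show ?thesis
    using borel_measurable_divide[OF wt_E_measurable[OF assms] wt_measurable] by simp
qed

lemma restrict_measurable: "(\<lambda>x. restrict x B) \<in> leb (B \<union> A) \<rightarrow>\<^sub>M leb B"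
  by (rule measurable_restrict_subset) auto

lemma pull_measurable:
  "g \<in> borel_measurable (leb B) \<Longrightarrow> (\<lambda>x. g (restrict x B)) \<in> borel_measurable (leb (B \<union> A))"
  by (rule measurable_compose[OF restrict_measurable])

lemma tower:
  assumes F: "integrable mu F"
  shows tower_section: "AE z in leb B. integrable (mz z) (\<lambda>y. F (mg z y))"
    and tower_integrable: "integrable (leb B) (\<lambda>z. wt z * E F z)"
    and tower_integral: "(\<integral>x. F x \<partial>mu) = (\<integral>z. wt z * E F z \<partial>leb B)"
proof -
  interpret pair_sigma_finite "leb B" "leb A" by (rule sigma_finite_pair_lebn[OF finA finB])
  have Fm: "F \<in> borel_measurable (leb (B \<union> A))" using borel_measurable_integrable[OF F] by simp
  have i: "integrable (leb (B \<union> A)) (\<lambda>x. dens (B \<union> A) b x * F x)"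
    using F integrable_gm[OF fin Fm] by simp
  note p = integrable_lebn_merge_pair[OF finA finB disj i]
  show "AE z in leb B. integrable (mz z) (\<lambda>y. F (mg z y))"
    using AE_integrable_fst'[OF p] AE_space
  proof eventually_elim
    case (elim z)
    have "integrable (leb A) (\<lambda>y. (1 / wt z) * (dens (B \<union> A) b (mg z y) * F (mg z y)))"
      using elim(1) by (rule integrable_mult_right)
    then have "integrable (leb A) (\<lambda>y. dens A (bc z) y * F (mg z y))"
      using wt_pos[of z] by (simp add: dens_merge)
    then show ?case by (subst integrable_gm[OF finA section_measurable[OF Fm elim(2)]])
  qed
  have "integrable (leb B) (\<lambda>z. \<integral>y. dens (B \<union> A) b (mg z y) * F (mg z y) \<partial>leb A)"
    using integrable_fst'[OF p] .
  then show "integrable (leb B) (\<lambda>z. wt z * E F z)"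
    by (rule Bochner_Integration.integrable_cong[THEN iffD1, rotated -1]) (simp_all add: wt_E[OF Fm])
  have "(\<integral>x. F x \<partial>mu) = (\<integral>x. dens (B \<union> A) b x * F x \<partial>leb (B \<union> A))" by (rule integral_gm[OF fin Fm])
  also have "\<dots> = (\<integral>z. \<integral>y. dens (B \<union> A) b (mg z y) * F (mg z y) \<partial>leb A \<partial>leb B)"
    by (rule lebn.product_integral_fold[OF disj finB finA i])
  also have "\<dots> = (\<integral>z. wt z * E F z \<partial>leb B)"
    by (rule Bochner_Integration.integral_cong[OF refl]) (simp add: wt_E[OF Fm])
  finally show "(\<integral>x. F x \<partial>mu) = (\<integral>z. wt z * E F z \<partial>leb B)" .
qed

lemma E_pull_out:
  assumes "z \<in> space (leb B)"
  shows "E (\<lambda>x. F x * g (restrict x B)) z = E F z * g z"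
  unfolding E_def restrict_mg_B[OF assms] by simp

lemma E_pull: "z \<in> space (leb B) \<Longrightarrow> E (\<lambda>x. g (restrict x B)) z = g z"
  using E_pull_out[of z "\<lambda>_. 1" g] by (simp add: E_const)

lemma pull_integrable:
  assumes g: "g \<in> borel_measurable (leb B)" and i: "integrable (leb B) (\<lambda>z. wt z * g z)"
  shows "integrable mu (\<lambda>x. g (restrict x B))"
proof -
  interpret P: prob_space "mz z" for z by (rule prob_mz)
  note gm = pull_measurable[OF g]
  have m: "(\<lambda>x. dens (B \<union> A) b x * g (restrict x B)) \<in> borel_measurable (leb (B \<union> A))"
    by (rule borel_measurable_times[OF dens_measurable[OF fin] gm])
  have "integrable (leb (B \<union> A)) (\<lambda>x. dens (B \<union> A) b x * g (restrict x B))"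
  proof (rule integrableI_bounded[OF m])
    have "(\<integral>\<^sup>+x. ennreal (norm (dens (B \<union> A) b x * g (restrict x B))) \<partial>leb (B \<union> A))
      = (\<integral>\<^sup>+z. \<integral>\<^sup>+y. ennreal (norm (dens (B \<union> A) b (mg z y) * g (restrict (mg z y) B))) \<partial>leb A \<partial>leb B)"
      by (rule lebn.product_nn_integral_fold[OF disj finB finA]) (use m in measurable)
    also have "\<dots> = (\<integral>\<^sup>+z. ennreal (norm (wt z * g z)) \<partial>leb B)"
    proof (rule nn_integral_cong)
      fix z assume z: "z \<in> space (leb B)"
      have "(\<integral>\<^sup>+y. ennreal (norm (dens (B \<union> A) b (mg z y) * g (restrict (mg z y) B))) \<partial>leb A)
        = (\<integral>\<^sup>+y. ennreal (norm (wt z * g z)) * ennreal (dens A (bc z) y) \<partial>leb A)"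
        unfolding restrict_mg_B[OF z] dens_merge
        using dens_pos[OF finA, of "bc z"]
        by (intro nn_integral_cong) (simp add: ennreal_mult''[symmetric] abs_mult mult_ac less_imp_le)
      also have "\<dots> = ennreal (norm (wt z * g z)) * (\<integral>\<^sup>+y. ennreal (dens A (bc z) y) \<partial>leb A)"
        by (rule nn_integral_cmult) (rule measurable_compose[OF dens_measurable[OF finA] measurable_ennreal])
      also have "(\<integral>\<^sup>+y. ennreal (dens A (bc z) y) \<partial>leb A) = ennreal (\<integral>y. dens A (bc z) y \<partial>leb A)"
        by (rule nn_integral_eq_integral[OF integrable_dens[OF finA]]) (simp add: dens_pos[OF finA] less_imp_le)
      finally show "(\<integral>\<^sup>+y. ennreal (norm (dens (B \<union> A) b (mg z y) * g (restrict (mg z y) B))) \<partial>leb A) = ennreal (norm (wt z * g z))"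
        by (simp only: integral_dens[OF finA] ennreal_1 mult_1_right)
    qed
    also have "\<dots> < \<infinity>" using i by (simp add: integrable_iff_bounded)
    finally show "(\<integral>\<^sup>+x. ennreal (norm (dens (B \<union> A) b x * g (restrict x B))) \<partial>leb (B \<union> A)) < \<infinity>" .
  qed
  then show ?thesis by (subst integrable_gm[OF fin gm])
qed

lemma pull_integral:
  assumes g: "g \<in> borel_measurable (leb B)" and i: "integrable (leb B) (\<lambda>z. wt z * g z)"
  shows "(\<integral>x. g (restrict x B) \<partial>mu) = (\<integral>z. wt z * g z \<partial>leb B)"
  by (subst tower_integral[OF pull_integrable[OF assms]], rule Bochner_Integration.integral_cong[OF refl])
    (simp add: E_pull)

lemma L2_section:
  assumes F: "F \<in> L2 mu"
  shows "AE z in leb B. (\<lambda>y. F (mg z y)) \<in> L2 (mz z)"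
  using tower_section[OF L2_D(2)[OF F]] AE_space
proof eventually_elim
  case (elim z)
  have "F \<in> borel_measurable (leb (B \<union> A))" using L2_D(1)[OF F] by simp
  from section_measurable[OF this elim(2)] show ?case using elim(1) by (simp add: L2_def)
qed

lemma E_Jensen:
  assumes F: "F \<in> L2 mu"
  shows "AE z in leb B. (E F z)\<^sup>2 \<le> E (\<lambda>x. (F x)\<^sup>2) z"
  using L2_section[OF F]
proof eventually_elim
  case (elim z)
  interpret prob_space "mz z" by (rule prob_mz)
  show ?case unfolding E_def by (rule L2_expectation_square_le[OF elim])
qed

text \<open>A conditional second moment integrates back to the second moment by the tower property.
  Applied with \<open>K = 1\<close> through Jensen's inequality and with a larger constant to
  conditional covariances.\<close>

lemma pull_L2:
  assumes g: "g \<in> borel_measurable (leb B)" and F: "F \<in> L2 mu"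
    and le: "AE z in leb B. (g z)\<^sup>2 \<le> K * E (\<lambda>x. (F x)\<^sup>2) z"
  shows "(\<lambda>x. g (restrict x B)) \<in> L2 mu"
    and "integrable (leb B) (\<lambda>z. wt z * (g z)\<^sup>2)"
    and "(\<integral>x. (g (restrict x B))\<^sup>2 \<partial>mu) \<le> K * (\<integral>x. (F x)\<^sup>2 \<partial>mu)"
proof -
  note Fi = L2_D(2)[OF F]
  have gm: "(\<lambda>z. (g z)\<^sup>2) \<in> borel_measurable (leb B)" using g by (rule borel_measurable_power)
  have iK: "integrable (leb B) (\<lambda>z. K * (wt z * E (\<lambda>x. (F x)\<^sup>2) z))"
    by (rule integrable_mult_right[OF tower_integrable[OF Fi]])
  have le': "AE z in leb B. wt z * (g z)\<^sup>2 \<le> K * (wt z * E (\<lambda>x. (F x)\<^sup>2) z)"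
    using le
  proof eventually_elim
    case (elim z)
    then show ?case using mult_left_mono[OF elim less_imp_le[OF wt_pos[of z]]] by (simp add: mult_ac)
  qed
  show i: "integrable (leb B) (\<lambda>z. wt z * (g z)\<^sup>2)"
  proof (rule Bochner_Integration.integrable_bound[OF iK])
    show "(\<lambda>z. wt z * (g z)\<^sup>2) \<in> borel_measurable (leb B)" by (rule borel_measurable_times[OF wt_measurable gm])
    show "AE z in leb B. norm (wt z * (g z)\<^sup>2) \<le> norm (K * (wt z * E (\<lambda>x. (F x)\<^sup>2) z))"
      using le'
    proof eventually_elim
      case (elim z)
      have "0 \<le> wt z * (g z)\<^sup>2" using wt_pos[of z] by (simp add: less_imp_le)
      then show ?case using elim by (simp only: real_norm_def abs_of_nonneg order_trans)
    qed
  qed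
  show "(\<lambda>x. g (restrict x B)) \<in> L2 mu"
    using pull_integrable[OF gm i] pull_measurable[OF g] by (simp add: L2_def)
  have "(\<integral>x. (g (restrict x B))\<^sup>2 \<partial>mu) = (\<integral>z. wt z * (g z)\<^sup>2 \<partial>leb B)" by (rule pull_integral[OF gm i])
  also have "\<dots> \<le> (\<integral>z. K * (wt z * E (\<lambda>x. (F x)\<^sup>2) z) \<partial>leb B)" by (rule integral_mono_AE[OF i iK le'])
  also have "\<dots> = K * (\<integral>x. (F x)\<^sup>2 \<partial>mu)" by (simp add: tower_integral[OF Fi])
  finally show "(\<integral>x. (g (restrict x B))\<^sup>2 \<partial>mu) \<le> K * (\<integral>x. (F x)\<^sup>2 \<partial>mu)" .
qed

lemma E_L2:
  assumes F: "F \<in> L2 mu"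
  shows "(\<lambda>x. E F (restrict x B)) \<in> L2 mu"
    and "integrable (leb B) (\<lambda>z. wt z * (E F z)\<^sup>2)"
    and "(\<integral>x. (E F (restrict x B))\<^sup>2 \<partial>mu) \<le> (\<integral>x. (F x)\<^sup>2 \<partial>mu)"
proof -
  have m: "E F \<in> borel_measurable (leb B)" using L2_D(1)[OF F] by (intro E_measurable) simp
  have "AE z in leb B. (E F z)\<^sup>2 \<le> 1 * E (\<lambda>x. (F x)\<^sup>2) z" using E_Jensen[OF F] by simp
  from pull_L2[OF m F this] show "(\<lambda>x. E F (restrict x B)) \<in> L2 mu"
    "integrable (leb B) (\<lambda>z. wt z * (E F z)\<^sup>2)"
    "(\<integral>x. (E F (restrict x B))\<^sup>2 \<partial>mu) \<le> (\<integral>x. (F x)\<^sup>2 \<partial>mu)" by simp_all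
qed

text \<open>The lower bound of the joint density is integrated over a cube of block spins; the
  maximum with 1 gives this cube positive volume for every \<open>R\<close>.\<close>

lemma wt_lower_bound:
  obtains \<epsilon> where "\<epsilon> > 0" "\<And>z. z \<in> PiE B (\<lambda>_. {-R..R}) \<Longrightarrow> \<epsilon> \<le> wt z"
proof -
  define R' where "R' = max R 1"
  have R': "R \<le> R'" "R' > 0" by (auto simp: R'_def)
  obtain \<epsilon> where \<epsilon>: "\<epsilon> > 0" "\<And>x. x \<in> PiE (B \<union> A) (\<lambda>_. {-R'..R'}) \<Longrightarrow> \<epsilon> \<le> dens (B \<union> A) b x"
    using dens_lower_bound[OF fin] by metis
  define V where "V = measure (leb A) (PiE A (\<lambda>_. {-R'..R'}))"
  have em: "emeasure (leb A) (PiE A (\<lambda>_. {-R'..R'})) = ennreal ((2 * R') ^ card A)"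
    using R' finA by (subst lebn.emeasure_PiM) (simp_all add: ennreal_power power_mult_distrib)
  have V: "V > 0" unfolding V_def measure_def em using R' by simp
  show ?thesis
  proof (rule that[of "\<epsilon> * V"])
    show "\<epsilon> * V > 0" using \<epsilon>(1) V by simp
    fix z assume z: "z \<in> PiE B (\<lambda>_. {-R..R})"
    then have zs: "z \<in> space (leb B)" by (auto simp: space_lebn PiE_iff)
    have cube: "PiE A (\<lambda>_. {-R'..R'}) \<in> sets (leb A)" by (rule cube_measurable[OF finA])
    have "\<epsilon> * V = (\<integral>y. \<epsilon> * indicator (PiE A (\<lambda>_. {-R'..R'})) y \<partial>leb A)"
      using cube by (simp add: V_def)
    also have "\<dots> \<le> (\<integral>y. wt z * dens A (bc z) y \<partial>leb A)"
    proof (rule integral_mono)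
      show "integrable (leb A) (\<lambda>y. \<epsilon> * indicator (PiE A (\<lambda>_. {-R'..R'})) y)"
        using cube em by (intro integrable_mult_right) simp
      show "integrable (leb A) (\<lambda>y. wt z * dens A (bc z) y)" by (rule integrable_mult_right[OF integrable_dens[OF finA]])
      fix y
      show "\<epsilon> * indicator (PiE A (\<lambda>_. {-R'..R'})) y \<le> wt z * dens A (bc z) y"
      proof (cases "y \<in> PiE A (\<lambda>_. {-R'..R'})")
        case True
        have "mg z y \<in> PiE (B \<union> A) (\<lambda>_. {-R'..R'})"
          unfolding cube_iff[OF merge_cspace]
        proof
          fix i assume "i \<in> B \<union> A"
          then show "\<bar>mg z y i\<bar> \<le> R'"
          proof
            assume i: "i \<in> B"
            then have "z i \<in> {-R..R}" using z by auto
            then show ?thesis using R' i by (auto simp: mg_B)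
          next
            assume i: "i \<in> A"
            then have "y i \<in> {-R'..R'}" using True by auto
            then show ?thesis using i by (auto simp: mg_A)
          qed
        qed
        from \<epsilon>(2)[OF this] show ?thesis using True by (simp add: dens_merge)
      next
        case False
        then show ?thesis using wt_pos[of z] dens_pos[OF finA, of "bc z" y] by simp
      qed
    qed
    also have "\<dots> = wt z" by (simp add: integral_dens[OF finA])
    finally show "\<epsilon> * V \<le> wt z" .
  qed
qed

text \<open>The conditional density of the block spins as a function on the whole volume. A spin in
  \<open>B\<close> enters through the linear field only, so the dependence on it is continuously
  differentiable; the joint density contains \<open>\<psi>\<close> of this spin and need not have
  this property.\<close>

definition pA :: "'d config \<Rightarrow> real" where
  "pA x = dens A (bc (restrict x B)) (restrict x A)"

lemma pA_mg: "z \<in> space (leb B) \<Longrightarrow> y \<in> space (leb A) \<Longrightarrow> pA (mg z y) = dens A (bc z) y"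
  unfolding pA_def by (simp only: restrict_mg_B restrict_mg_A)

lemma pA_eq: "x \<in> cspace (B \<union> A) \<Longrightarrow> pA x = dens (B \<union> A) b x / wt (restrict x B)"
  using dens_merge[of "restrict x B" "restrict x A"] wt_pos[of "restrict x B"]
  by (simp add: pA_def)

text \<open>Weighting with the conditional instead of the joint density folds an integral over the
  volume into a Lebesgue integral over \<open>B\<close> of the conditional expectation, without the
  factor \<open>wt\<close>. This factor is bounded below on the support of \<open>v\<close>, whence
  integrability.\<close>

lemma weighted_fold:
  assumes F: "integrable mu F" and v: "v \<in> borel_measurable (leb B)" and K: "\<forall>z. \<bar>v z\<bar> \<le> K"
    and supp: "\<forall>z\<in>cspace B. z \<notin> PiE B (\<lambda>_. {-R..R}) \<longrightarrow> v z = 0"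
  shows "integrable (leb (B \<union> A)) (\<lambda>x. F x * (pA x * v (restrict x B)))"
    and "integrable (leb B) (\<lambda>z. E F z * v z)"
    and "(\<integral>x. F x * (pA x * v (restrict x B)) \<partial>leb (B \<union> A)) = (\<integral>z. E F z * v z \<partial>leb B)"
proof -
  interpret pair_sigma_finite "leb B" "leb A" by (rule sigma_finite_pair_lebn[OF finA finB])
  obtain \<epsilon> where \<epsilon>: "\<epsilon> > 0" "\<And>z. z \<in> PiE B (\<lambda>_. {-R..R}) \<Longrightarrow> \<epsilon> \<le> wt z" using wt_lower_bound by metis
  have Fm: "F \<in> borel_measurable (leb (B \<union> A))" using borel_measurable_integrable[OF F] by simp
  have i: "integrable (leb (B \<union> A)) (\<lambda>x. dens (B \<union> A) b x * F x)"
    using F integrable_gm[OF fin Fm] by simp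
  have "integrable (leb (B \<union> A)) (\<lambda>x. (dens (B \<union> A) b x * F x) * (v (restrict x B) / wt (restrict x B)))"
  proof (rule Bochner_Integration.integrable_bound)
    show "integrable (leb (B \<union> A)) (\<lambda>x. (\<bar>K\<bar> / \<epsilon>) * (dens (B \<union> A) b x * F x))" by (rule integrable_mult_right[OF i])
    show "(\<lambda>x. (dens (B \<union> A) b x * F x) * (v (restrict x B) / wt (restrict x B))) \<in> borel_measurable (leb (B \<union> A))"
      by (intro borel_measurable_times borel_measurable_divide dens_measurable[OF fin] Fm pull_measurable v wt_measurable)
    show "AE x in leb (B \<union> A). norm ((dens (B \<union> A) b x * F x) * (v (restrict x B) / wt (restrict x B)))
      \<le> norm ((\<bar>K\<bar> / \<epsilon>) * (dens (B \<union> A) b x * F x))"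
    proof (rule AE_I2)
      fix x assume "x \<in> space (leb (B \<union> A))"
      then have z: "restrict x B \<in> cspace B" by (simp add: PiE_iff)
      have "\<bar>v (restrict x B) / wt (restrict x B)\<bar> \<le> \<bar>K\<bar> / \<epsilon>"
      proof (cases "restrict x B \<in> PiE B (\<lambda>_. {-R..R})")
        case True
        then show ?thesis using \<epsilon>(1) \<epsilon>(2)[OF True] spec[OF K, of "restrict x B"] unfolding abs_divide by (intro frac_le) auto
      next
        case False
        then show ?thesis using bspec[OF supp z] \<epsilon>(1) by simp
      qed
      then have "\<bar>dens (B \<union> A) b x * F x\<bar> * \<bar>v (restrict x B) / wt (restrict x B)\<bar> \<le> \<bar>dens (B \<union> A) b x * F x\<bar> * (\<bar>K\<bar> / \<epsilon>)"
        by (rule mult_left_mono) simp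
      also have "\<dots> = norm ((\<bar>K\<bar> / \<epsilon>) * (dens (B \<union> A) b x * F x))"
        using \<epsilon>(1) by (simp add: abs_mult mult_ac)
      finally show "norm ((dens (B \<union> A) b x * F x) * (v (restrict x B) / wt (restrict x B)))
        \<le> norm ((\<bar>K\<bar> / \<epsilon>) * (dens (B \<union> A) b x * F x))" by (simp only: real_norm_def abs_mult)
    qed
  qed
  then show int: "integrable (leb (B \<union> A)) (\<lambda>x. F x * (pA x * v (restrict x B)))"
    by (rule Bochner_Integration.integrable_cong[THEN iffD1, rotated -1]) (simp_all add: pA_eq space_lebn)
  have inner: "(\<integral>y. F (mg z y) * (pA (mg z y) * v (restrict (mg z y) B)) \<partial>leb A) = E F z * v z" if z: "z \<in> space (leb B)" for z
  proof -
    have "(\<integral>y. F (mg z y) * (pA (mg z y) * v (restrict (mg z y) B)) \<partial>leb A) = (\<integral>y. (dens A (bc z) y * F (mg z y)) * v z \<partial>leb A)"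
      by (rule Bochner_Integration.integral_cong[OF refl]) (simp add: pA_mg[OF z] restrict_mg_B[OF z] del: restrict_merge)
    also have "\<dots> = (\<integral>y. dens A (bc z) y * F (mg z y) \<partial>leb A) * v z" by simp
    finally show ?thesis unfolding E_def by (subst integral_gm[OF finA section_measurable[OF Fm z]])
  qed
  have "integrable (leb B) (\<lambda>z. \<integral>y. F (mg z y) * (pA (mg z y) * v (restrict (mg z y) B)) \<partial>leb A)"
    using integrable_fst'[OF integrable_lebn_merge_pair[OF finA finB disj int]] .
  then show "integrable (leb B) (\<lambda>z. E F z * v z)"
    by (rule Bochner_Integration.integrable_cong[THEN iffD1, rotated -1]) (simp_all only: inner refl)
  have "(\<integral>x. F x * (pA x * v (restrict x B)) \<partial>leb (B \<union> A))
    = (\<integral>z. \<integral>y. F (mg z y) * (pA (mg z y) * v (restrict (mg z y) B)) \<partial>leb A \<partial>leb B)"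
    by (rule lebn.product_integral_fold[OF disj finB finA int])
  also have "\<dots> = (\<integral>z. E F z * v z \<partial>leb B)"
    by (rule Bochner_Integration.integral_cong[OF refl]) (simp only: inner)
  finally show "(\<integral>x. F x * (pA x * v (restrict x B)) \<partial>leb (B \<union> A)) = (\<integral>z. E F z * v z \<partial>leb B)" .
qed

lemma integral_lebn_merge_swap:
  fixes F :: "'d config \<Rightarrow> real"
  assumes F: "integrable (leb (B \<union> A)) F"
  shows "(\<integral>x. F x \<partial>leb (B \<union> A)) = (\<integral>y. \<integral>z. F (mg z y) \<partial>leb B \<partial>leb A)"
proof -
  interpret pair_sigma_finite "leb B" "leb A" by (rule sigma_finite_pair_lebn[OF finA finB])
  have "integrable (leb B \<Otimes>\<^sub>M leb A) (\<lambda>(z, y). F (mg z y))"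
    using integrable_lebn_merge_pair[OF finA finB disj F] by (simp add: split_beta')
  from Fubini_integral[OF this] show ?thesis
    using lebn.product_integral_fold[OF disj finB finA F] by simp
qed

end

section \<open>Weak derivatives of differences and of functions that ignore a spin\<close>

lemma has_weak_partial_diff:
  assumes fin: "finite \<Lambda>" and j: "j \<in> \<Lambda>" and f: "has_weak_partial \<Lambda> j f g" and f': "has_weak_partial \<Lambda> j f' g'"
  shows "has_weak_partial \<Lambda> j (\<lambda>x. f x - f' x) (\<lambda>x. g x - g' x)"
proof -
  have l: "locally_integrable \<Lambda> f" "locally_integrable \<Lambda> g" "locally_integrable \<Lambda> f'" "locally_integrable \<Lambda> g'"
    using f f' by (simp_all add: has_weak_partial_def)
  have ld: "locally_integrable \<Lambda> (\<lambda>x. u x - v x)" if "locally_integrable \<Lambda> u" "locally_integrable \<Lambda> v" for u v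
    using that unfolding locally_integrable_def by (auto intro: set_integral_diff)
  show ?thesis unfolding has_weak_partial_def
  proof (intro conjI allI impI ld l)
    fix \<eta> assume \<eta>: "test_fun \<Lambda> \<eta>"
    note i = integrable_times_test_fun(2)[OF fin l(1) \<eta> j] integrable_times_test_fun(2)[OF fin l(3) \<eta> j]
      integrable_times_test_fun(1)[OF fin l(2) \<eta>] integrable_times_test_fun(1)[OF fin l(4) \<eta>]
    have "(\<integral>x. (f x - f' x) * partial_deriv j \<eta> x \<partial>leb \<Lambda>) = (\<integral>x. f x * partial_deriv j \<eta> x \<partial>leb \<Lambda>) - (\<integral>x. f' x * partial_deriv j \<eta> x \<partial>leb \<Lambda>)"
      unfolding left_diff_distrib by (rule Bochner_Integration.integral_diff[OF i(1,2)])
    also have "\<dots> = - ((\<integral>x. g x * \<eta> x \<partial>leb \<Lambda>) - (\<integral>x. g' x * \<eta> x \<partial>leb \<Lambda>))"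
      unfolding has_weak_partialD[OF f \<eta>] has_weak_partialD[OF f' \<eta>] by simp
    also have "(\<integral>x. g x * \<eta> x \<partial>leb \<Lambda>) - (\<integral>x. g' x * \<eta> x \<partial>leb \<Lambda>) = (\<integral>x. (g x - g' x) * \<eta> x \<partial>leb \<Lambda>)"
      unfolding left_diff_distrib by (rule Bochner_Integration.integral_diff[OF i(3,4), symmetric])
    finally show "(\<integral>x. (f x - f' x) * partial_deriv j \<eta> x \<partial>leb \<Lambda>) = - (\<integral>x. (g x - g' x) * \<eta> x \<partial>leb \<Lambda>)" .
  qed
qed

lemma locally_integrable_zero: "locally_integrable \<Lambda> (\<lambda>_. 0)"
  by (simp add: locally_integrable_def set_integrable_def)

lemma has_weak_partial_of_invariant:
  assumes fin: "finite \<Lambda>" and j: "j \<in> \<Lambda>" and l: "locally_integrable \<Lambda> f"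
    and inv: "\<And>x t. x \<in> cspace \<Lambda> \<Longrightarrow> f (x(j := t)) = f x"
  shows "has_weak_partial \<Lambda> j f (\<lambda>_. 0)"
proof (rule acl_imp_has_weak_partial[OF fin j])
  have "line_primitive \<Lambda> j f (\<lambda>_. 0) n f" for n
    unfolding line_primitive_def
  proof (rule AE_I2, rule impI)
    fix x assume "x \<in> space (leb \<Lambda>)"
    then have "f (x(j := 0)) = f x" by (intro inv) (simp add: space_lebn)
    then show "f x = f (x(j := 0)) + (LBINT r:{- real n..x j}. 0)" by (simp add: set_lebesgue_integral_def)
  qed
  then show "acl \<Lambda> j f (\<lambda>_. 0)"
    unfolding acl_def using l locally_integrable_zero by blast
qed

text \<open>On almost every line \<open>f\<close> agrees almost everywhere with one of its values,
  and the derivative of a compactly supported function integrates to zero along the line.\<close>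

lemma has_weak_partial_of_AE_invariant:
  assumes fin: "finite \<Lambda>" and j: "j \<in> \<Lambda>" and l: "locally_integrable \<Lambda> f"
    and inv: "AE x in leb \<Lambda>. AE t in lborel. f (x(j := t)) = f x"
  shows "has_weak_partial \<Lambda> j f (\<lambda>_. 0)"
  unfolding has_weak_partial_def
proof (intro conjI allI impI l locally_integrable_zero)
  fix \<eta> assume \<eta>: "test_fun \<Lambda> \<eta>"
  obtain R where R: "\<And>x i. x \<in> cspace \<Lambda> \<Longrightarrow> i \<in> \<Lambda> \<Longrightarrow> \<bar>x i\<bar> > R \<Longrightarrow> \<eta> x = 0"
    "\<And>j x i. j \<in> \<Lambda> \<Longrightarrow> x \<in> cspace \<Lambda> \<Longrightarrow> i \<in> \<Lambda> \<Longrightarrow> \<bar>x i\<bar> > R \<Longrightarrow> partial_deriv j \<eta> x = 0"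
    using test_fun_support[OF \<eta>] by metis
  define R' where "R' = \<bar>R\<bar> + 1"
  have R': "R < R'" "- R' \<le> R'" by (auto simp: R'_def)
  note i = integrable_times_test_fun(2)[OF fin l \<eta> j]
  have "(\<integral>x. f x * partial_deriv j \<eta> x \<partial>leb \<Lambda>) = (\<integral>x. \<integral>t. f (x(j := t)) * partial_deriv j \<eta> (x(j := t)) \<partial>lborel \<partial>leb (\<Lambda> - {j}))"
    by (rule integral_lebn_coordinate[OF fin j i])
  also have "\<dots> = 0"
  proof (rule integral_eq_zero_AE)
    show "AE x in leb (\<Lambda> - {j}). (\<integral>t. f (x(j := t)) * partial_deriv j \<eta> (x(j := t)) \<partial>lborel) = 0"
      using AE_lebn_coordinate[OF fin j inv] AE_space
    proof eventually_elim
      case (elim x)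
      have xc: "x(j := t) \<in> cspace \<Lambda>" for t
        using fun_upd_space_lebn[OF elim(2) j, of t] by (simp add: space_lebn)
      \<comment> \<open>Almost every point \<open>s\<close> of the line would do; there is one
        because the line is not a null set.\<close>
      have "\<exists>s. AE t in lborel. f (x(j := t)) = f (x(j := s))"
      proof (rule ccontr)
        assume no: "\<not> ?thesis"
        have "AE s in (lborel :: real measure). False"
          using elim(1)
        proof eventually_elim
          case (elim s)
          then have "AE t in lborel. f (x(j := t)) = f (x(j := s))" by (simp only: fun_upd_upd)
          then show False using no by blast
        qed
        then have "emeasure lborel (space lborel :: real set) = 0" by (simp add: AE_iff_null null_sets_def)
        then show False by simp
      qed
      then obtain s where s: "AE t in lborel. f (x(j := t)) = f (x(j := s))" ..
      have d: "((\<lambda>t. \<eta> (x(j := t))) has_real_derivative partial_deriv j \<eta> (x(j := t))) (at t)" for t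
        using test_fun_DERIV[OF \<eta> j xc[of 0], of t] by simp
      have c: "isCont (\<lambda>t. partial_deriv j \<eta> (x(j := t))) t" for t
        using test_fun_isCont[OF \<eta> j xc[of 0], of t] by simp
      have pm: "(\<lambda>t. partial_deriv j \<eta> (x(j := t))) \<in> borel_measurable lborel"
        using c by (simp add: borel_measurable_continuous_onI continuous_at_imp_continuous_on)
      have "(\<integral>t. f (x(j := t)) * partial_deriv j \<eta> (x(j := t)) \<partial>lborel) = (\<integral>t. f (x(j := s)) * partial_deriv j \<eta> (x(j := t)) \<partial>lborel)"
      proof (rule integral_cong_AE)
        show "(\<lambda>t. f (x(j := t)) * partial_deriv j \<eta> (x(j := t))) \<in> borel_measurable lborel"
          using measurable_compose[OF measurable_fun_upd_lebn[OF elim(2) j] borel_measurable_integrable[OF i]] .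
        show "(\<lambda>t. f (x(j := s)) * partial_deriv j \<eta> (x(j := t))) \<in> borel_measurable lborel"
          by (rule borel_measurable_times[OF borel_measurable_const pm])
        show "AE t in lborel. f (x(j := t)) * partial_deriv j \<eta> (x(j := t)) = f (x(j := s)) * partial_deriv j \<eta> (x(j := t))"
          using s by eventually_elim simp
      qed
      also have "\<dots> = f (x(j := s)) * (\<integral>t. partial_deriv j \<eta> (x(j := t)) \<partial>lborel)" by simp
      also have "(\<integral>t. partial_deriv j \<eta> (x(j := t)) \<partial>lborel) = (\<integral>t. partial_deriv j \<eta> (x(j := t)) * indicator {-R'..R'} t \<partial>lborel)"
      proof (rule Bochner_Integration.integral_cong[OF refl])
        fix t
        show "partial_deriv j \<eta> (x(j := t)) = partial_deriv j \<eta> (x(j := t)) * indicator {-R'..R'} t"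
        proof (cases "t \<in> {-R'..R'}")
          case False
          then have "\<bar>(x(j := t)) j\<bar> > R" using R' by auto
          from R(2)[OF j xc j this] show ?thesis by (simp only: mult_zero_left)
        qed simp
      qed
      also have "\<dots> = \<eta> (x(j := R')) - \<eta> (x(j := - R'))" by (rule integral_FTC_Icc_real[OF R'(2) d c])
      also have "\<eta> (x(j := R')) = 0" by (rule R(1)[OF xc j]) (use R' in auto)
      also have "\<eta> (x(j := - R')) = 0" by (rule R(1)[OF xc j]) (use R' in auto)
      finally show ?case by (simp only: diff_self mult_zero_right)
    qed
  qed
  finally show "(\<integral>x. f x * partial_deriv j \<eta> x \<partial>leb \<Lambda>) = - (\<integral>x. 0 * \<eta> x \<partial>leb \<Lambda>)" by simp
qed

section \<open>Sobolev functions of a Gibbs measure and the variance of linear functions\<close>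

context spin_system
begin

text \<open>\<open>H1\<close> speaks of the chosen version \<open>weak_partial\<close>; uniqueness
  up to null sets lets any square integrable weak derivative take its place.\<close>

lemma H1I:
  assumes fin: "finite \<Lambda>" and f: "f \<in> L2 (gm \<Lambda> b)"
    and g: "\<And>k. k \<in> \<Lambda> \<Longrightarrow> has_weak_partial \<Lambda> k f (g k)" "\<And>k. k \<in> \<Lambda> \<Longrightarrow> g k \<in> L2 (gm \<Lambda> b)"
  shows "f \<in> H1 \<Lambda> (gm \<Lambda> b)"
    and "k \<in> \<Lambda> \<Longrightarrow> AE x in gm \<Lambda> b. weak_partial \<Lambda> k f x = g k x"
proof -
  have ae: "AE x in gm \<Lambda> b. weak_partial \<Lambda> k f x = g k x" if "k \<in> \<Lambda>" for k
    unfolding AE_gm[OF fin] by (rule weak_partial_AE_eq[OF fin g(1)[OF that]])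
  have L: "weak_partial \<Lambda> k f \<in> L2 (gm \<Lambda> b)" if k: "k \<in> \<Lambda>" for k
  proof (rule L2_AE_cong[OF g(2)[OF k]])
    have "locally_integrable \<Lambda> (weak_partial \<Lambda> k f)"
      using has_weak_partial_weak_partial[OF g(1)[OF k]] by (simp add: has_weak_partial_def)
    from locally_integrable_measurable[OF fin this] show "weak_partial \<Lambda> k f \<in> borel_measurable (gm \<Lambda> b)" by simp
    show "AE x in gm \<Lambda> b. g k x = weak_partial \<Lambda> k f x" using ae[OF k] by eventually_elim simp
  qed
  have "\<exists>h. has_weak_partial \<Lambda> k f h" if "k \<in> \<Lambda>" for k by (rule exI[of _ "g k"]) (rule g(1)[OF that])
  then show "f \<in> H1 \<Lambda> (gm \<Lambda> b)" unfolding H1_def using f L by simp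
  show "k \<in> \<Lambda> \<Longrightarrow> AE x in gm \<Lambda> b. weak_partial \<Lambda> k f x = g k x" by (rule ae)
qed

lemma H1_D:
  assumes "f \<in> H1 \<Lambda> (gm \<Lambda> b)"
  shows "f \<in> L2 (gm \<Lambda> b)"
    and "k \<in> \<Lambda> \<Longrightarrow> has_weak_partial \<Lambda> k f (weak_partial \<Lambda> k f)"
    and "k \<in> \<Lambda> \<Longrightarrow> weak_partial \<Lambda> k f \<in> L2 (gm \<Lambda> b)"
proof -
  note h = assms[unfolded H1_def mem_Collect_eq]
  show "f \<in> L2 (gm \<Lambda> b)" by (rule conjunct1[OF h])
  show "weak_partial \<Lambda> k f \<in> L2 (gm \<Lambda> b)" if "k \<in> \<Lambda>" by (rule conjunct2[OF bspec[OF conjunct2[OF h] that]])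
  show "has_weak_partial \<Lambda> k f (weak_partial \<Lambda> k f)" if k: "k \<in> \<Lambda>"
  proof -
    obtain g where "has_weak_partial \<Lambda> k f g" using conjunct1[OF bspec[OF conjunct2[OF h] k]] ..
    then show ?thesis by (rule has_weak_partial_weak_partial)
  qed
qed

lemma dirichlet_AE_eq:
  assumes fin: "finite \<Lambda>"
    and f: "\<And>k. k \<in> \<Lambda> \<Longrightarrow> AE x in gm \<Lambda> b. weak_partial \<Lambda> k f x = g k x"
    and h: "\<And>k. k \<in> \<Lambda> \<Longrightarrow> AE x in gm \<Lambda> b. weak_partial \<Lambda> k h x = g' k x"
    and L: "\<And>k. k \<in> \<Lambda> \<Longrightarrow> g k \<in> L2 (gm \<Lambda> b)" "\<And>k. k \<in> \<Lambda> \<Longrightarrow> g' k \<in> L2 (gm \<Lambda> b)"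
      "f \<in> H1 \<Lambda> (gm \<Lambda> b)" "h \<in> H1 \<Lambda> (gm \<Lambda> b)"
  shows "dirichlet \<Lambda> (gm \<Lambda> b) f h = (\<Sum>k\<in>\<Lambda>. \<integral>x. g k x * g' k x \<partial>gm \<Lambda> b)"
proof -
  note m = L2_D(1)[OF L(1)] L2_D(1)[OF L(2)] L2_D(1)[OF H1_D(3)[OF L(3)]] L2_D(1)[OF H1_D(3)[OF L(4)]]
  have "dirichlet \<Lambda> (gm \<Lambda> b) f h = (\<Sum>k\<in>\<Lambda>. \<integral>x. weak_partial \<Lambda> k f x * weak_partial \<Lambda> k h x \<partial>gm \<Lambda> b)"
    unfolding dirichlet_def
    by (rule Bochner_Integration.integral_sum) (rule L2_mult_integrable[OF H1_D(3)[OF L(3)] H1_D(3)[OF L(4)]])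
  also have "\<dots> = (\<Sum>k\<in>\<Lambda>. \<integral>x. g k x * g' k x \<partial>gm \<Lambda> b)"
  proof (rule sum.cong[OF refl], rule integral_cong_AE)
    fix k assume k: "k \<in> \<Lambda>"
    show "(\<lambda>x. weak_partial \<Lambda> k f x * weak_partial \<Lambda> k h x) \<in> borel_measurable (gm \<Lambda> b)"
      by (rule borel_measurable_times[OF m(3)[OF k] m(4)[OF k]])
    show "(\<lambda>x. g k x * g' k x) \<in> borel_measurable (gm \<Lambda> b)" by (rule borel_measurable_times[OF m(1)[OF k] m(2)[OF k]])
    show "AE x in gm \<Lambda> b. weak_partial \<Lambda> k f x * weak_partial \<Lambda> k h x = g k x * g' k x"
      using f[OF k] h[OF k] by eventually_elim simp
  qed
  finally show ?thesis .
qed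

lemma linear_has_weak_partial:
  fixes \<Lambda> :: "'d site set"
  assumes fin: "finite \<Lambda>" and k: "k \<in> \<Lambda>"
  shows "has_weak_partial \<Lambda> k (\<lambda>x. \<Sum>i\<in>\<Lambda>. c i * x i) (\<lambda>_. c k)"
proof (rule acl_imp_has_weak_partial[OF fin k])
  let ?X = "\<lambda>x. \<Sum>i\<in>\<Lambda>. c i * x i"
  interpret prob_space "gm \<Lambda> b" for b by (rule prob_space_gm[OF fin])
  have l: "locally_integrable \<Lambda> ?X" "locally_integrable \<Lambda> (\<lambda>_. c k)"
    by (rule locally_integrable_gm[OF fin L2_integrable[OF linear_L2[OF fin]]])
      (rule locally_integrable_gm[OF fin L2_integrable[OF L2_const]])
  \<comment> \<open>The primitive starts at \<open>- real n\<close>, so \<open>real n * c k\<close>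
    is subtracted from the value at 0 in the constant of integration.\<close>
  have "line_primitive \<Lambda> k ?X (\<lambda>_. c k) n (\<lambda>x. ?X x - real n * c k)" for n
    unfolding line_primitive_def
  proof (rule AE_I2, rule impI)
    fix x :: "'d config" assume x: "\<forall>i\<in>\<Lambda>. \<bar>x i\<bar> < real n"
    have "?X (x(k := 0)) = ?X x - c k * x k"
    proof -
      have "?X y = c k * y k + (\<Sum>i\<in>\<Lambda> - {k}. c i * y i)" for y by (rule sum.remove[OF fin k])
      moreover have "(\<Sum>i\<in>\<Lambda> - {k}. c i * (x(k := 0)) i) = (\<Sum>i\<in>\<Lambda> - {k}. c i * x i)" by (rule sum.cong) auto
      ultimately show ?thesis by simp
    qed
    moreover have "(LBINT r:{- real n..x k}. c k) = (x k + real n) * c k"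
    proof -
      have "- real n \<le> x k" using bspec[OF x k] by linarith
      then show ?thesis by (simp add: set_lebesgue_integral_def)
    qed
    ultimately show "?X x = ?X (x(k := 0)) - real n * c k + (LBINT r:{- real n..x k}. c k)"
      by (simp add: algebra_simps)
  qed
  then show "acl \<Lambda> k ?X (\<lambda>_. c k)" unfolding acl_def using l by blast
qed

text \<open>The gradient of a linear function is constant, so its Dirichlet form under a probability
  measure is the sum of the squared coefficients.\<close>

lemma linear_variance_le:
  fixes c :: "'d site \<Rightarrow> real"
  assumes fin: "finite \<Lambda>" and P: "poincare \<rho> \<Lambda> (gm \<Lambda> b)"
  defines "X \<equiv> \<lambda>x. \<Sum>i\<in>\<Lambda>. c i * x i"
  shows "(\<integral>x. (X x - (\<integral>y. X y \<partial>gm \<Lambda> b))\<^sup>2 \<partial>gm \<Lambda> b) \<le> 1 / \<rho> * (\<Sum>k\<in>\<Lambda>. (c k)\<^sup>2)"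
proof -
  interpret prob_space "gm \<Lambda> b" by (rule prob_space_gm[OF fin])
  have L: "X \<in> L2 (gm \<Lambda> b)" unfolding X_def by (rule linear_L2[OF fin])
  note w = linear_has_weak_partial[OF fin, where c = c, folded X_def]
  have H: "X \<in> H1 \<Lambda> (gm \<Lambda> b)" by (rule H1I(1)[OF fin L w L2_const])
  have ae: "AE x in gm \<Lambda> b. weak_partial \<Lambda> k X x = c k" if "k \<in> \<Lambda>" for k
    by (rule H1I(2)[OF fin L w L2_const that])
  have "dirichlet \<Lambda> (gm \<Lambda> b) X X = (\<Sum>k\<in>\<Lambda>. \<integral>x. c k * c k \<partial>gm \<Lambda> b)"
    by (rule dirichlet_AE_eq[OF fin ae ae L2_const L2_const H H])
  moreover have "(\<integral>x. c k * c k \<partial>gm \<Lambda> b) = (c k)\<^sup>2" for k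
    by (simp add: prob_space[unfolded space_gm] power2_eq_square)
  ultimately have "dirichlet \<Lambda> (gm \<Lambda> b) X X = (\<Sum>k\<in>\<Lambda>. (c k)\<^sup>2)" by (simp only:)
  then show ?thesis using bspec[OF P[unfolded poincare_def] H] by (simp only:)
qed

end

section \<open>Differentiating conditional expectations in the outer spins\<close>

context block
begin

text \<open>The derivative of the block energy with respect to the outer spin at \<open>j\<close>,
  the 2 being that of \<open>bc\<close>. Conditionally centred, it is minus the logarithmic
  derivative of the conditional density.\<close>

definition ell :: "'d site \<Rightarrow> 'd config \<Rightarrow> real" where
  "ell j x = (\<Sum>i\<in>A. (2 * M i j) * x i)"

lemma ell_mg: "ell j (mg z y) = ell j y"
  unfolding ell_def by (intro sum.cong refl) (simp add: mg_A)

lemma ell_L2: "ell j \<in> L2 mu"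
proof -
  have "ell j = (\<lambda>x. \<Sum>i\<in>B \<union> A. (if i \<in> A then 2 * M i j else 0) * x i)"
    unfolding ell_def using fin by (intro ext sum.mono_neutral_cong_left) auto
  then show ?thesis using linear_L2[OF fin] by simp
qed

lemma ell_L2_mz: "ell j \<in> L2 (mz z)"
  unfolding ell_def[abs_def] by (rule linear_L2[OF finA])

lemma E_ell: "E (ell j) z = (\<integral>y. (\<Sum>i\<in>A. (2 * M i j) * y i) \<partial>mz z)"
  unfolding E_def ell_mg unfolding ell_def ..

definition cov :: "('d config \<Rightarrow> real) \<Rightarrow> 'd site \<Rightarrow> 'd config \<Rightarrow> real" where
  "cov f j z = E (\<lambda>x. f x * ell j x) z - E f z * E (ell j) z"

lemma bc_upd:
  assumes "j \<in> B"
  shows "bc (z(j := t)) = (\<lambda>i. bc (z(j := 0)) i + t * (2 * M i j))"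
proof
  fix i
  have s: "(\<Sum>k\<in>B. M i k * (z(j := t)) k) = M i j * t + (\<Sum>k\<in>B - {j}. M i k * z k)" for t
    by (subst sum.remove[OF finB assms]) (auto intro!: sum.cong)
  show "bc (z(j := t)) i = bc (z(j := 0)) i + t * (2 * M i j)"
    unfolding bc_def s by simp
qed

lemma pA_line:
  assumes j: "j \<in> B" and x: "x \<in> cspace (B \<union> A)"
  shows DERIV_pA: "((\<lambda>t. pA (x(j := t))) has_real_derivative
      - pA (x(j := t)) * (ell j (x(j := t)) - E (ell j) ((restrict x B)(j := t)))) (at t)"
    and isCont_E_ell: "isCont (\<lambda>t. E (ell j) ((restrict x B)(j := t))) t"
proof -
  have jA: "j \<notin> A" using j disj by auto
  have rB: "restrict (x(j := t)) B = (restrict x B)(j := t)" for t using j by (auto simp: fun_eq_iff)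
  have rA: "restrict (x(j := t)) A = restrict x A" for t using jA by (auto simp: fun_eq_iff)
  have e: "ell j (x(j := t)) = (\<Sum>i\<in>A. 2 * M i j * restrict x A i)" for t
    unfolding ell_def using jA by (intro sum.cong) auto
  define b0 where "b0 = bc ((restrict x B)(j := 0))"
  have bcb: "bc ((restrict x B)(j := t)) = (\<lambda>i. b0 i + t * (2 * M i j))" for t
    unfolding b0_def using bc_upd[OF j, of "restrict x B" t] .
  show "((\<lambda>t. pA (x(j := t))) has_real_derivative
      - pA (x(j := t)) * (ell j (x(j := t)) - E (ell j) ((restrict x B)(j := t)))) (at t)"
    unfolding pA_def rB rA e E_ell bcb by (rule DERIV_dens[OF finA])
  show "isCont (\<lambda>t. E (ell j) ((restrict x B)(j := t))) t"
    unfolding E_ell bcb by (rule isCont_gm_linear[OF finA])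
qed

lemma integrable_L2_mu: "f \<in> L2 mu \<Longrightarrow> integrable mu f"
  by (rule prob_space.L2_integrable[OF prob_space_gm[OF fin]])

lemma L2_mu_measurable: "f \<in> L2 mu \<Longrightarrow> f \<in> borel_measurable (leb (B \<union> A))"
  using L2_D(1)[of f mu] by simp

lemma weak_partial_E_slice:
  assumes \<phi>: "\<phi> \<in> L2 mu" and D: "D \<in> L2 mu" and acl: "acl (B \<union> A) j \<phi> D" and j: "j \<in> B"
    and \<eta>: "test_fun (B \<union> A) \<eta>" and y: "y \<in> space (leb A)"
  shows "(\<integral>z. E \<phi> z * partial_deriv j \<eta> (mg z y) \<partial>leb B) = - (\<integral>z. (E D z - cov \<phi> j z) * \<eta> (mg z y) \<partial>leb B)"
proof -
  have j': "j \<in> B \<union> A" and jA: "j \<notin> A" using j disj by auto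
  obtain R where R: "\<And>x i. x \<in> cspace (B \<union> A) \<Longrightarrow> i \<in> B \<union> A \<Longrightarrow> \<bar>x i\<bar> > R \<Longrightarrow> \<eta> x = 0"
    "\<And>j x i. j \<in> B \<union> A \<Longrightarrow> x \<in> cspace (B \<union> A) \<Longrightarrow> i \<in> B \<union> A \<Longrightarrow> \<bar>x i\<bar> > R \<Longrightarrow> partial_deriv j \<eta> x = 0"
    using test_fun_support[OF \<eta>] by metis
  define \<theta> where "\<theta> z = \<eta> (mg z y)" for z
  define \<theta>' where "\<theta>' z = partial_deriv j \<eta> (mg z y)" for z
  have bounded: "\<exists>K. \<forall>z. \<bar>h (mg z y)\<bar> \<le> K"
    if h: "continuous_on (cspace (B \<union> A)) h" and h0: "\<And>x i. x \<in> cspace (B \<union> A) \<Longrightarrow> i \<in> B \<union> A \<Longrightarrow> \<bar>x i\<bar> > R \<Longrightarrow> h x = 0" for h :: "'d config \<Rightarrow> real"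
  proof -
    obtain K where K: "K \<ge> 0" "\<And>x. x \<in> PiE (B \<union> A) (\<lambda>_. {-R..R}) \<Longrightarrow> \<bar>h x\<bar> \<le> K"
      by (rule continuous_on_cspace_bounded[OF h, of R]) (rule that)
    have "\<bar>h (mg z y)\<bar> \<le> K" for z
    proof (cases "mg z y \<in> PiE (B \<union> A) (\<lambda>_. {-R..R})")
      case False
      then obtain i where "i \<in> B \<union> A" "\<not> \<bar>mg z y i\<bar> \<le> R" unfolding cube_iff[OF merge_cspace] by blast
      then have "h (mg z y) = 0" by (intro h0[OF merge_cspace, of i]) (simp_all only: not_le)
      then show ?thesis using K(1) by (simp only: abs_zero)
    qed (rule K(2))
    then show ?thesis by (intro exI allI)
  qed
  have supp: "h (mg z y) = 0"
    if h0: "\<And>x i. x \<in> cspace (B \<union> A) \<Longrightarrow> i \<in> B \<union> A \<Longrightarrow> \<bar>x i\<bar> > R \<Longrightarrow> h x = 0"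
      and z: "z \<in> cspace B" "z \<notin> PiE B (\<lambda>_. {-R..R})" for h :: "'d config \<Rightarrow> real" and z
  proof -
    obtain i where i: "i \<in> B" "\<not> \<bar>z i\<bar> \<le> R" using z(2) unfolding cube_iff[OF z(1)] by blast
    show ?thesis
    proof (rule h0[OF merge_cspace])
      show "i \<in> B \<union> A" using i(1) by simp
      show "R < \<bar>mg z y i\<bar>" using i(2) by (simp only: mg_B[OF i(1)] not_le)
    qed
  qed
  note c\<eta> = test_fun_continuous(1)[OF \<eta>] test_fun_continuous(2)[OF \<eta> j']
  have "\<exists>K. \<forall>z. \<bar>\<theta> z\<bar> \<le> K" unfolding \<theta>_def by (rule bounded[OF c\<eta>(1)]) (rule R(1))
  then obtain K where K: "\<forall>z. \<bar>\<theta> z\<bar> \<le> K" ..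
  have "\<exists>K. \<forall>z. \<bar>\<theta>' z\<bar> \<le> K" unfolding \<theta>'_def by (rule bounded[OF c\<eta>(2)]) (rule R(2)[OF j'])
  then obtain K' where K': "\<forall>z. \<bar>\<theta>' z\<bar> \<le> K'" ..
  have m: "\<theta> \<in> borel_measurable (leb B)" "\<theta>' \<in> borel_measurable (leb B)"
    unfolding \<theta>_def[abs_def] \<theta>'_def[abs_def]
    by (rule section_measurable'[OF continuous_on_cspace_measurable[OF c\<eta>(1)] y],
        rule section_measurable'[OF continuous_on_cspace_measurable[OF c\<eta>(2)] y])
  have s: "\<forall>z\<in>cspace B. z \<notin> PiE B (\<lambda>_. {-R..R}) \<longrightarrow> \<theta> z = 0"
  proof (intro ballI impI)
    fix z assume z: "z \<in> cspace B" "z \<notin> PiE B (\<lambda>_. {-R..R})"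
    show "\<theta> z = 0" unfolding \<theta>_def by (rule supp[where h = \<eta>]) (rule R(1) z | assumption)+
  qed
  have s': "\<forall>z\<in>cspace B. z \<notin> PiE B (\<lambda>_. {-R..R}) \<longrightarrow> \<theta>' z = 0"
  proof (intro ballI impI)
    fix z assume z: "z \<in> cspace B" "z \<notin> PiE B (\<lambda>_. {-R..R})"
    show "\<theta>' z = 0" unfolding \<theta>'_def by (rule supp[where h = "partial_deriv j \<eta>"]) (rule R(2)[OF j'] z | assumption)+
  qed
  note i1 = integrable_L2_mu[OF \<phi>]
  note i2 = L2_mult_integrable[OF \<phi> ell_L2[of j]]
  note i3 = L2_mult_integrable[OF \<phi> E_L2(1)[OF ell_L2[of j]]]
  note i4 = integrable_L2_mu[OF D]
  note W1 = weighted_fold[OF i1 m(2) K' s'] and W2 = weighted_fold[OF i2 m(1) K s]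
    and W3 = weighted_fold[OF i3 m(1) K s] and W4 = weighted_fold[OF i4 m(1) K s]
  \<comment> \<open>The product rule for \<open>pA x * \<theta> (restrict x B)\<close> in the
    direction \<open>j\<close>.\<close>
  define D' where "D' x = pA x * \<theta>' (restrict x B) - (pA x * \<theta> (restrict x B)) * (ell j x - E (ell j) (restrict x B))" for x
  have D'_eq: "\<phi> x * D' x = \<phi> x * (pA x * \<theta>' (restrict x B)) - (\<phi> x * ell j x) * (pA x * \<theta> (restrict x B))
    + (\<phi> x * E (ell j) (restrict x B)) * (pA x * \<theta> (restrict x B))" for x
    by (simp add: D'_def algebra_simps)
  have iD': "integrable (leb (B \<union> A)) (\<lambda>x. \<phi> x * D' x)"
    unfolding D'_eq by (intro Bochner_Integration.integrable_add Bochner_Integration.integrable_diff W1(1) W2(1) W3(1))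
  have "(\<integral>x. \<phi> x * D' x \<partial>leb (B \<union> A)) = - (\<integral>x. D x * (pA x * \<theta> (restrict x B)) \<partial>leb (B \<union> A))"
  proof (rule acl_integration_by_parts[OF fin j' acl _ _ _ iD' W4(1)])
    fix x :: "'d config" and t assume x: "x \<in> cspace (B \<union> A)"
    have rB: "restrict (x(j := t)) B = (restrict x B)(j := t)" for t using j by (auto simp: fun_eq_iff)
    have e: "ell j (x(j := t)) = ell j x" for t
      unfolding ell_def using jA by (intro sum.cong) auto
    have upd: "mg ((restrict x B)(j := t)) y = (mg (restrict x B) y)(j := t)" for t
      using j by (auto simp: merge_def fun_eq_iff)
    have d\<theta>: "((\<lambda>t. \<theta> ((restrict x B)(j := t))) has_real_derivative \<theta>' ((restrict x B)(j := t))) (at t)" for t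
      unfolding \<theta>_def \<theta>'_def upd by (rule test_fun_DERIV[OF \<eta> j' merge_cspace])
    have c\<theta>': "isCont (\<lambda>t. \<theta>' ((restrict x B)(j := t))) t" for t
      unfolding \<theta>'_def upd by (rule test_fun_isCont[OF \<eta> j' merge_cspace])
    show "((\<lambda>t. pA (x(j := t)) * \<theta> (restrict (x(j := t)) B)) has_real_derivative D' (x(j := t))) (at t)"
      unfolding D'_def rB
      by (rule DERIV_cong[OF DERIV_mult[OF DERIV_pA[OF j x] d\<theta>]]) (simp add: algebra_simps)
    show "isCont (\<lambda>t. D' (x(j := t))) t"
      unfolding D'_def rB e
      by (intro continuous_intros DERIV_isCont[OF DERIV_pA[OF j x]] DERIV_isCont[OF d\<theta>] c\<theta>' isCont_E_ell[OF j x])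
  next
    fix x :: "'d config" assume x: "x \<in> cspace (B \<union> A)" "\<bar>x j\<bar> > R"
    have z: "restrict x B \<in> cspace B" by (simp add: PiE_iff)
    have "\<not> \<bar>restrict x B j\<bar> \<le> R" using x(2) j by simp
    then have "restrict x B \<notin> PiE B (\<lambda>_. {-R..R})" unfolding cube_iff[OF z] using j by blast
    then show "pA x * \<theta> (restrict x B) = 0 \<and> D' x = 0"
      unfolding D'_def using bspec[OF s z] bspec[OF s' z] by simp
  qed
  moreover have "(\<integral>x. \<phi> x * D' x \<partial>leb (B \<union> A)) = (\<integral>z. E \<phi> z * \<theta>' z \<partial>leb B)
    - (\<integral>z. E (\<lambda>x. \<phi> x * ell j x) z * \<theta> z \<partial>leb B) + (\<integral>z. E (\<lambda>x. \<phi> x * E (ell j) (restrict x B)) z * \<theta> z \<partial>leb B)"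
    unfolding D'_eq W1(3)[symmetric] W2(3)[symmetric] W3(3)[symmetric]
    by (subst Bochner_Integration.integral_add[OF Bochner_Integration.integrable_diff[OF W1(1) W2(1)] W3(1)],
        subst Bochner_Integration.integral_diff[OF W1(1) W2(1)]) (rule refl)
  moreover have "(\<integral>z. (E D z - cov \<phi> j z) * \<theta> z \<partial>leb B) = (\<integral>z. E D z * \<theta> z \<partial>leb B)
    - (\<integral>z. E (\<lambda>x. \<phi> x * ell j x) z * \<theta> z \<partial>leb B) + (\<integral>z. E (\<lambda>x. \<phi> x * E (ell j) (restrict x B)) z * \<theta> z \<partial>leb B)"
  proof -
    have "(\<integral>z. (E D z - cov \<phi> j z) * \<theta> z \<partial>leb B) = (\<integral>z. E D z * \<theta> z - E (\<lambda>x. \<phi> x * ell j x) z * \<theta> z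
      + E (\<lambda>x. \<phi> x * E (ell j) (restrict x B)) z * \<theta> z \<partial>leb B)"
    proof (rule Bochner_Integration.integral_cong[OF refl])
      fix z assume z: "z \<in> space (leb B)"
      show "(E D z - cov \<phi> j z) * \<theta> z = E D z * \<theta> z - E (\<lambda>x. \<phi> x * ell j x) z * \<theta> z
        + E (\<lambda>x. \<phi> x * E (ell j) (restrict x B)) z * \<theta> z"
        unfolding E_pull_out[OF z] cov_def by (simp add: algebra_simps)
    qed
    then show ?thesis
      by (subst (asm) Bochner_Integration.integral_add[OF Bochner_Integration.integrable_diff[OF W4(2) W2(2)] W3(2)],
          subst (asm) Bochner_Integration.integral_diff[OF W4(2) W2(2)])
  qed
  ultimately show ?thesis
    unfolding W4(3) \<theta>_def[symmetric] \<theta>'_def[symmetric] by linarith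
qed

lemma cov_measurable: "\<phi> \<in> L2 mu \<Longrightarrow> cov \<phi> j \<in> borel_measurable (leb B)"
  unfolding cov_def[abs_def]
  by (intro borel_measurable_diff borel_measurable_times E_measurable L2_mu_measurable ell_L2)

lemma cov_integrable:
  assumes "\<phi> \<in> L2 mu"
  shows "integrable mu (\<lambda>x. cov \<phi> j (restrict x B))"
  unfolding cov_def
proof (rule Bochner_Integration.integrable_diff)
  note i = L2_mult_integrable[OF assms ell_L2[of j]]
  have m: "(\<lambda>x. \<phi> x * ell j x) \<in> borel_measurable (leb (B \<union> A))" using borel_measurable_integrable[OF i] by simp
  show "integrable mu (\<lambda>x. E (\<lambda>x. \<phi> x * ell j x) (restrict x B))"
    by (rule pull_integrable[OF E_measurable[OF m] tower_integrable[OF i]])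
  show "integrable mu (\<lambda>x. E \<phi> (restrict x B) * E (ell j) (restrict x B))"
    by (rule L2_mult_integrable[OF E_L2(1)[OF assms] E_L2(1)[OF ell_L2]])
qed

text \<open>A test function depends on the block spins too. The slice identity holds for each fixed
  value \<open>y\<close> of them and is then integrated over \<open>y\<close>.\<close>

lemma has_weak_partial_E:
  assumes \<phi>: "\<phi> \<in> L2 mu" and D: "D \<in> L2 mu" and w: "has_weak_partial (B \<union> A) j \<phi> D" and j: "j \<in> B"
  shows "has_weak_partial (B \<union> A) j (\<lambda>x. E \<phi> (restrict x B)) (\<lambda>x. E D (restrict x B) - cov \<phi> j (restrict x B))"
  unfolding has_weak_partial_def
proof (intro conjI allI impI)
  have j': "j \<in> B \<union> A" using j by simp
  note acl = has_weak_partial_imp_acl[OF fin j' w]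
  show l1: "locally_integrable (B \<union> A) (\<lambda>x. E \<phi> (restrict x B))"
    by (rule locally_integrable_gm[OF fin integrable_L2_mu[OF E_L2(1)[OF \<phi>]]])
  show l2: "locally_integrable (B \<union> A) (\<lambda>x. E D (restrict x B) - cov \<phi> j (restrict x B))"
    by (rule locally_integrable_gm[OF fin Bochner_Integration.integrable_diff[OF integrable_L2_mu[OF E_L2(1)[OF D]] cov_integrable[OF \<phi>]]])
  fix \<eta> assume \<eta>: "test_fun (B \<union> A) \<eta>"
  have "(\<integral>x. E \<phi> (restrict x B) * partial_deriv j \<eta> x \<partial>leb (B \<union> A))
    = (\<integral>y. \<integral>z. E \<phi> (restrict (mg z y) B) * partial_deriv j \<eta> (mg z y) \<partial>leb B \<partial>leb A)"
    by (rule integral_lebn_merge_swap[OF integrable_times_test_fun(2)[OF fin l1 \<eta> j']])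
  also have "\<dots> = (\<integral>y. - (\<integral>z. (E D (restrict (mg z y) B) - cov \<phi> j (restrict (mg z y) B)) * \<eta> (mg z y) \<partial>leb B) \<partial>leb A)"
  proof (rule Bochner_Integration.integral_cong[OF refl])
    fix y assume y: "y \<in> space (leb A)"
    have "(\<integral>z. E \<phi> (restrict (mg z y) B) * partial_deriv j \<eta> (mg z y) \<partial>leb B) = (\<integral>z. E \<phi> z * partial_deriv j \<eta> (mg z y) \<partial>leb B)"
      by (rule Bochner_Integration.integral_cong[OF refl]) (simp only: restrict_mg_B)
    moreover have "(\<integral>z. (E D (restrict (mg z y) B) - cov \<phi> j (restrict (mg z y) B)) * \<eta> (mg z y) \<partial>leb B)
      = (\<integral>z. (E D z - cov \<phi> j z) * \<eta> (mg z y) \<partial>leb B)"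
      by (rule Bochner_Integration.integral_cong[OF refl]) (simp only: restrict_mg_B)
    ultimately show "(\<integral>z. E \<phi> (restrict (mg z y) B) * partial_deriv j \<eta> (mg z y) \<partial>leb B)
      = - (\<integral>z. (E D (restrict (mg z y) B) - cov \<phi> j (restrict (mg z y) B)) * \<eta> (mg z y) \<partial>leb B)"
      using weak_partial_E_slice[OF \<phi> D acl j \<eta> y] by (simp only:)
  qed
  also have "\<dots> = - (\<integral>x. (E D (restrict x B) - cov \<phi> j (restrict x B)) * \<eta> x \<partial>leb (B \<union> A))"
    by (subst integral_lebn_merge_swap[OF integrable_times_test_fun(1)[OF fin l2 \<eta>]]) (rule integral_minus)
  finally show "(\<integral>x. E \<phi> (restrict x B) * partial_deriv j \<eta> x \<partial>leb (B \<union> A))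
    = - (\<integral>x. (E D (restrict x B) - cov \<phi> j (restrict x B)) * \<eta> x \<partial>leb (B \<union> A))" .
qed

end

text \<open>Minkowski's inequality in squared form: the square is expanded and each mixed term is
  estimated by Cauchy-Schwarz.\<close>

lemma L2_sum_norm_le:
  assumes fin: "finite B" and f: "\<And>k. k \<in> B \<Longrightarrow> f k \<in> L2 N"
    and \<beta>: "\<And>k. k \<in> B \<Longrightarrow> sqrt (\<integral>x. (f k x)\<^sup>2 \<partial>N) \<le> \<beta> k"
  shows "(\<integral>x. (\<Sum>k\<in>B. a k * f k x)\<^sup>2 \<partial>N) \<le> (\<Sum>k\<in>B. \<bar>a k\<bar> * \<beta> k)\<^sup>2"
proof -
  have "(\<integral>x. (\<Sum>k\<in>B. a k * f k x)\<^sup>2 \<partial>N) = (\<integral>x. (\<Sum>k\<in>B. \<Sum>l\<in>B. (a k * a l) * (f k x * f l x)) \<partial>N)"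
    by (intro Bochner_Integration.integral_cong refl) (simp add: power2_eq_square sum_product mult_ac)
  also have "\<dots> = (\<Sum>k\<in>B. \<integral>x. (\<Sum>l\<in>B. (a k * a l) * (f k x * f l x)) \<partial>N)"
    by (rule Bochner_Integration.integral_sum)
      (intro Bochner_Integration.integrable_sum integrable_mult_right L2_mult_integrable f)
  also have "\<dots> = (\<Sum>k\<in>B. \<Sum>l\<in>B. (a k * a l) * (\<integral>x. f k x * f l x \<partial>N))"
  proof (rule sum.cong[OF refl])
    fix k assume k: "k \<in> B"
    have "(\<integral>x. (\<Sum>l\<in>B. (a k * a l) * (f k x * f l x)) \<partial>N) = (\<Sum>l\<in>B. \<integral>x. (a k * a l) * (f k x * f l x) \<partial>N)"
      by (rule Bochner_Integration.integral_sum) (intro integrable_mult_right L2_mult_integrable f k)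
    then show "(\<integral>x. (\<Sum>l\<in>B. (a k * a l) * (f k x * f l x)) \<partial>N) = (\<Sum>l\<in>B. (a k * a l) * (\<integral>x. f k x * f l x \<partial>N))"
      by simp
  qed
  also have "\<dots> \<le> (\<Sum>k\<in>B. \<Sum>l\<in>B. (\<bar>a k\<bar> * \<beta> k) * (\<bar>a l\<bar> * \<beta> l))"
  proof (intro sum_mono)
    fix k l assume kl: "k \<in> B" "l \<in> B"
    have "\<bar>\<integral>x. f k x * f l x \<partial>N\<bar> \<le> sqrt (\<integral>x. (f k x)\<^sup>2 \<partial>N) * sqrt (\<integral>x. (f l x)\<^sup>2 \<partial>N)"
      by (rule integral_Cauchy_Schwarz[OF f[OF kl(1)] f[OF kl(2)]])
    also have "\<dots> \<le> \<beta> k * \<beta> l"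
      by (rule mult_mono[OF \<beta>[OF kl(1)] \<beta>[OF kl(2)]]) (use order_trans[OF _ \<beta>[OF kl(1)]] in auto)
    finally have "\<bar>a k * a l\<bar> * \<bar>\<integral>x. f k x * f l x \<partial>N\<bar> \<le> \<bar>a k * a l\<bar> * (\<beta> k * \<beta> l)"
      by (rule mult_left_mono) simp
    moreover have "(a k * a l) * (\<integral>x. f k x * f l x \<partial>N) \<le> \<bar>a k * a l\<bar> * \<bar>\<integral>x. f k x * f l x \<partial>N\<bar>"
      unfolding abs_mult[symmetric] by (rule abs_ge_self)
    ultimately have "(a k * a l) * (\<integral>x. f k x * f l x \<partial>N) \<le> \<bar>a k * a l\<bar> * (\<beta> k * \<beta> l)" by linarith
    also have "\<dots> = (\<bar>a k\<bar> * \<beta> k) * (\<bar>a l\<bar> * \<beta> l)" by (simp add: abs_mult mult_ac)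
    finally show "(a k * a l) * (\<integral>x. f k x * f l x \<partial>N) \<le> (\<bar>a k\<bar> * \<beta> k) * (\<bar>a l\<bar> * \<beta> l)" .
  qed
  also have "\<dots> = (\<Sum>k\<in>B. \<bar>a k\<bar> * \<beta> k)\<^sup>2" by (simp add: power2_eq_square sum_product)
  finally show ?thesis .
qed

section \<open>The energy estimate on a block\<close>

context block
begin

text \<open>A rough bound whose purpose is to place the covariance in \<open>L2\<close>; the added 1
  keeps the variance bound positive.\<close>

lemma cov_square_le:
  assumes \<rho>: "\<rho> > 0" and P: "poincare \<rho> A (mz z)" and f: "(\<lambda>y. \<phi> (mg z y)) \<in> L2 (mz z)"
  shows "(cov \<phi> j z)\<^sup>2 \<le> (1 / \<rho> * (\<Sum>k\<in>A. (2 * M k j)\<^sup>2) + 1) * E (\<lambda>x. (\<phi> x)\<^sup>2) z"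
proof -
  interpret prob_space "mz z" by (rule prob_mz)
  define V where "V = 1 / \<rho> * (\<Sum>k\<in>A. (2 * M k j)\<^sup>2) + 1"
  have V: "V > 0" unfolding V_def using \<rho> by (intro add_nonneg_pos mult_nonneg_nonneg sum_nonneg) auto
  have var: "(\<integral>y. (ell j y - expectation (ell j))\<^sup>2 \<partial>mz z) \<le> V"
    using linear_variance_le[OF finA P, of "\<lambda>i. 2 * M i j"] by (simp add: ell_def[abs_def] V_def)
  have "cov \<phi> j z = (\<integral>y. \<phi> (mg z y) * ell j y \<partial>mz z) - (\<integral>y. \<phi> (mg z y) \<partial>mz z) * expectation (ell j)"
    by (simp only: cov_def E_def ell_mg)
  also have "\<dots> = (\<integral>y. (\<phi> (mg z y) - (\<integral>y. \<phi> (mg z y) \<partial>mz z)) * (ell j y - expectation (ell j)) \<partial>mz z)"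
    by (rule L2_covariance[OF f ell_L2_mz, symmetric])
  finally have "(cov \<phi> j z)\<^sup>2 = (\<integral>y. (\<phi> (mg z y) - (\<integral>y. \<phi> (mg z y) \<partial>mz z)) * (ell j y - expectation (ell j)) \<partial>mz z)\<^sup>2"
    by (simp only:)
  also have "\<dots> \<le> (\<integral>y. (\<phi> (mg z y) - (\<integral>y. \<phi> (mg z y) \<partial>mz z))\<^sup>2 \<partial>mz z) * V"
    by (rule integral_Cauchy_Schwarz_bound[OF L2_centered[OF f] L2_centered[OF ell_L2_mz] var V])
  also have "\<dots> \<le> (\<integral>y. (\<phi> (mg z y))\<^sup>2 \<partial>mz z) * V"
    unfolding L2_variance[OF f] using V by (intro mult_right_mono) auto
  finally show ?thesis by (simp only: V_def E_def mult.commute)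
qed

lemma cov_L2:
  assumes \<rho>: "\<rho> > 0" and P: "\<And>z. poincare \<rho> A (mz z)" and \<phi>: "\<phi> \<in> L2 mu"
  shows "(\<lambda>x. cov \<phi> j (restrict x B)) \<in> L2 mu"
proof (rule pull_L2(1)[OF cov_measurable[OF \<phi>] \<phi>])
  show "AE z in leb B. (cov \<phi> j z)\<^sup>2 \<le> (1 / \<rho> * (\<Sum>k\<in>A. (2 * M k j)\<^sup>2) + 1) * E (\<lambda>x. (\<phi> x)\<^sup>2) z"
    using L2_section[OF \<phi>]
  proof eventually_elim
    case (elim z)
    show ?case by (rule cov_square_le[OF \<rho> P elim])
  qed
qed

text \<open>Absolute continuity on lines passes to almost every section and gives back weak
  derivatives there. This makes the block Poincare inequality applicable to functions on the whole
  volume, conditionally on the outer spins.\<close>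

lemma H1_section:
  assumes h: "h \<in> H1 (B \<union> A) mu"
  shows "AE z in leb B. (\<lambda>y. h (mg z y)) \<in> H1 A (mz z) \<and>
    dirichlet A (mz z) (\<lambda>y. h (mg z y)) (\<lambda>y. h (mg z y)) = (\<Sum>k\<in>A. E (\<lambda>x. (weak_partial (B \<union> A) k h x)\<^sup>2) z)"
proof -
  define D where "D k = weak_partial (B \<union> A) k h" for k
  have 1: "AE z in leb B. acl A k (\<lambda>y. h (mg z y)) (\<lambda>y. D k (mg z y)) \<and> (\<lambda>y. D k (mg z y)) \<in> L2 (mz z)" if k: "k \<in> A" for k
  proof -
    have k': "k \<in> B \<union> A" using k by simp
    have "acl (B \<union> A) k h (D k)" unfolding D_def by (rule has_weak_partial_imp_acl[OF fin k' H1_D(2)[OF h k']])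
    from acl_merge[OF finA finB disj k this] L2_section[OF H1_D(3)[OF h k', folded D_def]]
    show ?thesis by eventually_elim (rule conjI)
  qed
  have "AE z in leb B. \<forall>k\<in>A. acl A k (\<lambda>y. h (mg z y)) (\<lambda>y. D k (mg z y)) \<and> (\<lambda>y. D k (mg z y)) \<in> L2 (mz z)"
    by (rule AE_finite_allI[OF finA 1])
  then show ?thesis
    using L2_section[OF H1_D(1)[OF h]]
  proof eventually_elim
    case (elim z)
    define g where "g k y = D k (mg z y)" for k y
    have w: "has_weak_partial A k (\<lambda>y. h (mg z y)) (g k)" if "k \<in> A" for k
      unfolding g_def using elim(1) that by (intro acl_imp_has_weak_partial[OF finA]) auto
    have L: "g k \<in> L2 (mz z)" if "k \<in> A" for k unfolding g_def[abs_def] using elim(1) that by blast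
    have H: "(\<lambda>y. h (mg z y)) \<in> H1 A (mz z)" by (rule H1I(1)[where g = g, OF finA elim(2)]) (rule w L, assumption)+
    have ae: "AE y in mz z. weak_partial A k (\<lambda>y. h (mg z y)) y = g k y" if k: "k \<in> A" for k
      unfolding AE_gm[OF finA] by (rule weak_partial_AE_eq[OF finA w[OF k]])
    have "dirichlet A (mz z) (\<lambda>y. h (mg z y)) (\<lambda>y. h (mg z y)) = (\<Sum>k\<in>A. \<integral>y. g k y * g k y \<partial>mz z)"
      by (rule dirichlet_AE_eq[where g = g and g' = g, OF finA]) (fact H | rule ae L, assumption)+
    also have "\<dots> = (\<Sum>k\<in>A. E (\<lambda>x. (D k x)\<^sup>2) z)" unfolding E_def g_def power2_eq_square ..
    finally show ?case using H unfolding D_def by blast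
  qed
qed

text \<open>In block directions \<open>\<phi> - E \<phi>\<close> has the derivatives of
  \<open>\<phi>\<close>, so the tested equation says that block energy plus outer terms is zero.
  Jensen's inequality disposes of the squares in the outer terms; the remaining covariances cost
  half of the block energy plus a term in the couplings across the boundary.\<close>

lemma block_energy_bound:
  assumes \<rho>: "\<rho> > 0" and P: "\<And>z. poincare \<rho> A (mz z)"
    and \<phi>: "weak_solution (B \<union> A) mu f \<phi>" and f: "f \<in> H1 (B \<union> A) mu"
    and inv: "\<And>k. k \<in> A \<Longrightarrow> AE x in leb (B \<union> A). weak_partial (B \<union> A) k f x = 0"
  defines "D \<equiv> \<lambda>k. weak_partial (B \<union> A) k \<phi>"
  shows "(\<Sum>i\<in>A. \<integral>x. (D i x)\<^sup>2 \<partial>mu) \<le>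
    4 / \<rho>\<^sup>2 * (\<Sum>i\<in>A. (\<Sum>k\<in>B. \<bar>M i k\<bar> * sqrt (\<integral>x. (D k x)\<^sup>2 \<partial>mu))\<^sup>2)"
proof -
  interpret P: prob_space mu by (rule prob_space_gm[OF fin])
  have \<phi>H: "\<phi> \<in> H1 (B \<union> A) mu" using \<phi> by (simp add: weak_solution_def)
  have weak_eq: "dirichlet (B \<union> A) mu \<xi> \<phi> = (\<integral>x. \<xi> x * (f x - (\<integral>y. f y \<partial>mu)) \<partial>mu)" if "\<xi> \<in> H1 (B \<union> A) mu" for \<xi>
    using \<phi> that by (simp add: weak_solution_def)
  have wD: "has_weak_partial (B \<union> A) k \<phi> (D k)" and LD: "D k \<in> L2 mu" if "k \<in> B \<union> A" for k
    unfolding D_def by (rule H1_D(2)[OF \<phi>H that], rule H1_D(3)[OF \<phi>H that])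
  have L\<phi>: "\<phi> \<in> L2 mu" by (rule H1_D(1)[OF \<phi>H])
  have Lf: "f \<in> L2 mu" by (rule H1_D(1)[OF f])
  define u where "u x = E \<phi> (restrict x B)" for x
  have Lu: "u \<in> L2 mu" unfolding u_def[abs_def] by (rule E_L2(1)[OF L\<phi>])
  define G where "G k z = E (D k) z" for k z
  define gk where "gk k x = (if k \<in> A then 0 else G k (restrict x B) - cov \<phi> k (restrict x B))" for k x
  have wu: "has_weak_partial (B \<union> A) k u (gk k)" if k: "k \<in> B \<union> A" for k
  proof (cases "k \<in> A")
    case True
    have "has_weak_partial (B \<union> A) k u (\<lambda>_. 0)"
    proof (rule has_weak_partial_of_invariant[OF fin k locally_integrable_gm[OF fin integrable_L2_mu[OF Lu]]])
      fix x :: "'d config" and t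
      have "k \<notin> B" using True disj by auto
      then have "restrict (x(k := t)) B = restrict x B" by (auto simp: fun_eq_iff)
      then show "u (x(k := t)) = u x" by (simp only: u_def)
    qed
    moreover have "gk k = (\<lambda>_. 0)" using True by (simp add: gk_def[abs_def])
    ultimately show ?thesis by (simp only:)
  next
    case False
    then have "k \<in> B" using k by simp
    from has_weak_partial_E[OF L\<phi> LD[OF k] wD[OF k] this]
    show ?thesis using False by (simp only: u_def[abs_def] gk_def[abs_def] G_def if_False)
  qed
  have Lcov: "(\<lambda>x. cov \<phi> k (restrict x B)) \<in> L2 mu" for k by (rule cov_L2[OF \<rho> P L\<phi>])
  have LG: "(\<lambda>x. G k (restrict x B)) \<in> L2 mu" if "k \<in> B \<union> A" for k
    unfolding G_def by (rule E_L2(1)[OF LD[OF that]])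
  have Lgk: "gk k \<in> L2 mu" if "k \<in> B \<union> A" for k
  proof (cases "k \<in> A")
    case True
    then have "gk k = (\<lambda>_. 0)" by (simp add: gk_def[abs_def])
    then show ?thesis using P.L2_const[of 0] by (simp only:)
  next
    case False
    then have "gk k = (\<lambda>x. G k (restrict x B) - cov \<phi> k (restrict x B))" by (simp add: gk_def[abs_def])
    then show ?thesis using L2_diff[OF LG[OF that] Lcov[of k]] by (simp only:)
  qed
  define \<xi> where "\<xi> x = \<phi> x - u x" for x
  define g\<xi> where "g\<xi> k x = D k x - gk k x" for k x
  have L\<xi>: "\<xi> \<in> L2 mu" unfolding \<xi>_def[abs_def] by (rule L2_diff[OF L\<phi> Lu])
  have Lg\<xi>: "g\<xi> k \<in> L2 mu" if "k \<in> B \<union> A" for k unfolding g\<xi>_def[abs_def] by (rule L2_diff[OF LD[OF that] Lgk[OF that]])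
  have w\<xi>: "has_weak_partial (B \<union> A) k \<xi> (g\<xi> k)" if k: "k \<in> B \<union> A" for k
    unfolding \<xi>_def[abs_def] g\<xi>_def[abs_def] by (rule has_weak_partial_diff[OF fin k wD[OF k] wu[OF k]])
  have \<xi>H: "\<xi> \<in> H1 (B \<union> A) mu" by (rule H1I(1)[where g = g\<xi>, OF fin L\<xi>]) (rule w\<xi> Lg\<xi>, assumption)+
  have ae\<xi>: "AE x in mu. weak_partial (B \<union> A) k \<xi> x = g\<xi> k x" if k: "k \<in> B \<union> A" for k
    unfolding AE_gm[OF fin] by (rule weak_partial_AE_eq[OF fin w\<xi>[OF k]])
  have ae\<phi>: "AE x in mu. weak_partial (B \<union> A) k \<phi> x = D k x" for k unfolding D_def by simp
  have dir: "dirichlet (B \<union> A) mu \<xi> \<phi> = (\<Sum>k\<in>B \<union> A. \<integral>x. g\<xi> k x * D k x \<partial>mu)"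
    by (rule dirichlet_AE_eq[where g = g\<xi> and g' = D, OF fin]) (fact \<xi>H \<phi>H | rule ae\<phi> | rule ae\<xi> LD Lg\<xi>, assumption)+
  \<comment> \<open>Conditionally on the outer spins \<open>f\<close> has zero gradient, hence zero
    variance by the block Poincare inequality, while \<open>\<xi>\<close> has conditional mean zero.
    So the right-hand side of the weak equation vanishes.\<close>
  have zero: "(\<integral>x. \<xi> x * (f x - (\<integral>y. f y \<partial>mu)) \<partial>mu) = 0"
  proof -
    define c where "c = (\<integral>y. f y \<partial>mu)"
    have i: "integrable mu (\<lambda>x. \<xi> x * (f x - c))" by (rule L2_mult_integrable[OF L\<xi> L2_diff[OF Lf P.L2_const]])
    have "AE z in leb B. \<forall>k\<in>A. AE y in leb A. weak_partial (B \<union> A) k f (mg z y) = 0"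
      by (rule AE_finite_allI[OF finA AE_lebn_merge[OF finA finB disj inv]])
    then have "AE z in leb B. wt z * E (\<lambda>x. \<xi> x * (f x - c)) z = 0"
      using H1_section[OF f] L2_section[OF L\<phi>] L2_section[OF Lf] AE_space
    proof eventually_elim
      case (elim z)
      interpret prob_space "mz z" by (rule prob_mz)
      have "E (\<lambda>x. (weak_partial (B \<union> A) k f x)\<^sup>2) z = 0" if k: "k \<in> A" for k
        unfolding E_def
      proof (rule integral_eq_zero_AE)
        show "AE y in mz z. (weak_partial (B \<union> A) k f (mg z y))\<^sup>2 = 0"
          unfolding AE_gm[OF finA] using bspec[OF elim(1) k] by eventually_elim simp
      qed
      then have d0: "dirichlet A (mz z) (\<lambda>y. f (mg z y)) (\<lambda>y. f (mg z y)) = 0"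
        unfolding conjunct2[OF elim(2)] by (rule sum.neutral[OF ballI])
      have "(\<integral>y. (f (mg z y) - (\<integral>y. f (mg z y) \<partial>mz z))\<^sup>2 \<partial>mz z) \<le> 0"
        using bspec[OF P[of z, unfolded poincare_def] conjunct1[OF elim(2)]] unfolding d0 by simp
      moreover have "0 \<le> (\<integral>y. (f (mg z y) - (\<integral>y. f (mg z y) \<partial>mz z))\<^sup>2 \<partial>mz z)" by (rule integral_nonneg_AE) simp
      ultimately have v0: "(\<integral>y. (f (mg z y) - (\<integral>y. f (mg z y) \<partial>mz z))\<^sup>2 \<partial>mz z) = 0" by linarith
      define e where "e = (\<integral>y. \<phi> (mg z y) \<partial>mz z)"
      define m where "m = (\<integral>y. f (mg z y) \<partial>mz z)"
      have L1: "(\<lambda>y. \<phi> (mg z y) - e) \<in> L2 (mz z)" and L2': "(\<lambda>y. f (mg z y) - m) \<in> L2 (mz z)"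
        unfolding e_def m_def by (rule L2_centered[OF elim(3)], rule L2_centered[OF elim(4)])
      have "\<bar>\<integral>y. (\<phi> (mg z y) - e) * (f (mg z y) - m) \<partial>mz z\<bar> \<le> 0"
        using integral_Cauchy_Schwarz[OF L1 L2'] v0 unfolding m_def by simp
      then have c0: "(\<integral>y. (\<phi> (mg z y) - e) * (f (mg z y) - m) \<partial>mz z) = 0" by linarith
      have e0: "(\<integral>y. \<phi> (mg z y) - e \<partial>mz z) = 0"
        using L2_integrable[OF elim(3)] by (simp add: e_def prob_space[unfolded space_gm])
      have "E (\<lambda>x. \<xi> x * (f x - c)) z = (\<integral>y. (\<phi> (mg z y) - e) * (f (mg z y) - c) \<partial>mz z)"
        unfolding E_def[of "\<lambda>x. \<xi> x * (f x - c)"] unfolding \<xi>_def u_def restrict_mg_B[OF elim(5)]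
        unfolding E_def e_def ..
      also have "\<dots> = (\<integral>y. (\<phi> (mg z y) - e) * (f (mg z y) - m) + (m - c) * (\<phi> (mg z y) - e) \<partial>mz z)"
        by (intro Bochner_Integration.integral_cong refl) (simp add: algebra_simps)
      also have "\<dots> = (\<integral>y. (\<phi> (mg z y) - e) * (f (mg z y) - m) \<partial>mz z) + (m - c) * (\<integral>y. \<phi> (mg z y) - e \<partial>mz z)"
        by (subst Bochner_Integration.integral_add[OF L2_mult_integrable[OF L1 L2'] integrable_mult_right[OF L2_integrable[OF L1]]])
          (simp only: integral_mult_right_zero)
      finally show ?case by (simp only: c0 e0 mult_zero_right add_0)
    qed
    then have "(\<integral>z. wt z * E (\<lambda>x. \<xi> x * (f x - c)) z \<partial>leb B) = 0" by (rule integral_eq_zero_AE)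
    then show ?thesis using tower_integral[OF i] unfolding c_def by (simp only:)
  qed
  define SA where "SA = (\<Sum>i\<in>A. \<integral>x. (D i x)\<^sup>2 \<partial>mu)"
  have sumA: "(\<Sum>k\<in>A. \<integral>x. g\<xi> k x * D k x \<partial>mu) = SA"
    unfolding SA_def by (rule sum.cong[OF refl]) (simp add: g\<xi>_def gk_def power2_eq_square)
  have iG2: "integrable (leb B) (\<lambda>z. wt z * (G k z)\<^sup>2)" if "k \<in> B" for k
    unfolding G_def by (rule E_L2(2)[OF LD]) (use that in simp)
  have Dgk: "integrable (leb B) (\<lambda>z. wt z * (G k z * (G k z - cov \<phi> k z)))"
    "(\<integral>x. D k x * gk k x \<partial>mu) = (\<integral>z. wt z * (G k z * (G k z - cov \<phi> k z)) \<partial>leb B)" if k: "k \<in> B" for k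
  proof -
    have k': "k \<in> B \<union> A" and kA: "k \<notin> A" using k disj by auto
    note i = L2_mult_integrable[OF LD[OF k'] Lgk[OF k']]
    have Ez: "E (\<lambda>x. D k x * gk k x) z = G k z * (G k z - cov \<phi> k z)" if "z \<in> space (leb B)" for z
      using E_pull_out[OF that, of "D k" "\<lambda>z. G k z - cov \<phi> k z"] kA by (simp only: gk_def if_False G_def)
    show "integrable (leb B) (\<lambda>z. wt z * (G k z * (G k z - cov \<phi> k z)))"
      using tower_integrable[OF i] by (rule Bochner_Integration.integrable_cong[THEN iffD1, rotated -1]) (simp_all only: Ez refl)
    show "(\<integral>x. D k x * gk k x \<partial>mu) = (\<integral>z. wt z * (G k z * (G k z - cov \<phi> k z)) \<partial>leb B)"
      unfolding tower_integral[OF i] by (rule Bochner_Integration.integral_cong[OF refl]) (simp only: Ez)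
  qed
  have icov: "integrable (leb B) (\<lambda>z. wt z * (cov \<phi> k z * G k z))" if k: "k \<in> B" for k
  proof -
    have "wt z * (cov \<phi> k z * G k z) = wt z * (G k z)\<^sup>2 - wt z * (G k z * (G k z - cov \<phi> k z))" for z
      by (simp add: power2_eq_square algebra_simps)
    then show ?thesis using Bochner_Integration.integrable_diff[OF iG2[OF k] Dgk(1)[OF k]] by (simp only:)
  qed
  define t where "t k = (\<integral>z. wt z * (cov \<phi> k z * G k z) \<partial>leb B)" for k
  \<comment> \<open>By Jensen the square of \<open>D k\<close> integrates to at least that of
    \<open>G k\<close>. This cancels the square in \<open>G k * (G k - cov \<phi> k)\<close>, and
    only the covariance term is left.\<close>
  have sumB: "t k \<le> (\<integral>x. g\<xi> k x * D k x \<partial>mu)" if k: "k \<in> B" for k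
  proof -
    have k': "k \<in> B \<union> A" using k by simp
    have "(\<integral>x. g\<xi> k x * D k x \<partial>mu) = (\<integral>x. (D k x)\<^sup>2 - D k x * gk k x \<partial>mu)"
      by (intro Bochner_Integration.integral_cong refl) (simp add: g\<xi>_def power2_eq_square algebra_simps)
    also have "\<dots> = (\<integral>x. (D k x)\<^sup>2 \<partial>mu) - (\<integral>x. D k x * gk k x \<partial>mu)"
      by (rule Bochner_Integration.integral_diff[OF L2_D(2)[OF LD[OF k']] L2_mult_integrable[OF LD[OF k'] Lgk[OF k']]])
    also have "\<dots> \<ge> (\<integral>z. wt z * (G k z)\<^sup>2 \<partial>leb B) - (\<integral>x. D k x * gk k x \<partial>mu)"
    proof -
      have "(\<integral>z. wt z * (G k z)\<^sup>2 \<partial>leb B) = (\<integral>x. (E (D k) (restrict x B))\<^sup>2 \<partial>mu)"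
        unfolding G_def
        by (rule pull_integral[symmetric, OF borel_measurable_power[OF E_measurable[OF L2_mu_measurable[OF LD[OF k']]]] E_L2(2)[OF LD[OF k']]])
      also have "\<dots> \<le> (\<integral>x. (D k x)\<^sup>2 \<partial>mu)" by (rule E_L2(3)[OF LD[OF k']])
      finally show ?thesis by simp
    qed
    also have "(\<integral>z. wt z * (G k z)\<^sup>2 \<partial>leb B) - (\<integral>x. D k x * gk k x \<partial>mu)
      = (\<integral>z. wt z * (G k z)\<^sup>2 - wt z * (G k z * (G k z - cov \<phi> k z)) \<partial>leb B)"
      unfolding Dgk(2)[OF k] by (rule Bochner_Integration.integral_diff[symmetric, OF iG2[OF k] Dgk(1)[OF k]])
    also have "\<dots> = t k" unfolding t_def
      by (intro Bochner_Integration.integral_cong refl) (simp add: power2_eq_square algebra_simps)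
    finally show ?thesis .
  qed
  have "0 = (\<Sum>k\<in>B. \<integral>x. g\<xi> k x * D k x \<partial>mu) + SA"
    using dir weak_eq[OF \<xi>H] zero sumA by (simp only: sum.union_disjoint[OF finB finA disj])
  also have "\<dots> \<ge> (\<Sum>k\<in>B. t k) + SA" using sum_mono[OF sumB] by (intro add_right_mono)
  finally have SA_le: "SA \<le> - (\<Sum>k\<in>B. t k)" by simp
  \<comment> \<open>The functions \<open>ell k\<close> weighted with \<open>G k z\<close> add up to
    the linear function of the block spins with coefficients \<open>c i z\<close>, so all outer
    sites are handled by a single conditional covariance.\<close>
  define c where "c i z = (\<Sum>k\<in>B. (2 * M i k) * G k z)" for i z
  have Lc: "(\<lambda>x. c i (restrict x B)) \<in> L2 mu" for i
    unfolding c_def by (rule L2_sum[OF finB]) (rule L2_cmult[OF LG], simp)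
  have ic: "integrable (leb B) (\<lambda>z. wt z * (c i z)\<^sup>2)" and c_int: "(\<integral>z. wt z * (c i z)\<^sup>2 \<partial>leb B) = (\<integral>x. (c i (restrict x B))\<^sup>2 \<partial>mu)" for i
  proof -
    note i = L2_D(2)[OF Lc[of i]]
    have Ez: "E (\<lambda>x. (c i (restrict x B))\<^sup>2) z = (c i z)\<^sup>2" if "z \<in> space (leb B)" for z
      by (rule E_pull[OF that, of "\<lambda>z. (c i z)\<^sup>2"])
    show "integrable (leb B) (\<lambda>z. wt z * (c i z)\<^sup>2)"
      using tower_integrable[OF i] by (rule Bochner_Integration.integrable_cong[THEN iffD1, rotated -1]) (simp_all only: Ez refl)
    show "(\<integral>z. wt z * (c i z)\<^sup>2 \<partial>leb B) = (\<integral>x. (c i (restrict x B))\<^sup>2 \<partial>mu)"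
      unfolding tower_integral[OF i] by (rule Bochner_Integration.integral_cong[OF refl]) (simp only: Ez)
  qed
  have pointwise: "AE z in leb B. - (\<Sum>k\<in>B. wt z * (cov \<phi> k z * G k z))
    \<le> (\<Sum>i\<in>A. wt z * E (\<lambda>x. (D i x)\<^sup>2) z + wt z * (c i z)\<^sup>2 / \<rho>\<^sup>2) / 2"
    using H1_section[OF \<phi>H] L2_section[OF L\<phi>]
  proof eventually_elim
    case (elim z)
    interpret prob_space "mz z" by (rule prob_mz)
    define F where "F y = \<phi> (mg z y)" for y
    have LF: "F \<in> L2 (mz z)" unfolding F_def[abs_def] by (rule elim(2))
    define X where "X y = (\<Sum>i\<in>A. c i z * y i)" for y :: "'d config"
    have LX: "X \<in> L2 (mz z)" unfolding X_def[abs_def] by (rule linear_L2[OF finA])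
    have X_eq: "X y = (\<Sum>k\<in>B. G k z * ell k y)" for y
      unfolding X_def c_def ell_def sum_distrib_left sum_distrib_right
      by (subst sum.swap) (simp only: mult_ac)
    have iF: "integrable (mz z) (\<lambda>y. F y * ell k y)" for k by (rule L2_mult_integrable[OF LF ell_L2_mz])
    have "(\<Sum>k\<in>B. cov \<phi> k z * G k z) = (\<integral>y. F y * X y \<partial>mz z) - expectation F * expectation X"
    proof -
      have "(\<integral>y. F y * X y \<partial>mz z) = (\<integral>y. (\<Sum>k\<in>B. G k z * (F y * ell k y)) \<partial>mz z)"
        unfolding X_eq by (intro Bochner_Integration.integral_cong refl) (simp add: sum_distrib_left mult_ac)
      also have "\<dots> = (\<Sum>k\<in>B. \<integral>y. G k z * (F y * ell k y) \<partial>mz z)"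
        by (rule Bochner_Integration.integral_sum) (rule integrable_mult_right[OF iF])
      also have "\<dots> = (\<Sum>k\<in>B. G k z * (\<integral>y. F y * ell k y \<partial>mz z))" by simp
      finally have 1: "(\<integral>y. F y * X y \<partial>mz z) = (\<Sum>k\<in>B. G k z * (\<integral>y. F y * ell k y \<partial>mz z))" .
      have "expectation X = (\<Sum>k\<in>B. \<integral>y. G k z * ell k y \<partial>mz z)"
        unfolding X_eq by (rule Bochner_Integration.integral_sum) (rule integrable_mult_right[OF L2_integrable[OF ell_L2_mz]])
      also have "\<dots> = (\<Sum>k\<in>B. G k z * expectation (ell k))" by simp
      finally have 2: "expectation X = (\<Sum>k\<in>B. G k z * expectation (ell k))" .
      have 3: "cov \<phi> k z = (\<integral>y. F y * ell k y \<partial>mz z) - expectation F * expectation (ell k)" for k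
        unfolding cov_def E_def ell_mg F_def[abs_def] ..
      show ?thesis unfolding 1 2 3 by (simp add: sum_subtractf sum_distrib_left algebra_simps)
    qed
    then have "- (\<Sum>k\<in>B. cov \<phi> k z * G k z) \<le> (\<rho> * (\<integral>y. (F y - expectation F)\<^sup>2 \<partial>mz z) + (\<integral>y. (X y - expectation X)\<^sup>2 \<partial>mz z) / \<rho>) / 2"
      using covariance_AM_GM[OF LF LX \<rho>] by (simp only:)
    \<comment> \<open>The first variance is bounded by the block Poincare inequality for the section
      of \<open>\<phi>\<close>, where \<open>\<rho>\<close> cancels; the second by the bound for
      linear functions, which supplies another factor \<open>1 / \<rho>\<close>.\<close>
    also have "\<dots> \<le> ((\<Sum>i\<in>A. E (\<lambda>x. (D i x)\<^sup>2) z) + (\<Sum>i\<in>A. (c i z)\<^sup>2) / \<rho>\<^sup>2) / 2"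
    proof -
      have "(\<integral>y. (F y - expectation F)\<^sup>2 \<partial>mz z) \<le> 1 / \<rho> * (\<Sum>i\<in>A. E (\<lambda>x. (D i x)\<^sup>2) z)"
        using bspec[OF P[of z, unfolded poincare_def] conjunct1[OF elim(1)]]
        unfolding conjunct2[OF elim(1)] D_def F_def .
      then have "\<rho> * (\<integral>y. (F y - expectation F)\<^sup>2 \<partial>mz z) \<le> \<rho> * (1 / \<rho> * (\<Sum>i\<in>A. E (\<lambda>x. (D i x)\<^sup>2) z))"
        using \<rho> by (intro mult_left_mono) auto
      also have "\<dots> = (\<Sum>i\<in>A. E (\<lambda>x. (D i x)\<^sup>2) z)" using \<rho> by simp
      finally have vF: "\<rho> * (\<integral>y. (F y - expectation F)\<^sup>2 \<partial>mz z) \<le> (\<Sum>i\<in>A. E (\<lambda>x. (D i x)\<^sup>2) z)" .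
      have "(\<integral>y. (X y - expectation X)\<^sup>2 \<partial>mz z) / \<rho> \<le> (1 / \<rho> * (\<Sum>i\<in>A. (c i z)\<^sup>2)) / \<rho>"
        using linear_variance_le[OF finA P[of z], of "\<lambda>i. c i z"] \<rho> unfolding X_def by (intro divide_right_mono) auto
      also have "\<dots> = (\<Sum>i\<in>A. (c i z)\<^sup>2) / \<rho>\<^sup>2" by (simp add: power2_eq_square)
      finally show ?thesis using vF by (intro divide_right_mono add_mono) simp_all
    qed
    finally have "wt z * - (\<Sum>k\<in>B. cov \<phi> k z * G k z) \<le> wt z * (((\<Sum>i\<in>A. E (\<lambda>x. (D i x)\<^sup>2) z) + (\<Sum>i\<in>A. (c i z)\<^sup>2) / \<rho>\<^sup>2) / 2)"
      by (rule mult_left_mono) (rule less_imp_le[OF wt_pos])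
    then show ?case by (simp add: sum_distrib_left sum.distrib sum_divide_distrib distrib_left)
  qed
  have "- (\<Sum>k\<in>B. t k) = (\<integral>z. - (\<Sum>k\<in>B. wt z * (cov \<phi> k z * G k z)) \<partial>leb B)"
    unfolding t_def integral_minus by (subst Bochner_Integration.integral_sum[OF icov]) simp_all
  also have "\<dots> \<le> (\<integral>z. (\<Sum>i\<in>A. wt z * E (\<lambda>x. (D i x)\<^sup>2) z + wt z * (c i z)\<^sup>2 / \<rho>\<^sup>2) / 2 \<partial>leb B)"
  proof (rule integral_mono_AE[OF _ _ pointwise])
    show "integrable (leb B) (\<lambda>z. - (\<Sum>k\<in>B. wt z * (cov \<phi> k z * G k z)))"
      by (intro Bochner_Integration.integrable_minus Bochner_Integration.integrable_sum icov)
    show "integrable (leb B) (\<lambda>z. (\<Sum>i\<in>A. wt z * E (\<lambda>x. (D i x)\<^sup>2) z + wt z * (c i z)\<^sup>2 / \<rho>\<^sup>2) / 2)"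
      by (intro integrable_divide Bochner_Integration.integrable_sum Bochner_Integration.integrable_add ic tower_integrable L2_D(2) LD) auto
  qed
  also have "\<dots> = (\<Sum>i\<in>A. (\<integral>x. (D i x)\<^sup>2 \<partial>mu) + (\<integral>x. (c i (restrict x B))\<^sup>2 \<partial>mu) / \<rho>\<^sup>2) / 2"
  proof -
    have iD: "integrable (leb B) (\<lambda>z. wt z * E (\<lambda>x. (D i x)\<^sup>2) z)" if "i \<in> A" for i
      by (rule tower_integrable[OF L2_D(2)[OF LD]]) (use that in simp)
    have "(\<integral>z. (\<Sum>i\<in>A. wt z * E (\<lambda>x. (D i x)\<^sup>2) z + wt z * (c i z)\<^sup>2 / \<rho>\<^sup>2) / 2 \<partial>leb B)
      = (\<integral>z. (\<Sum>i\<in>A. wt z * E (\<lambda>x. (D i x)\<^sup>2) z + wt z * (c i z)\<^sup>2 / \<rho>\<^sup>2) \<partial>leb B) / 2"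
      by (rule integral_divide_zero)
    also have "(\<integral>z. (\<Sum>i\<in>A. wt z * E (\<lambda>x. (D i x)\<^sup>2) z + wt z * (c i z)\<^sup>2 / \<rho>\<^sup>2) \<partial>leb B)
      = (\<Sum>i\<in>A. \<integral>z. wt z * E (\<lambda>x. (D i x)\<^sup>2) z + wt z * (c i z)\<^sup>2 / \<rho>\<^sup>2 \<partial>leb B)"
      by (rule Bochner_Integration.integral_sum) (rule Bochner_Integration.integrable_add[OF iD integrable_divide[OF ic]], assumption)
    also have "\<dots> = (\<Sum>i\<in>A. (\<integral>x. (D i x)\<^sup>2 \<partial>mu) + (\<integral>x. (c i (restrict x B))\<^sup>2 \<partial>mu) / \<rho>\<^sup>2)"
    proof (rule sum.cong[OF refl])
      fix i assume i: "i \<in> A"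
      have i': "i \<in> B \<union> A" using i by simp
      show "(\<integral>z. wt z * E (\<lambda>x. (D i x)\<^sup>2) z + wt z * (c i z)\<^sup>2 / \<rho>\<^sup>2 \<partial>leb B)
        = (\<integral>x. (D i x)\<^sup>2 \<partial>mu) + (\<integral>x. (c i (restrict x B))\<^sup>2 \<partial>mu) / \<rho>\<^sup>2"
        by (subst Bochner_Integration.integral_add[OF iD[OF i] integrable_divide[OF ic]])
          (simp only: tower_integral[OF L2_D(2)[OF LD[OF i']]] integral_divide_zero c_int)
    qed
    finally show ?thesis .
  qed
  also have "\<dots> = (SA + (\<Sum>i\<in>A. (\<integral>x. (c i (restrict x B))\<^sup>2 \<partial>mu)) / \<rho>\<^sup>2) / 2"
    by (simp add: SA_def sum.distrib sum_divide_distrib)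
  \<comment> \<open>The block energy on the right carries the factor 1/2 and is absorbed; doubling
    then clears the factor 1/2 of the other term.\<close>
  finally have "SA \<le> (\<Sum>i\<in>A. (\<integral>x. (c i (restrict x B))\<^sup>2 \<partial>mu)) / \<rho>\<^sup>2" using SA_le by simp
  \<comment> \<open>Conditional expectation does not increase the norm, so \<open>G k\<close> may be
    replaced by \<open>D k\<close>; the square of the factor 2 of the field is the 4 of the
    claim.\<close>
  also have "\<dots> \<le> (\<Sum>i\<in>A. (2 * (\<Sum>k\<in>B. \<bar>M i k\<bar> * sqrt (\<integral>x. (D k x)\<^sup>2 \<partial>mu)))\<^sup>2) / \<rho>\<^sup>2"
  proof (intro divide_right_mono sum_mono)
    fix i
    have "(\<integral>x. (c i (restrict x B))\<^sup>2 \<partial>mu) \<le> (\<Sum>k\<in>B. \<bar>2 * M i k\<bar> * sqrt (\<integral>x. (D k x)\<^sup>2 \<partial>mu))\<^sup>2"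
      unfolding c_def
    proof (rule L2_sum_norm_le[OF finB])
      fix k assume "k \<in> B"
      then have k': "k \<in> B \<union> A" by simp
      show "(\<lambda>x. G k (restrict x B)) \<in> L2 mu" by (rule LG[OF k'])
      show "sqrt (\<integral>x. (G k (restrict x B))\<^sup>2 \<partial>mu) \<le> sqrt (\<integral>x. (D k x)\<^sup>2 \<partial>mu)"
        unfolding G_def by (rule real_sqrt_le_mono[OF E_L2(3)[OF LD[OF k']]])
    qed
    also have "(\<Sum>k\<in>B. \<bar>2 * M i k\<bar> * sqrt (\<integral>x. (D k x)\<^sup>2 \<partial>mu)) = 2 * (\<Sum>k\<in>B. \<bar>M i k\<bar> * sqrt (\<integral>x. (D k x)\<^sup>2 \<partial>mu))"
      by (simp add: abs_mult sum_distrib_left mult.assoc)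
    finally show "(\<integral>x. (c i (restrict x B))\<^sup>2 \<partial>mu) \<le> (2 * (\<Sum>k\<in>B. \<bar>M i k\<bar> * sqrt (\<integral>x. (D k x)\<^sup>2 \<partial>mu)))\<^sup>2" .
  qed simp
  also have "\<dots> = 4 / \<rho>\<^sup>2 * (\<Sum>i\<in>A. (\<Sum>k\<in>B. \<bar>M i k\<bar> * sqrt (\<integral>x. (D k x)\<^sup>2 \<partial>mu))\<^sup>2)"
    unfolding power_mult_distrib sum_distrib_left[symmetric] by simp
  finally show ?thesis unfolding SA_def .
qed

end

section \<open>Block measures as Gibbs measures, and the total energy\<close>

context spin_system
begin

lemma gm_cong: "(\<And>i. i \<in> \<Lambda> \<Longrightarrow> b i = b' i) \<Longrightarrow> gm \<Lambda> b = gm \<Lambda> b'"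
proof -
  assume *: "\<And>i. i \<in> \<Lambda> \<Longrightarrow> b i = b' i"
  have "U \<Lambda> b = U \<Lambda> b'" unfolding U_def using * by (intro ext arg_cong2[where f = "(+)"] sum.cong) auto
  then show ?thesis by (simp add: gm_def dens_def[abs_def] Z_def)
qed

text \<open>Freezing \<open>z\<close> on the finite set \<open>B\<close> prescribes the boundary
  condition at finitely many further sites, which preserves summability. The uniform Poincare
  hypothesis therefore covers the block measures for all \<open>z\<close>.\<close>

lemma gm_eq_gibbs_of_block:
  assumes fin: "finite B" and disj: "B \<inter> A = {}" and wt: "well_tempered M (B \<union> A) \<omega>"
    and b: "b = (\<lambda>i. s i + 2 * (\<Sum>\<^sub>\<infinity>j\<in>- (B \<union> A). M i j * \<omega> j))"
  defines "\<omega>' \<equiv> \<lambda>z j. if j \<in> B then z j else \<omega> j"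
  shows "gm A (\<lambda>i. b i + 2 * (\<Sum>j\<in>B. M i j * z j)) = gibbs \<psi> s M A (\<omega>' z)"
    and "well_tempered M A (\<omega>' z)"
proof -
  have un: "- A = - (B \<union> A) \<union> B" and di: "- (B \<union> A) \<inter> B = {}" using disj by auto
  have sm: "(\<lambda>j. \<bar>M i j\<bar> * \<bar>\<omega>' z j\<bar>) summable_on - (B \<union> A)" if "i \<in> A" for i
  proof -
    have "(\<lambda>j. \<bar>M i j\<bar> * \<bar>\<omega> j\<bar>) summable_on - (B \<union> A)" using wt that by (simp add: well_tempered_def)
    then show ?thesis by (rule summable_on_cong[THEN iffD1, rotated]) (simp add: \<omega>'_def)
  qed
  show "well_tempered M A (\<omega>' z)"
    unfolding well_tempered_def un by (intro ballI summable_on_Un_disjoint[OF sm _ di] summable_on_finite fin)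
  show "gm A (\<lambda>i. b i + 2 * (\<Sum>j\<in>B. M i j * z j)) = gibbs \<psi> s M A (\<omega>' z)"
    unfolding gibbs_eq_gm
  proof (rule gm_cong)
    fix i assume i: "i \<in> A"
    have "(\<lambda>j. M i j * \<omega>' z j) summable_on - (B \<union> A)"
      by (rule abs_summable_summable) (use sm[OF i] in \<open>simp add: abs_mult\<close>)
    then have "(\<Sum>\<^sub>\<infinity>j\<in>- A. M i j * \<omega>' z j) = (\<Sum>\<^sub>\<infinity>j\<in>- (B \<union> A). M i j * \<omega>' z j) + (\<Sum>\<^sub>\<infinity>j\<in>B. M i j * \<omega>' z j)"
      unfolding un by (rule infsum_Un_disjoint[OF _ summable_on_finite[OF fin] di])
    also have "(\<Sum>\<^sub>\<infinity>j\<in>- (B \<union> A). M i j * \<omega>' z j) = (\<Sum>\<^sub>\<infinity>j\<in>- (B \<union> A). M i j * \<omega> j)"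
      by (rule infsum_cong) (simp add: \<omega>'_def)
    also have "(\<Sum>\<^sub>\<infinity>j\<in>B. M i j * \<omega>' z j) = (\<Sum>j\<in>B. M i j * z j)"
      using fin by (simp add: \<omega>'_def)
    finally show "b i + 2 * (\<Sum>j\<in>B. M i j * z j) = s i + 2 * (\<Sum>\<^sub>\<infinity>j\<in>- A. M i j * \<omega>' z j)"
      unfolding b by simp
  qed
qed

lemma dirichlet_self:
  assumes fin: "finite \<Lambda>" and h: "h \<in> H1 \<Lambda> (gm \<Lambda> b)"
  shows "dirichlet \<Lambda> (gm \<Lambda> b) h h = (\<Sum>k\<in>\<Lambda>. \<integral>x. (weak_partial \<Lambda> k h x)\<^sup>2 \<partial>gm \<Lambda> b)"
  unfolding dirichlet_def power2_eq_square
  by (rule Bochner_Integration.integral_sum) (rule L2_mult_integrable[OF H1_D(3)[OF h] H1_D(3)[OF h]])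

text \<open>The equation is tested with \<open>\<phi>\<close> itself; both variances go through the
  Poincare inequality, and half of the energy of \<open>\<phi>\<close> is absorbed.\<close>

lemma weak_solution_energy_le:
  assumes fin: "finite \<Lambda>" and \<rho>: "\<rho> > 0" and P: "poincare \<rho> \<Lambda> (gm \<Lambda> b)"
    and f: "f \<in> H1 \<Lambda> (gm \<Lambda> b)" and \<phi>: "weak_solution \<Lambda> (gm \<Lambda> b) f \<phi>"
  shows "dirichlet \<Lambda> (gm \<Lambda> b) \<phi> \<phi> \<le> 1 / \<rho>\<^sup>2 * dirichlet \<Lambda> (gm \<Lambda> b) f f"
proof -
  interpret prob_space "gm \<Lambda> b" by (rule prob_space_gm[OF fin])
  have \<phi>H: "\<phi> \<in> H1 \<Lambda> (gm \<Lambda> b)" using \<phi> by (simp add: weak_solution_def)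
  note L\<phi> = H1_D(1)[OF \<phi>H] and Lf = H1_D(1)[OF f]
  \<comment> \<open>The change of sign turns the lower bound of \<open>covariance_AM_GM\<close> into
    an upper bound for the covariance of \<open>\<phi>\<close> and \<open>f\<close>.\<close>
  define h where "h x = (-1) * f x" for x
  have Lh: "h \<in> L2 (gm \<Lambda> b)" unfolding h_def[abs_def] by (rule L2_cmult[OF Lf])
  have eh: "expectation h = - expectation f" unfolding h_def by simp
  have "dirichlet \<Lambda> (gm \<Lambda> b) \<phi> \<phi> = (\<integral>x. \<phi> x * (f x - expectation f) \<partial>gm \<Lambda> b)"
    using \<phi> \<phi>H by (simp add: weak_solution_def)
  also have "\<dots> = (\<integral>x. \<phi> x * f x - expectation f * \<phi> x \<partial>gm \<Lambda> b)"
    by (intro Bochner_Integration.integral_cong refl) (simp add: algebra_simps)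
  also have "\<dots> = (\<integral>x. \<phi> x * f x \<partial>gm \<Lambda> b) - expectation f * expectation \<phi>"
    by (subst Bochner_Integration.integral_diff[OF L2_mult_integrable[OF L\<phi> Lf] integrable_mult_right[OF L2_integrable[OF L\<phi>]]])
      (simp only: integral_mult_right_zero)
  also have "\<dots> = - ((\<integral>x. \<phi> x * h x \<partial>gm \<Lambda> b) - expectation \<phi> * expectation h)"
    unfolding eh by (simp add: h_def)
  also have "\<dots> \<le> (\<rho> * (\<integral>x. (\<phi> x - expectation \<phi>)\<^sup>2 \<partial>gm \<Lambda> b) + (\<integral>x. (h x - expectation h)\<^sup>2 \<partial>gm \<Lambda> b) / \<rho>) / 2"
    by (rule covariance_AM_GM[OF L\<phi> Lh \<rho>])
  also have "(\<integral>x. (h x - expectation h)\<^sup>2 \<partial>gm \<Lambda> b) = (\<integral>x. (f x - expectation f)\<^sup>2 \<partial>gm \<Lambda> b)"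
    unfolding eh by (intro Bochner_Integration.integral_cong refl) (simp add: h_def power2_commute)
  also have "(\<rho> * (\<integral>x. (\<phi> x - expectation \<phi>)\<^sup>2 \<partial>gm \<Lambda> b) + (\<integral>x. (f x - expectation f)\<^sup>2 \<partial>gm \<Lambda> b) / \<rho>) / 2
    \<le> (\<rho> * (1 / \<rho> * dirichlet \<Lambda> (gm \<Lambda> b) \<phi> \<phi>) + (1 / \<rho> * dirichlet \<Lambda> (gm \<Lambda> b) f f) / \<rho>) / 2"
    using \<rho> bspec[OF P[unfolded poincare_def] \<phi>H] bspec[OF P[unfolded poincare_def] f]
    by (intro divide_right_mono add_mono mult_left_mono) auto
  also have "\<dots> = (dirichlet \<Lambda> (gm \<Lambda> b) \<phi> \<phi> + 1 / \<rho>\<^sup>2 * dirichlet \<Lambda> (gm \<Lambda> b) f f) / 2"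
    using \<rho> by (simp add: power2_eq_square)
  finally show ?thesis by simp
qed

lemma weak_partial_zero_off_supp:
  assumes fin: "finite \<Lambda>" and f: "f \<in> H1 \<Lambda> (gm \<Lambda> b)" and k: "k \<in> \<Lambda>" "k \<notin> site_supp \<Lambda> f"
  shows "AE x in leb \<Lambda>. weak_partial \<Lambda> k f x = 0"
proof -
  have "AE x in leb \<Lambda>. AE t in lborel. f (x(k := t)) = f x"
    using k by (simp add: site_supp_def)
  moreover have "locally_integrable \<Lambda> f" using H1_D(2)[OF f k(1)] by (simp add: has_weak_partial_def)
  ultimately have "has_weak_partial \<Lambda> k f (\<lambda>_. 0)" by (intro has_weak_partial_of_AE_invariant fin k)
  then show ?thesis by (rule weak_partial_AE_eq[OF fin])
qed

end

section \<open>From the block estimate to decay in the distance from the support\<close>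

lemma site_norm_ge_site_dist:
  assumes "finite S" "j \<in> S"
  shows "site_dist i S \<le> site_norm (j - i)"
  unfolding site_dist_def site_norm_commute[of j i] using assms by (intro Min_le) auto

theorem theorem4p2:
  fixes C\<^sub>M \<alpha>\<^sub>M \<rho> \<delta> C\<^sub>\<psi> :: real
  assumes "C\<^sub>M > 0" "\<alpha>\<^sub>M > 0" "\<rho> > 0" "\<delta> > 0"
  shows "\<exists>C>0. \<forall>(\<psi> :: 'd::finite site \<Rightarrow> real \<Rightarrow> real) (s :: 'd site \<Rightarrow> real)
            (M :: 'd site \<Rightarrow> 'd site \<Rightarrow> real).
      (\<forall>i j. M i j = M j i) \<longrightarrow>
      diag_dominant \<delta> M \<longrightarrow>
      perturbed_convex C\<^sub>\<psi> \<psi> \<longrightarrow>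
      (\<forall>i j. \<bar>M i j\<bar> \<le> C\<^sub>M * (1 + real_of_int (site_norm (i - j))) powr (- (2 * real CARD('d) + \<alpha>\<^sub>M))) \<longrightarrow>
      (\<forall>\<Lambda> \<omega>. finite \<Lambda> \<longrightarrow> well_tempered M \<Lambda> \<omega> \<longrightarrow> poincare \<rho> \<Lambda> (gibbs \<psi> s M \<Lambda> \<omega>)) \<longrightarrow>
      (\<forall>\<Lambda> \<omega>. finite \<Lambda> \<longrightarrow> well_tempered M \<Lambda> \<omega> \<longrightarrow>
        (\<forall>f\<in>H1 \<Lambda> (gibbs \<psi> s M \<Lambda> \<omega>). site_supp \<Lambda> f \<subseteq> \<Lambda> \<longrightarrow>
          (\<forall>i\<in>\<Lambda>. \<forall>\<phi>. weak_solution \<Lambda> (gibbs \<psi> s M \<Lambda> \<omega>) f \<phi> \<longrightarrow>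
            (\<integral>x. (weak_partial \<Lambda> i \<phi> x)\<^sup>2 \<partial>gibbs \<psi> s M \<Lambda> \<omega>) \<le>
              C * (real (card (site_supp \<Lambda> f)) /
                   (1 + real_of_int (site_dist i (site_supp \<Lambda> f))) powr (2 * real CARD('d) + \<alpha>\<^sub>M))
                * dirichlet \<Lambda> (gibbs \<psi> s M \<Lambda> \<omega>) f f)))"
proof -
  define p where "p = 2 * real CARD('d) + \<alpha>\<^sub>M"
  have Q: "4 / \<rho>\<^sup>2 \<ge> 0" by simp
  \<comment> \<open>The block estimate enters with the constant \<open>4 / \<rho>\<^sup>2\<close>,
    so \<open>C'\<close> depends on the dimension, \<open>C\<^sub>M\<close>,
    \<open>\<alpha>\<^sub>M\<close> and \<open>\<rho>\<close>.\<close>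
  obtain C' where C': "C' > 0" and decay: "\<forall>(M :: 'd site \<Rightarrow> 'd site \<Rightarrow> real) b \<Lambda> i m.
    (\<forall>i j. \<bar>M i j\<bar> \<le> C\<^sub>M * (1 + real_of_int (site_norm (i - j))) powr (- (2 * real CARD('d) + \<alpha>\<^sub>M))) \<longrightarrow>
    finite \<Lambda> \<longrightarrow> i \<in> \<Lambda> \<longrightarrow> (\<forall>j. b j \<ge> 0) \<longrightarrow>
    (\<forall>r<m. (\<Sum>k\<in>{k\<in>\<Lambda>. site_norm (k - i) \<le> int r}. (b k)\<^sup>2) \<le>
      4 / \<rho>\<^sup>2 * (\<Sum>k\<in>{k\<in>\<Lambda>. site_norm (k - i) \<le> int r}.
            (\<Sum>j\<in>{j\<in>\<Lambda>. \<not> site_norm (j - i) \<le> int r}. \<bar>M k j\<bar> * b j)\<^sup>2)) \<longrightarrow>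
    (b i)\<^sup>2 \<le> C' * (1 + real m) powr (- (2 * real CARD('d) + \<alpha>\<^sub>M)) * (\<Sum>k\<in>\<Lambda>. (b k)\<^sup>2)"
    using decay_of_hole_filling[OF assms(1,2) Q, where ?'d = 'd] by blast
  have main: "(\<integral>x. (weak_partial \<Lambda> i \<phi> x)\<^sup>2 \<partial>gibbs \<psi> s M \<Lambda> \<omega>) \<le>
      C' / \<rho>\<^sup>2 * (real (card (site_supp \<Lambda> f)) / (1 + real_of_int (site_dist i (site_supp \<Lambda> f))) powr p)
        * dirichlet \<Lambda> (gibbs \<psi> s M \<Lambda> \<omega>) f f"
    if sym: "\<forall>i j. M i j = M j i" and dd: "diag_dominant \<delta> M" and pc: "perturbed_convex C\<^sub>\<psi> \<psi>"
      and Mb: "\<forall>i j. \<bar>M i j\<bar> \<le> C\<^sub>M * (1 + real_of_int (site_norm (i - j))) powr (- (2 * real CARD('d) + \<alpha>\<^sub>M))"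
      and P: "\<forall>\<Lambda> \<omega>. finite \<Lambda> \<longrightarrow> well_tempered M \<Lambda> \<omega> \<longrightarrow> poincare \<rho> \<Lambda> (gibbs \<psi> s M \<Lambda> \<omega>)"
      and fin: "finite \<Lambda>" and wt: "well_tempered M \<Lambda> \<omega>"
      and f: "f \<in> H1 \<Lambda> (gibbs \<psi> s M \<Lambda> \<omega>)" and i: "i \<in> \<Lambda>"
      and \<phi>: "weak_solution \<Lambda> (gibbs \<psi> s M \<Lambda> \<omega>) f \<phi>"
    for \<psi> :: "'d site \<Rightarrow> real \<Rightarrow> real" and s and M :: "'d site \<Rightarrow> 'd site \<Rightarrow> real" and \<Lambda> \<omega> f i \<phi>
  proof -
    interpret spin_system \<psi> M \<delta> C\<^sub>\<psi> by unfold_locales (use sym dd pc assms(4) in blast)+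
    define b where "b = (\<lambda>i. s i + 2 * (\<Sum>\<^sub>\<infinity>j\<in>- \<Lambda>. M i j * \<omega> j))"
    have gb: "gibbs \<psi> s M \<Lambda> \<omega> = gm \<Lambda> b" unfolding b_def by (rule gibbs_eq_gm)
    note f' = f[unfolded gb] and \<phi>' = \<phi>[unfolded gb]
    have P\<Lambda>: "poincare \<rho> \<Lambda> (gm \<Lambda> b)" using P fin wt unfolding gb[symmetric] by blast
    have \<phi>H: "\<phi> \<in> H1 \<Lambda> (gm \<Lambda> b)" using \<phi>' by (simp add: weak_solution_def)
    define S where "S = site_supp \<Lambda> f"
    have S: "finite S" "S \<subseteq> \<Lambda>" using fin by (auto simp: S_def site_supp_def)
    define D where "D k = (\<integral>x. (weak_partial \<Lambda> k \<phi> x)\<^sup>2 \<partial>gm \<Lambda> b)" for k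
    have D0: "D k \<ge> 0" for k unfolding D_def by (rule integral_nonneg_AE) simp
    \<comment> \<open>Any part \<open>A\<close> of the volume that misses the support may serve as
      block.\<close>
    have key: "(\<Sum>k\<in>A. D k) \<le> 4 / \<rho>\<^sup>2 * (\<Sum>k\<in>A. (\<Sum>j\<in>B. \<bar>M k j\<bar> * sqrt (D j))\<^sup>2)"
      if AB: "\<Lambda> = B \<union> A" "B \<inter> A = {}" and AS: "A \<inter> S = {}" for A B
    proof -
      interpret blk: block \<psi> M \<delta> C\<^sub>\<psi> A B b
        by unfold_locales (use AB fin in auto)
      have PA: "poincare \<rho> A (gm A (blk.bc z))" for z
      proof -
        have bc: "blk.bc z = (\<lambda>i. b i + 2 * (\<Sum>j\<in>B. M i j * z j))" by (simp add: blk.bc_def fun_eq_iff)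
        have finB: "finite B" and finA: "finite A" using AB fin by auto
        note g = gm_eq_gibbs_of_block[OF finB AB(2) wt[unfolded AB(1)] b_def[unfolded AB(1)], of z]
        show ?thesis unfolding bc g(1) using P finA g(2) by blast
      qed
      have inv: "AE x in leb (B \<union> A). weak_partial (B \<union> A) k f x = 0" if k: "k \<in> A" for k
        using weak_partial_zero_off_supp[OF fin f', of k] AS k unfolding AB(1)[symmetric] S_def[symmetric]
        using AB(1) by blast
      show ?thesis
        unfolding D_def AB(1)
        by (rule blk.block_energy_bound[OF assms(3) PA \<phi>'[unfolded AB(1)] f'[unfolded AB(1)] inv])
    qed
    show ?thesis
    proof (cases "S = {}")
      \<comment> \<open>With empty support the right-hand side is zero. The block
        \<open>A = \<Lambda>\<close> without outer spins shows that the whole energy of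
        \<open>\<phi>\<close> vanishes.\<close>
      case True
      have "(\<Sum>k\<in>\<Lambda>. D k) \<le> 4 / \<rho>\<^sup>2 * (\<Sum>k\<in>\<Lambda>. (\<Sum>j\<in>{}. \<bar>M k j\<bar> * sqrt (D j))\<^sup>2)"
        by (rule key) (use True in auto)
      then have "(\<Sum>k\<in>\<Lambda>. D k) \<le> 0" by simp
      moreover have "D i \<le> (\<Sum>k\<in>\<Lambda>. D k)" by (rule member_le_sum[OF i D0 fin])
      ultimately have "D i \<le> 0" by simp
      then show ?thesis using True unfolding gb D_def S_def by simp
    next
      case False
      \<comment> \<open>Balls of radius below the distance miss the support, so the block estimate
        holds for all radii below \<open>m\<close>.\<close>
      define m where "m = nat (site_dist i S)"
      have dist0: "site_dist i S \<ge> 0"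
        unfolding site_dist_def using S(1) False by (subst Min_ge_iff) (auto simp: site_norm_nonneg)
      define \<beta> where "\<beta> k = sqrt (D k)" for k
      have \<beta>2: "(\<beta> k)\<^sup>2 = D k" for k unfolding \<beta>_def using D0 by simp
      have "(\<beta> i)\<^sup>2 \<le> C' * (1 + real m) powr (- (2 * real CARD('d) + \<alpha>\<^sub>M)) * (\<Sum>k\<in>\<Lambda>. (\<beta> k)\<^sup>2)"
      proof (rule decay[rule_format, OF spec[OF spec[OF Mb]] fin i])
        show "\<beta> j \<ge> 0" for j unfolding \<beta>_def using D0 by simp
        fix r assume r: "r < m"
        have disj: "{k\<in>\<Lambda>. site_norm (k - i) \<le> int r} \<inter> S = {}"
        proof -
          have "\<not> site_norm (k - i) \<le> int r" if "k \<in> S" for k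
            using site_norm_ge_site_dist[OF S(1) that, of i] r unfolding m_def by linarith
          then show ?thesis by blast
        qed
        show "(\<Sum>k\<in>{k\<in>\<Lambda>. site_norm (k - i) \<le> int r}. (\<beta> k)\<^sup>2) \<le>
          4 / \<rho>\<^sup>2 * (\<Sum>k\<in>{k\<in>\<Lambda>. site_norm (k - i) \<le> int r}.
            (\<Sum>j\<in>{j\<in>\<Lambda>. \<not> site_norm (j - i) \<le> int r}. \<bar>M k j\<bar> * \<beta> j)\<^sup>2)"
          unfolding \<beta>2 unfolding \<beta>_def by (rule key[OF _ _ disj]) auto
      qed
      then have "D i \<le> C' * (1 + real m) powr (- p) * dirichlet \<Lambda> (gm \<Lambda> b) \<phi> \<phi>"
        unfolding \<beta>2 p_def dirichlet_self[OF fin \<phi>H] D_def .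
      also have "\<dots> \<le> C' * (1 + real m) powr (- p) * (1 / \<rho>\<^sup>2 * dirichlet \<Lambda> (gm \<Lambda> b) f f)"
        using C' by (intro mult_left_mono weak_solution_energy_le[OF fin assms(3) P\<Lambda> f' \<phi>']) auto
      also have "\<dots> = C' / \<rho>\<^sup>2 * (1 / (1 + real_of_int (site_dist i S)) powr p) * dirichlet \<Lambda> (gm \<Lambda> b) f f"
        using dist0 by (simp add: m_def powr_minus field_simps)
      also have "\<dots> \<le> C' / \<rho>\<^sup>2 * (real (card S) / (1 + real_of_int (site_dist i S)) powr p) * dirichlet \<Lambda> (gm \<Lambda> b) f f"
      proof -
        \<comment> \<open>The support is nonempty, so its cardinality is at least 1 and can be
          inserted as a factor.\<close>
        have "card S \<ge> 1" using S(1) False by (simp add: Suc_le_eq card_gt_0_iff)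
        then have "1 / (1 + real_of_int (site_dist i S)) powr p \<le> real (card S) / (1 + real_of_int (site_dist i S)) powr p"
          by (intro divide_right_mono) auto
        moreover have "dirichlet \<Lambda> (gm \<Lambda> b) f f \<ge> 0"
          unfolding dirichlet_self[OF fin f'] by (intro sum_nonneg integral_nonneg_AE) simp
        ultimately show ?thesis using C' by (intro mult_right_mono mult_left_mono) auto
      qed
      finally show ?thesis unfolding gb D_def S_def .
    qed
  qed
  have "C' / \<rho>\<^sup>2 > 0" using C' assms(3) by simp
  then show ?thesis
    unfolding p_def[symmetric] using main[unfolded p_def[symmetric]]
    by (intro exI[of _ "C' / \<rho>\<^sup>2"] conjI allI impI ballI) blast+
qed

end
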